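(* There is an algorithm for \textsc{Distinct Kemeny Ranking Aggregation} which, on an instance $(\mathcal{C},\Pi,k,r)$ with $m=|\mathcal{C}|$, runs in time $O^*(2^m r^{O(1)})$. In particular, \textsc{Distinct Kemeny Ranking Aggregation} and \textsc{Distinct OPT Kemeny Ranking Aggregation} are fixed-parameter tractable parameterized by the number $m$ of candidates.
   Context: Let $\mathcal{C}$ be a set of $m$ candidates and $\Pi$ a multiset of rankings (complete linear orders) of $\mathcal{C}$. The Kendall-Tau distance $d_{KT}(\pi,\sigma)$ is the number of pairs of candidates that two rankings order differently. The Kemeny score of a ranking $Q$ is $\mathrm{Kemeny}_\Pi(Q)=\sum_{\pi\in\Pi} d_{KT}(Q,\pi)$; a Kemeny ranking minimizes it. $K(\Pi)$ denotes the set of Kemeny rankings and $K(\Pi,k)$ the set of rankings of Kemeny score at most $k$. A ranking respects the unanimity order of $\Pi$ if it places $x$ before $y$ whenever all rankings in $\Pi$ do. \textsc{Distinct Kemeny Ranking Aggregation}: given $(\mathcal{C},\Pi,k,r)$, output $\min\{r,|K(\Pi,k)|\}$ distinct rankings, each of Kemeny score at most $k$ and respecting the unanimity order. \textsc{Distinct OPT Kemeny Ranking Aggregation}: given $(\mathcal{C},\Pi,r)$, output $\min\{r,|K(\Pi)|\}$ distinct Kemeny rankings. $O^*(g)$ denotes $O(g\cdot \mathrm{poly}(\text{input size}))$.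
   Formalization: Distinct Kemeny Ranking Aggregation asks for min{r, number of rankings in K(Π,k) respecting unanimity}, since with |K(Π,k)| some instances have no answer (two candidates, unanimous votes, large k, r=2); answers agree whenever the original has one. r^{O(1)} is read as max(1,r)^{O(1)}. *)

theory Defs
  imports
    "HOL-Library.Discrete_Functions"
    "HOL-Combinatorics.Multiset_Permutations"
    "HOL-Computational_Algebra.Polynomial"
begin

section \<open>Rankings and Kemeny scores\<close>

text \<open>
  A ranking of a finite set \<open>C\<close> is a duplicate-free list of its elements, most preferred first,
  i.e. an element of \<^term>\<open>permutations_of_set C\<close>.
\<close>

definition before :: "'a list \<Rightarrow> 'a \<Rightarrow> 'a \<Rightarrow> bool" where
  "before \<pi> x y \<longleftrightarrow> (\<exists>i j. i < j \<and> j < length \<pi> \<and> \<pi> ! i = x \<and> \<pi> ! j = y)"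

definition kendall_tau :: "'a list \<Rightarrow> 'a list \<Rightarrow> nat" where
  "kendall_tau \<pi> \<sigma> = card {{x, y} | x y. before \<pi> x y \<and> before \<sigma> y x}"

definition kemeny :: "'a list multiset \<Rightarrow> 'a list \<Rightarrow> nat" where
  "kemeny \<P> Q = (\<Sum>\<pi>\<in>#\<P>. kendall_tau Q \<pi>)"

definition kemeny_rankings :: "'a set \<Rightarrow> 'a list multiset \<Rightarrow> 'a list set" where
  "kemeny_rankings C \<P> =
     {Q \<in> permutations_of_set C. \<forall>Q' \<in> permutations_of_set C. kemeny \<P> Q \<le> kemeny \<P> Q'}"

definition kemeny_rankings_upto :: "'a set \<Rightarrow> 'a list multiset \<Rightarrow> nat \<Rightarrow> 'a list set" where
  "kemeny_rankings_upto C \<P> k = {Q \<in> permutations_of_set C. kemeny \<P> Q \<le> k}"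

definition respects_unanimity :: "'a set \<Rightarrow> 'a list multiset \<Rightarrow> 'a list \<Rightarrow> bool" where
  "respects_unanimity C \<P> Q \<longleftrightarrow>
     (\<forall>x\<in>C. \<forall>y\<in>C. x \<noteq> y \<longrightarrow> (\<forall>\<pi>\<in>#\<P>. before \<pi> x y) \<longrightarrow> before Q x y)"

text \<open>
  The number of rankings asked for counts only the rankings of score at most \<open>k\<close> that respect
  the unanimity order. Counting all of \<^term>\<open>kemeny_rankings_upto C \<P> k\<close> would make instances
  unsolvable: for two candidates on whose order all votes agree, and large \<open>k\<close>, there are two
  rankings of score at most \<open>k\<close>, but only one of them respects unanimity. By
  \<open>dkra_answer_iff_literal\<close> the two versions have the same answers on every instance on
  which the other one is solvable.
\<close>

definition dkra_answer ::
    "'a set \<Rightarrow> 'a list multiset \<Rightarrow> nat \<Rightarrow> nat \<Rightarrow> 'a list list \<Rightarrow> bool" where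
  "dkra_answer C \<P> k r Qs \<longleftrightarrow>
     distinct Qs \<and>
     (\<forall>Q\<in>set Qs. Q \<in> kemeny_rankings_upto C \<P> k \<and> respects_unanimity C \<P> Q) \<and>
     length Qs = min r (card {Q \<in> kemeny_rankings_upto C \<P> k. respects_unanimity C \<P> Q})"

definition dkra_answer_literal ::
    "'a set \<Rightarrow> 'a list multiset \<Rightarrow> nat \<Rightarrow> nat \<Rightarrow> 'a list list \<Rightarrow> bool" where
  "dkra_answer_literal C \<P> k r Qs \<longleftrightarrow>
     distinct Qs \<and>
     (\<forall>Q\<in>set Qs. Q \<in> kemeny_rankings_upto C \<P> k \<and> respects_unanimity C \<P> Q) \<and>
     length Qs = min r (card (kemeny_rankings_upto C \<P> k))"

lemma dkra_answer_iff_literal: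
  assumes "finite C" and "dkra_answer_literal C \<P> k r Qs"
  shows "dkra_answer C \<P> k r Qs' \<longleftrightarrow> dkra_answer_literal C \<P> k r Qs'"
proof -
  let ?K = "kemeny_rankings_upto C \<P> k"
  let ?U = "{Q \<in> ?K. respects_unanimity C \<P> Q}"
  have fin: "finite ?K"
    unfolding kemeny_rankings_upto_def by simp
  have "card ?U \<le> card ?K"
    by (rule card_mono[OF fin]) auto
  moreover have "length Qs = card (set Qs)"
    using assms(2) by (simp add: dkra_answer_literal_def distinct_card)
  moreover have "card (set Qs) \<le> card ?U"
    using assms(2) fin by (intro card_mono) (auto simp: dkra_answer_literal_def)
  moreover have "length Qs = min r (card ?K)"
    using assms(2) by (simp add: dkra_answer_literal_def)
  ultimately have "min r (card ?U) = min r (card ?K)"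
    by linarith
  then show ?thesis
    by (simp add: dkra_answer_def dkra_answer_literal_def)
qed

definition dokra_answer :: "'a set \<Rightarrow> 'a list multiset \<Rightarrow> nat \<Rightarrow> 'a list list \<Rightarrow> bool" where
  "dokra_answer C \<P> r Qs \<longleftrightarrow>
     distinct Qs \<and> set Qs \<subseteq> kemeny_rankings C \<P> \<and>
     length Qs = min r (card (kemeny_rankings C \<P>))"


section \<open>Random access machines with logarithmic cost\<close>

text \<open>
  Algorithms are structured RAM programs. The memory is divided into arrays of natural numbers,
  of which a program mentions finitely many; an index into an array is computed at run time.
  The cost of a step is the total number of binary digits of all values (constants, addresses,
  contents, intermediate results) handled in it.
\<close>

type_synonym state = "nat \<Rightarrow> nat \<Rightarrow> nat"

datatype bop = Add | Sub | Mul | Div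

datatype exp =
    Const nat
  | Load nat exp  \<comment> \<open>array, index\<close>
  | Bop bop exp exp

datatype com =
    Skip
  | Store nat exp exp  \<comment> \<open>array, index, value\<close>
  | Seq com com
  | Cond exp com com  \<comment> \<open>the condition holds if its value is nonzero\<close>
  | While exp com

definition bits :: "nat \<Rightarrow> nat" where
  "bits n = Suc (floor_log n)"

fun bop_val :: "bop \<Rightarrow> nat \<Rightarrow> nat \<Rightarrow> nat" where
  "bop_val Add x y = x + y"
| "bop_val Sub x y = x - y"
| "bop_val Mul x y = x * y"
| "bop_val Div x y = x div y"

fun exp_val :: "state \<Rightarrow> exp \<Rightarrow> nat" where
  "exp_val s (Const n) = n"
| "exp_val s (Load a e) = s a (exp_val s e)"
| "exp_val s (Bop f e1 e2) = bop_val f (exp_val s e1) (exp_val s e2)"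

fun exp_cost :: "state \<Rightarrow> exp \<Rightarrow> nat" where
  "exp_cost s (Const n) = bits n"
| "exp_cost s (Load a e) = exp_cost s e + bits (exp_val s (Load a e))"
| "exp_cost s (Bop f e1 e2) = exp_cost s e1 + exp_cost s e2 + bits (exp_val s (Bop f e1 e2))"

inductive big_step :: "com \<Rightarrow> state \<Rightarrow> nat \<Rightarrow> state \<Rightarrow> bool" where
  Skip: "big_step Skip s 1 s"
| Store: "big_step (Store a e1 e2) s (1 + exp_cost s e1 + exp_cost s e2)
            (s(a := (s a)(exp_val s e1 := exp_val s e2)))"
| Seq: "big_step c1 s t1 s' \<Longrightarrow> big_step c2 s' t2 s'' \<Longrightarrow> big_step (Seq c1 c2) s (t1 + t2) s''"
| CondTrue: "exp_val s e \<noteq> 0 \<Longrightarrow> big_step c1 s t s' \<Longrightarrow>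
            big_step (Cond e c1 c2) s (1 + exp_cost s e + t) s'"
| CondFalse: "exp_val s e = 0 \<Longrightarrow> big_step c2 s t s' \<Longrightarrow>
            big_step (Cond e c1 c2) s (1 + exp_cost s e + t) s'"
| WhileFalse: "exp_val s e = 0 \<Longrightarrow> big_step (While e c) s (1 + exp_cost s e) s"
| WhileTrue: "exp_val s e \<noteq> 0 \<Longrightarrow> big_step c s t1 s' \<Longrightarrow> big_step (While e c) s' t2 s'' \<Longrightarrow>
            big_step (While e c) s (1 + exp_cost s e + t1 + t2) s''"

inductive_cases big_stepE:
  "big_step Skip s t s'"
  "big_step (Store a e1 e2) s t s'"
  "big_step (Seq c1 c2) s t s'"
  "big_step (Cond e c1 c2) s t s'"
  "big_step (While e c) s t s'"

lemma big_step_deterministic: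
  "big_step c s t s' \<Longrightarrow> big_step c s u s'' \<Longrightarrow> u = t \<and> s'' = s'"
proof (induction arbitrary: u s'' rule: big_step.induct)
  case Skip
  then show ?case by (elim big_stepE) simp
next
  case Store
  then show ?case by (elim big_stepE) simp
next
  case Seq
  from Seq.prems Seq.IH show ?case by (elim big_stepE(3)) metis
next
  case (CondTrue s e c1 t s' c2)
  from CondTrue.prems CondTrue.hyps(1) obtain t'
    where "u = Suc (exp_cost s e + t')" "big_step c1 s t' s''"
    by (elim big_stepE(4)) auto
  with CondTrue.IH show ?case by simp
next
  case (CondFalse s e c2 t s' c1)
  from CondFalse.prems CondFalse.hyps(1) obtain t'
    where "u = Suc (exp_cost s e + t')" "big_step c2 s t' s''"
    by (elim big_stepE(4)) auto
  with CondFalse.IH show ?case by simp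
next
  case (WhileFalse s e c)
  from WhileFalse.prems WhileFalse.hyps show ?case by - (erule big_stepE(5), simp_all)
next
  case (WhileTrue s e c t1 s1 t2 s2)
  from WhileTrue.prems WhileTrue.hyps(1) obtain t1' t2' s1'
    where u: "u = Suc (exp_cost s e + t1' + t2')"
      and 1: "big_step c s t1' s1'" and 2: "big_step (While e c) s1' t2' s''"
    by - (erule big_stepE(5), auto)
  from WhileTrue.IH(1)[OF 1] have "t1' = t1" "s1' = s1" by simp_all
  with u WhileTrue.IH(2) 2 show ?case by simp
qed

text \<open>
  A sequence is held in an array with its length at index 0 and its entries from index 1 on.
  The input is in array 0, the output in array 1, and all other cells are initially 0.
\<close>

definition init_state :: "nat list \<Rightarrow> state" where
  "init_state xs = (\<lambda>a i. if a = 0 \<and> i \<le> length xs then (length xs # xs) ! i else 0)"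

definition output_of :: "state \<Rightarrow> nat list" where
  "output_of s = map (s 1) [1..<Suc (s 1 0)]"

definition computes :: "com \<Rightarrow> nat list \<Rightarrow> nat \<Rightarrow> nat list \<Rightarrow> bool" where
  "computes P xs t ys \<longleftrightarrow> (\<exists>s. big_step P (init_state xs) t s \<and> output_of s = ys)"

definition computable :: "(nat \<Rightarrow> nat) \<Rightarrow> bool" where
  "computable f \<longleftrightarrow> (\<exists>P. \<forall>n. \<exists>t. computes P [n] t [f n])"


section \<open>Search problems and fixed-parameter tractability\<close>

record 'x search_problem =
  instances :: "'x set"
  encode :: "'x \<Rightarrow> nat list"
  answer :: "'x \<Rightarrow> nat list \<Rightarrow> bool"

definition input_size :: "'x search_problem \<Rightarrow> 'x \<Rightarrow> nat" where
  "input_size p x = sum_list (map bits (encode p x))"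

definition solves_in_time :: "com \<Rightarrow> 'x search_problem \<Rightarrow> ('x \<Rightarrow> nat) \<Rightarrow> bool" where
  "solves_in_time P p T \<longleftrightarrow>
     (\<forall>x \<in> instances p. \<exists>t ys. computes P (encode p x) t ys \<and> answer p x ys \<and> t \<le> T x)"

definition fpt :: "'x search_problem \<Rightarrow> ('x \<Rightarrow> nat) \<Rightarrow> bool" where
  "fpt p \<kappa> \<longleftrightarrow>
     (\<exists>P f (q :: nat poly). computable f \<and>
        solves_in_time P p (\<lambda>x. f (\<kappa> x) * poly q (input_size p x)))"


section \<open>The two aggregation problems\<close>

text \<open>
  Candidates are named by arbitrary natural numbers. An instance presents the set of candidates
  and the multiset of votes by lists \<open>cs\<close> and \<open>ps\<close>, in any order; the numbers \<open>k\<close> and \<open>r\<close>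
  contribute their binary length to the input size.
\<close>

definition profile :: "nat list \<Rightarrow> nat list list \<Rightarrow> bool" where
  "profile cs ps \<longleftrightarrow> distinct cs \<and> set ps \<subseteq> permutations_of_set (set cs)"

definition encode_rankings :: "nat list list \<Rightarrow> nat list" where
  "encode_rankings Qs = length Qs # concat Qs"

definition DKRA :: "(nat list \<times> nat list list \<times> nat \<times> nat) search_problem" where
  "DKRA = \<lparr>
     instances = {(cs, ps, k, r). profile cs ps},
     encode = (\<lambda>(cs, ps, k, r). [k, r, length cs] @ cs @ encode_rankings ps),
     answer = (\<lambda>(cs, ps, k, r) ys.
       \<exists>Qs. ys = encode_rankings Qs \<and> dkra_answer (set cs) (mset ps) k r Qs)\<rparr>"

definition DOKRA :: "(nat list \<times> nat list list \<times> nat) search_problem" where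
  "DOKRA = \<lparr>
     instances = {(cs, ps, r). profile cs ps},
     encode = (\<lambda>(cs, ps, r). [r, length cs] @ cs @ encode_rankings ps),
     answer = (\<lambda>(cs, ps, r) ys.
       \<exists>Qs. ys = encode_rankings Qs \<and> dokra_answer (set cs) (mset ps) r Qs)\<rparr>"

end

theory Submission
  imports Defs
begin

text \<open>
  The Kemeny score of a ranking is a sum over its ordered pairs \<open>(x, y)\<close> of the number of votes that
  prefer \<open>y\<close> to \<open>x\<close>; a pair that contradicts a unanimous preference is charged \<open>k + 1\<close> extra, so
  that the rankings of total cost at most \<open>k\<close> are exactly the ones of score at most \<open>k\<close> that respect
  unanimity. A Held-Karp style dynamic program over all subsets computes the cheapest internal
  order of every set of candidates in \<open>2^m\<close> times polynomial time.
  With this table one can decide whether a partial ranking, built from the bottom upwards, has a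
  completion of cost at most \<open>k\<close>. A breadth-first search keeps only such partial rankings and
  truncates every level to \<open>r\<close> of them: as each of them has an extension on the next level, the
  last level still contains all solutions or \<open>r\<close> of them. For the same reason no level is longer than
  the last one, so that it has at most \<open>min r (m!)\<close> entries, which gives both time bounds. For the optimisation problem the same program runs without penalties,
  with \<open>k\<close> read off the table.
\<close>

section \<open>Cost-bounded execution\<close>

text \<open>Costs are logarithmic, so a count of steps means something only together with a bound on
  the numbers handled. All memory cells are kept below \<open>2 ^ L\<close> for one width
  \<open>L\<close>, quadratic in the input size; a step then costs a constant times
  \<open>L\<close>, and the lemmas about program parts count steps only. The width is quadratic
  rather than linear because a whole partial ranking is packed into one cell. Both problems run the
  same program with three parameters: a penalty \<open>H\<close>, a cap \<open>G\<close> and a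
  threshold \<open>K < G\<close>. The table is asked only whether a cost stays within
  \<open>K\<close>, and for this question capped entries are as good as exact ones, while they
  remain short. The number \<open>r\<close> is written in binary and may be exponential in the input
  size. Hence a list bound in terms of \<open>r\<close> alone would not give fixed-parameter
  tractability, and every level, not just the last one, has to be bounded in terms of
  \<open>m\<close> as well.\<close>

lemma bits_le_iff:
  assumes "L \<ge> 1"
  shows "bits n \<le> L \<longleftrightarrow> n < 2 ^ L"
proof
  assume "bits n \<le> L"
  have "n < 2 ^ bits n"
    using floor_log_exp2_gt[of n] by (simp add: bits_def)
  also have "\<dots> \<le> 2 ^ L"
    using \<open>bits n \<le> L\<close> by (intro power_increasing) auto
  finally show "n < 2 ^ L" .
next
  assume n: "n < 2 ^ L"
  show "bits n \<le> L"
  proof (cases "n = 0")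
    case True
    \<comment> \<open>The number 0 has one digit; this is the case that requires \<open>L\<close> to
      be positive.\<close>
    then show ?thesis using assms by (simp add: bits_def)
  next
    case False
    then have "2 ^ floor_log n < (2::nat) ^ L"
      using floor_log_exp2_le[of n] n by linarith
    then show ?thesis by (simp add: bits_def Suc_le_eq)
  qed
qed

lemma bits_ge_1: "1 \<le> bits n"
  by (simp add: bits_def)

lemma less_two_power_bits: "n < 2 ^ bits n"
  using bits_le_iff[OF bits_ge_1, of n n] by simp

lemma bits_mono: "x \<le> y \<Longrightarrow> bits x \<le> bits y"
  by (simp add: bits_def floor_log_le_iff)

lemma bits_numerals [simp]: "bits 0 = 1" "bits (Suc 0) = 1" "bits 1 = 1" "bits 2 = 2" "bits 3 = 2" "bits 4 = 3"
  by (simp_all add: bits_def floor_log_rec)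

lemma bits_mult_le: "bits (x * y) \<le> bits x + bits y"
proof -
  have "x * y < 2 ^ bits x * 2 ^ bits y"
    by (intro mult_strict_mono less_two_power_bits) auto
  then have "x * y < 2 ^ (bits x + bits y)"
    by (simp add: power_add)
  moreover have "1 \<le> bits x + bits y"
    using bits_ge_1[of x] by linarith
  ultimately show ?thesis using bits_le_iff by blast
qed

text \<open>The maximum of the two lengths plus one would be sharper. The sum of the lengths is
  preferred because the same bound then holds for all four operations, and a fixed expression
  performs only constantly many of them.\<close>

lemma bits_add_le: "bits (x + y) \<le> bits x + bits y"
proof -
  have xy: "x + 1 \<le> 2 ^ bits x" "y + 1 \<le> 2 ^ bits y"
    using less_two_power_bits[of x] less_two_power_bits[of y] by linarith+
  have "2 ^ 1 \<le> (2::nat) ^ bits x" "2 ^ 1 \<le> (2::nat) ^ bits y"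
    by (intro power_increasing bits_ge_1; simp)+
  then have "(2::nat) \<le> 2 ^ bits x" "(2::nat) \<le> 2 ^ bits y" by simp_all
  \<comment> \<open>Powers of two with positive exponent are at least 2, and from there on a product
    dominates the sum.\<close>
  moreover have "a + b \<le> a * b" if "2 \<le> a" "2 \<le> b" for a b :: nat
  proof -
    obtain c d where "a = c + 2" "b = d + 2"
      using \<open>2 \<le> a\<close> \<open>2 \<le> b\<close> by (metis add.commute le_Suc_ex)
    then show ?thesis by simp
  qed
  ultimately have "2 ^ bits x + 2 ^ bits y \<le> (2::nat) ^ bits x * 2 ^ bits y"
    by blast
  with xy have "x + y < 2 ^ (bits x + bits y)"
    by (simp add: power_add)
  moreover have "1 \<le> bits x + bits y"
    using bits_ge_1[of x] by linarith
  ultimately show ?thesis using bits_le_iff by blast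
qed

lemma bits_bop_val_le: "bits (bop_val f x y) \<le> bits x + bits y"
proof (cases f)
  case Sub
  then show ?thesis using bits_mono[of "x - y" x] by simp
next
  case Div
  then show ?thesis using bits_mono[of "x div y" x] by simp
qed (simp_all add: bits_add_le bits_mult_le)

text \<open>The condition \<open>1 \<le> L\<close> lets the unit charge of every command, and the
  single digit of 0, be absorbed into a multiple of \<open>L\<close>.\<close>

definition bounded_mem :: "nat \<Rightarrow> state \<Rightarrow> bool" where
  "bounded_mem L s \<longleftrightarrow> 1 \<le> L \<and> (\<forall>a i. s a i < 2 ^ L)"

text \<open>If all memory cells have at most \<open>L\<close> bits, evaluating \<open>e\<close> yields at most \<open>exp_width e * L\<close> bits
  and costs at most \<open>exp_weight e * L\<close>. Hence only the number of steps has to be tracked.\<close>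

fun exp_width :: "exp \<Rightarrow> nat" where
  "exp_width (Const n) = bits n"
| "exp_width (Load a e) = 1"
| "exp_width (Bop f e1 e2) = exp_width e1 + exp_width e2"

fun exp_weight :: "exp \<Rightarrow> nat" where
  "exp_weight (Const n) = bits n"
| "exp_weight (Load a e) = exp_weight e + 1"
| "exp_weight (Bop f e1 e2) = exp_weight e1 + exp_weight e2 + exp_width e1 + exp_width e2"

lemma bits_exp_val_le:
  assumes "bounded_mem L s"
  shows "bits (exp_val s e) \<le> exp_width e * L"
proof (induction e)
  case (Const n)
  then show ?case using assms by (simp add: bounded_mem_def)
next
  case (Load a e)
  then show ?case using assms bits_le_iff by (simp add: bounded_mem_def)
next
  case (Bop f e1 e2)
  then show ?case
    using bits_bop_val_le[of f "exp_val s e1" "exp_val s e2"] by (simp add: distrib_right)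
qed

lemma exp_cost_le:
  assumes "bounded_mem L s"
  shows "exp_cost s e \<le> exp_weight e * L"
proof (induction e)
  case (Const n)
  then show ?case using assms by (simp add: bounded_mem_def)
next
  case (Load a e)
  then show ?case using bits_exp_val_le[OF assms, of "Load a e"] by (simp add: distrib_right)
next
  case (Bop f e1 e2)
  then show ?case
    using bits_exp_val_le[OF assms, of "Bop f e1 e2"] by (simp add: distrib_right)
qed

text \<open>Total correctness with a time bound, for a single start state, where \<open>T\<close> is
  measured in units of \<open>L\<close>. The memory bound is both a premise and part of the
  conclusion, so it passes through sequences and loops by itself; only a store has to show that its
  value fits.\<close>

definition exec :: "nat \<Rightarrow> com \<Rightarrow> nat \<Rightarrow> state \<Rightarrow> (state \<Rightarrow> bool) \<Rightarrow> bool" where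
  "exec L c T s Q \<longleftrightarrow> (bounded_mem L s \<longrightarrow>
     (\<exists>t s'. big_step c s t s' \<and> t \<le> T * L \<and> bounded_mem L s' \<and> Q s'))"

lemma exec_mono:
  assumes "exec L c T s Q" "T \<le> T'" "\<And>s'. Q s' \<Longrightarrow> Q' s'"
  shows "exec L c T' s Q'"
  using assms unfolding exec_def by (meson le_trans mult_le_mono1)

lemma exec_Skip:
  assumes "Q s" "1 \<le> T"
  shows "exec L Skip T s Q"
  unfolding exec_def
proof
  assume b: "bounded_mem L s"
  then have "1 \<le> T * L" using assms(2) by (simp add: bounded_mem_def)
  then show "\<exists>t s'. big_step Skip s t s' \<and> t \<le> T * L \<and> bounded_mem L s' \<and> Q s'"
    using big_step.Skip b assms(1) by blast
qed

lemma exec_Store: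
  assumes "exp_val s e2 < 2 ^ L"
    and "Q (s(a := (s a)(exp_val s e1 := exp_val s e2)))"
    and "1 + exp_weight e1 + exp_weight e2 \<le> T"
  shows "exec L (Store a e1 e2) T s Q"
  unfolding exec_def
proof
  assume b: "bounded_mem L s"
  have "1 + exp_cost s e1 + exp_cost s e2 \<le> (1 + exp_weight e1 + exp_weight e2) * L"
    using exp_cost_le[OF b, of e1] exp_cost_le[OF b, of e2] b
    by (simp add: bounded_mem_def distrib_right add_mult_distrib)
  also have "\<dots> \<le> T * L" using assms(3) by (rule mult_le_mono1)
  finally have "1 + exp_cost s e1 + exp_cost s e2 \<le> T * L" .
  moreover have "bounded_mem L (s(a := (s a)(exp_val s e1 := exp_val s e2)))"
    using b assms(1) by (auto simp: bounded_mem_def)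
  ultimately show "\<exists>t s'. big_step (Store a e1 e2) s t s' \<and> t \<le> T * L \<and> bounded_mem L s' \<and> Q s'"
    using big_step.Store assms(2) by blast
qed

text \<open>In weakest-precondition style the judgement for the second command is the postcondition
  of the first. \<open>exec_Seq'\<close> is the variant with an explicit assertion in
  between.\<close>

lemma exec_Seq:
  assumes "exec L c1 T1 s (\<lambda>s'. exec L c2 T2 s' Q)" "T1 + T2 \<le> T"
  shows "exec L (Seq c1 c2) T s Q"
  unfolding exec_def
proof
  assume "bounded_mem L s"
  then obtain t1 s1 t2 s2 where "big_step c1 s t1 s1" "t1 \<le> T1 * L"
      "big_step c2 s1 t2 s2" "t2 \<le> T2 * L" "bounded_mem L s2" "Q s2"
    using assms(1) unfolding exec_def by blast
  moreover have "T1 * L + T2 * L \<le> T * L"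
    using mult_le_mono1[OF assms(2), of L] by (simp add: distrib_right)
  ultimately show "\<exists>t s'. big_step (Seq c1 c2) s t s' \<and> t \<le> T * L \<and> bounded_mem L s' \<and> Q s'"
    by (intro exI[of _ "t1 + t2"] exI[of _ s2]) (auto intro: big_step.Seq)
qed

lemma exec_Cond:
  assumes "exp_val s e \<noteq> 0 \<Longrightarrow> exec L c1 T' s Q" "exp_val s e = 0 \<Longrightarrow> exec L c2 T' s Q"
    and "1 + exp_weight e + T' \<le> T"
  shows "exec L (Cond e c1 c2) T s Q"
  unfolding exec_def
proof
  assume b: "bounded_mem L s"
  have "exec L (if exp_val s e \<noteq> 0 then c1 else c2) T' s Q"
    using assms by simp
  then obtain t s' where ts: "big_step (if exp_val s e \<noteq> 0 then c1 else c2) s t s'"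
      "t \<le> T' * L" "bounded_mem L s'" "Q s'"
    using b unfolding exec_def by blast
  have "big_step (Cond e c1 c2) s (1 + exp_cost s e + t) s'"
    using ts(1) CondTrue CondFalse by (cases "exp_val s e = 0") auto
  moreover have "1 + exp_cost s e + t \<le> (1 + exp_weight e + T') * L"
    using exp_cost_le[OF b, of e] ts(2) b by (simp add: bounded_mem_def add_mult_distrib)
  moreover have "\<dots> \<le> T * L" using assms(3) by (rule mult_le_mono1)
  ultimately show "\<exists>t s'. big_step (Cond e c1 c2) s t s' \<and> t \<le> T * L \<and> bounded_mem L s' \<and> Q s'"
    using ts by (meson le_trans)
qed

lemma exec_Store':
  assumes "exp_val s e1 = i" "exp_val s e2 = v" "v < 2 ^ L" "Q (s(a := (s a)(i := v)))"
    and "1 + exp_weight e1 + exp_weight e2 \<le> T"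
  shows "exec L (Store a e1 e2) T s Q"
  using assms by (intro exec_Store) auto

text \<open>The state after a store is known exactly, so chains of stores need no intermediate
  assertions. Address and value enter through equations to keep that state in simplified
  form.\<close>

lemma exec_Store_Seq:
  assumes "exp_val s e1 = i" "exp_val s e2 = v" "v < 2 ^ L"
    and "exec L c T' (s(a := (s a)(i := v))) Q"
    and "1 + exp_weight e1 + exp_weight e2 + T' \<le> T"
  shows "exec L (Seq (Store a e1 e2) c) T s Q"
  by (rule exec_Seq[OF exec_Store'[OF assms(1-3) _ order_refl]]) (use assms(4,5) in auto)

lemma exec_Seq':
  assumes "exec L c1 T1 s R" "\<And>s'. R s' \<Longrightarrow> exec L c2 T2 s' Q" "T1 + T2 \<le> T"
  shows "exec L (Seq c1 c2) T s Q"
  using exec_Seq[OF exec_mono[OF assms(1) order_refl] assms(3)] assms(2) by blast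

section \<open>Counting loops and their step budgets\<close>

abbreviation Var :: "nat \<Rightarrow> exp" where
  "Var a \<equiv> Load a (Const 0)"

abbreviation set_var :: "state \<Rightarrow> nat \<Rightarrow> nat \<Rightarrow> state" where
  "set_var s a x \<equiv> s(a := (s a)(0 := x))"

text \<open>The machine cannot compare numbers, but a truncated difference is nonzero exactly while
  the counter is below the bound. The bound is evaluated anew in every round, so its value has to be
  constant under the loop invariant.\<close>

definition For :: "nat \<Rightarrow> exp \<Rightarrow> com \<Rightarrow> com" where
  "For v e c = Seq (Store v (Const 0) (Const 0))
     (While (Bop Sub e (Var v)) (Seq c (Store v (Const 0) (Bop Add (Var v) (Const 1)))))"

text \<open>The value of the condition is the number of rounds left, so termination and the time
  bound come from one induction.\<close>

lemma exec_While_upwards: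
  assumes step: "\<And>i s. i < n \<Longrightarrow> I i s \<Longrightarrow> exec L c T s (I (Suc i))"
    and cond: "\<And>i s. i \<le> n \<Longrightarrow> I i s \<Longrightarrow> exp_val s e = n - i"
    and "i \<le> n" "I i s"
  shows "exec L (While e c) ((n - i) * (1 + exp_weight e + T) + 1 + exp_weight e) s (I n)"
  using assms(3,4)
proof (induction "n - i" arbitrary: i s)
  case 0
  then have [simp]: "i = n" by simp
  show ?case
    unfolding exec_def
  proof
    assume b: "bounded_mem L s"
    have "exp_val s e = 0" using cond[of n s] 0 by simp
    then have "big_step (While e c) s (1 + exp_cost s e) s" by (rule WhileFalse)
    moreover have "1 + exp_cost s e \<le> (1 + exp_weight e) * L"
      using exp_cost_le[OF b, of e] b by (simp add: bounded_mem_def)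
    ultimately show "\<exists>t s'. big_step (While e c) s t s' \<and>
        t \<le> ((n - i) * (1 + exp_weight e + T) + 1 + exp_weight e) * L \<and> bounded_mem L s' \<and> I n s'"
      using b 0 by (intro exI[of _ "1 + exp_cost s e"] exI[of _ s]) auto
  qed
next
  case (Suc d)
  then have i: "i < n" by simp
  define B where "B = (n - Suc i) * (1 + exp_weight e + T) + 1 + exp_weight e"
  show ?case
    unfolding exec_def
  proof
    assume b: "bounded_mem L s"
    obtain t1 s1 where 1: "big_step c s t1 s1" "t1 \<le> T * L" "bounded_mem L s1" "I (Suc i) s1"
      using step[OF i Suc.prems(2)] b unfolding exec_def by blast
    have "exec L (While e c) B s1 (I n)"
      unfolding B_def using Suc.hyps(1)[of "Suc i" s1] Suc.hyps(2) 1(4) i by simp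
    then obtain t2 s2 where 2: "big_step (While e c) s1 t2 s2" "t2 \<le> B * L" "bounded_mem L s2" "I n s2"
      using 1(3) unfolding exec_def by blast
    have "exp_val s e \<noteq> 0" using cond[of i s] Suc.prems i by simp
    then have "big_step (While e c) s (1 + exp_cost s e + t1 + t2) s2"
      using 1 2 by (intro WhileTrue)
    moreover have "1 + exp_cost s e + t1 + t2 \<le> (1 + exp_weight e + T + B) * L"
      using exp_cost_le[OF b, of e] b 1(2) 2(2) by (simp add: bounded_mem_def add_mult_distrib)
    moreover have "1 + exp_weight e + T + B = (n - i) * (1 + exp_weight e + T) + 1 + exp_weight e"
    proof -
      have "n - i = Suc (n - Suc i)" using i by simp
      then show ?thesis unfolding B_def by simp
    qed
    ultimately show "\<exists>t s'. big_step (While e c) s t s' \<and>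
        t \<le> ((n - i) * (1 + exp_weight e + T) + 1 + exp_weight e) * L \<and> bounded_mem L s' \<and> I n s'"
      using 2 by metis
  qed
qed

text \<open>The body must leave the counter alone, and the invariant is re-established for the state
  after the increment. The additive 20 per round pays for initialising, testing and incrementing the
  counter.\<close>

lemma exec_For:
  assumes init: "I 0 (set_var s v 0)"
    and step: "\<And>i s. i < n \<Longrightarrow> I i s \<Longrightarrow> s v 0 = i \<Longrightarrow>
        exec L c T s (\<lambda>s'. s' v 0 = i \<and> I (Suc i) (set_var s' v (Suc i)))"
    and bound: "\<And>i s. i \<le> n \<Longrightarrow> I i s \<Longrightarrow> exp_val s e = n"
    and fin: "\<And>s. I n s \<Longrightarrow> Q s"
    and n: "n < 2 ^ L"
    and T: "(n + 1) * (T + exp_weight e + exp_width e + 20) \<le> T'"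
  shows "exec L (For v e c) T' s Q"
  unfolding For_def
proof (rule exec_Seq)
  let ?J = "\<lambda>i s. s v 0 = i \<and> I i s"
  let ?e = "Bop Sub e (Var v)"
  let ?c = "Seq c (Store v (Const 0) (Bop Add (Var v) (Const 1)))"
  have w: "exec L (While ?e ?c) ((n - 0) * (1 + exp_weight ?e + (T + 10)) + 1 + exp_weight ?e) s' (?J n)"
    if "?J 0 s'" for s'
  proof (rule exec_While_upwards[where I = ?J])
    show "exec L ?c (T + 10) s (?J (Suc i))" if "i < n" "?J i s" for i s
    proof (rule exec_Seq)
      show "exec L c T s (\<lambda>s'. exec L (Store v (Const 0) (Bop Add (Var v) (Const 1))) 10 s' (?J (Suc i)))"
      proof (rule exec_mono[OF step])
        fix s' assume "s' v 0 = i \<and> I (Suc i) (set_var s' v (Suc i))"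
        then show "exec L (Store v (Const 0) (Bop Add (Var v) (Const 1))) 10 s' (?J (Suc i))"
          using \<open>i < n\<close> n by (intro exec_Store) auto
      qed (use that in auto)
    qed simp
    show "exp_val s ?e = n - i" if "i \<le> n" "?J i s" for i s
      using that bound[of i s] by simp
  qed (use that in auto)
  show "exec L (Store v (Const 0) (Const 0)) 3 s (\<lambda>s'. exec L (While ?e ?c)
      (n * (T + exp_weight e + exp_width e + 20) + exp_weight e + exp_width e + 10) s' Q)"
  proof (rule exec_Store)
    have "exec L (While ?e ?c) (n * (T + exp_weight e + exp_width e + 20) + exp_weight e + exp_width e + 10)
      (set_var s v 0) Q"
    proof (rule exec_mono[OF w])
      show "(n - 0) * (1 + exp_weight ?e + (T + 10)) + 1 + exp_weight ?e
        \<le> n * (T + exp_weight e + exp_width e + 20) + exp_weight e + exp_width e + 10"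
        by (simp add: algebra_simps)
    qed (use init fin in auto)
    then show "exec L (While ?e ?c) (n * (T + exp_weight e + exp_width e + 20) + exp_weight e + exp_width e + 10)
      (s(v := (s v)(exp_val s (Const 0) := exp_val s (Const 0)))) Q" by simp
  qed auto
  show "3 + (n * (T + exp_weight e + exp_width e + 20) + exp_weight e + exp_width e + 10) \<le> T'"
    using T by (simp add: algebra_simps)
qed

text \<open>The budget of a loop whose body takes \<open>c * x\<close> steps: as \<open>x\<close> is
  at least 1, the overhead of a round is absorbed by a larger constant, and the result has again the
  shape of a constant times a product. This is why the constants of nested loops climb from 600 to
  700, 800 and so on.\<close>

lemma loop_bound:
  fixes x :: nat
  assumes "1 \<le> x" "c + w + v + 20 \<le> c'"
  shows "(k + 1) * (c * x + w + v + 20) \<le> c' * ((k + 1) * x)"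
proof -
  have "c * x + (w + v + 20) * 1 \<le> c * x + (w + v + 20) * x"
    using assms(1) by (intro add_left_mono mult_le_mono2)
  also have "\<dots> = (c + w + v + 20) * x" by (simp add: algebra_simps)
  also have "\<dots> \<le> c' * x" using assms(2) by (rule mult_le_mono1)
  finally have "(k + 1) * (c * x + w + v + 20) \<le> (k + 1) * (c' * x)"
    by (intro mult_le_mono2) simp
  then show ?thesis by (simp only: ac_simps)
qed

definition same_outside :: "nat set \<Rightarrow> state \<Rightarrow> state \<Rightarrow> bool" where
  "same_outside X s s' \<longleftrightarrow> (\<forall>a. a \<notin> X \<longrightarrow> s' a = s a)"

lemma same_outside_refl [simp]: "same_outside X s s"
  by (simp add: same_outside_def)

lemma same_outside_upd [simp]: "a \<in> X \<Longrightarrow> same_outside X s (s'(a := f)) \<longleftrightarrow> same_outside X s s'"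
  by (auto simp: same_outside_def)

section \<open>Kemeny scores as sums over ordered pairs\<close>

definition pairs_before :: "'a list \<Rightarrow> ('a \<times> 'a) set" where
  "pairs_before xs = {(x, y). before xs x y}"

lemma before_snoc: "before (xs @ [z]) x y \<longleftrightarrow> before xs x y \<or> x \<in> set xs \<and> y = z"
proof
  assume "before (xs @ [z]) x y"
  then obtain i j where ij: "i < j" "j < length xs + 1" "(xs @ [z]) ! i = x" "(xs @ [z]) ! j = y"
    by (auto simp: before_def)
  show "before xs x y \<or> x \<in> set xs \<and> y = z"
  proof (cases "j = length xs")
    case True
    then show ?thesis using ij by (auto simp: nth_append)
  next
    case False
    then have "before xs x y" using ij unfolding before_def
      by (intro exI[of _ i] exI[of _ j]) (auto simp: nth_append)
    then show ?thesis ..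
  qed
next
  assume "before xs x y \<or> x \<in> set xs \<and> y = z"
  then show "before (xs @ [z]) x y"
  proof
    assume "before xs x y"
    then obtain i j where "i < j" "j < length xs" "xs ! i = x" "xs ! j = y"
      by (auto simp: before_def)
    then show ?thesis unfolding before_def
      by (intro exI[of _ i] exI[of _ j]) (auto simp: nth_append)
  next
    assume "x \<in> set xs \<and> y = z"
    then obtain i where "i < length xs" "xs ! i = x" "y = z" by (auto simp: in_set_conv_nth)
    then show ?thesis unfolding before_def
      by (intro exI[of _ i] exI[of _ "length xs"]) (auto simp: nth_append)
  qed
qed

lemma before_in_set: "before xs x y \<Longrightarrow> x \<in> set xs \<and> y \<in> set xs"
  by (auto simp: before_def)

lemma before_asym: "distinct xs \<Longrightarrow> before xs x y \<Longrightarrow> \<not> before xs y x"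
  unfolding before_def by (metis less_trans nth_eq_iff_index_eq not_less_iff_gr_or_eq)

lemma before_total: "x \<in> set xs \<Longrightarrow> y \<in> set xs \<Longrightarrow> x \<noteq> y \<Longrightarrow> before xs x y \<or> before xs y x"
  unfolding before_def by (metis in_set_conv_nth linorder_neqE_nat)

lemma pairs_before_Nil [simp]: "pairs_before [] = {}"
  by (simp add: pairs_before_def before_def)

lemma pairs_before_snoc: "pairs_before (xs @ [z]) = pairs_before xs \<union> (\<lambda>y. (y, z)) ` set xs"
  by (auto simp: pairs_before_def before_snoc)

lemma finite_pairs_before [simp]: "finite (pairs_before xs)"
  by (rule finite_subset[of _ "set xs \<times> set xs"]) (auto simp: pairs_before_def dest: before_in_set)

lemma sum_pairs_before_snoc:
  assumes "distinct (xs @ [z])"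
  shows "(\<Sum>(x, y)\<in>pairs_before (xs @ [z]). F x y)
       = (\<Sum>(x, y)\<in>pairs_before xs. F x y) + (\<Sum>x\<in>set xs. F x z)"
proof -
  have "pairs_before xs \<inter> (\<lambda>y. (y, z)) ` set xs = {}"
    using assms by (auto simp: pairs_before_def dest: before_in_set)
  then show ?thesis
    unfolding pairs_before_snoc
    by (subst sum.union_disjoint) (auto simp: sum.reindex inj_on_def)
qed

text \<open>Transfers scores from rankings of indices, which the program handles, to rankings of the
  candidates themselves.\<close>

lemma sum_pairs_before_map:
  assumes "distinct xs" "inj_on f (set xs)"
  shows "(\<Sum>(x, y)\<in>pairs_before (map f xs). F x y) = (\<Sum>(x, y)\<in>pairs_before xs. F (f x) (f y))"
  using assms
proof (induction xs rule: rev_induct)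
  case (snoc z xs)
  have "distinct (map f (xs @ [z]))"
    using snoc.prems by (simp only: distinct_map)
  then have "distinct (map f xs @ [f z])" by simp
  moreover have "inj_on f (set xs)"
    using snoc.prems by (auto simp: inj_on_def)
  ultimately show ?case
    using snoc sum_pairs_before_snoc[of xs z "\<lambda>x y. F (f x) (f y)"]
      sum_pairs_before_snoc[of "map f xs" "f z" F]
    by (simp add: sum.reindex)
qed simp

text \<open>A duplicate-free ranking contains each unordered pair in at most one orientation, so
  disagreements can be counted in the orientation given by \<open>Q\<close>.\<close>

lemma kendall_tau_eq_card_pairs:
  assumes "distinct Q"
  shows "kendall_tau Q \<pi> = card {(x, y) \<in> pairs_before Q. before \<pi> y x}"
proof -
  let ?A = "{(x, y) \<in> pairs_before Q. before \<pi> y x}"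
  have "{{x, y} | x y. before Q x y \<and> before \<pi> y x} = (\<lambda>(x, y). {x, y}) ` ?A"
    by (auto simp: pairs_before_def)
  moreover have "inj_on (\<lambda>(x, y). {x, y}) ?A"
    using before_asym[OF assms] by (auto simp: inj_on_def pairs_before_def doubleton_eq_iff)
  ultimately show ?thesis
    by (simp add: kendall_tau_def card_image)
qed

section \<open>Pairwise vote counts\<close>

definition preferring :: "'a list list \<Rightarrow> 'a \<Rightarrow> 'a \<Rightarrow> nat" where
  "preferring ps x y = length (filter (\<lambda>\<pi>. before \<pi> x y) ps)"

lemma preferring_le: "preferring ps x y \<le> length ps"
  by (simp add: preferring_def)

lemma preferring_eq_length_iff:
  "preferring ps x y = length ps \<longleftrightarrow> (\<forall>\<pi>\<in>set ps. before \<pi> x y)"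
  unfolding preferring_def
  by (metis filter_True length_filter_less nless_le)

lemma kemeny_eq_sum_pairs:
  assumes "distinct Q"
  shows "kemeny (mset ps) Q = (\<Sum>(x, y)\<in>pairs_before Q. preferring ps y x)"
proof (induction ps)
  case (Cons \<pi> ps)
  have "card {(x, y) \<in> pairs_before Q. before \<pi> y x}
      = (\<Sum>(x, y)\<in>pairs_before Q. of_bool (before \<pi> y x))"
    by (simp add: case_prod_beta' Int_def)
  moreover have "preferring (\<pi> # ps) y x = of_bool (before \<pi> y x) + preferring ps y x" for x y
    by (simp add: preferring_def)
  ultimately show ?case
    using Cons kendall_tau_eq_card_pairs[OF assms, of \<pi>]
    by (simp add: kemeny_def sum.distrib case_prod_beta')
qed (simp add: kemeny_def preferring_def)

section \<open>Building rankings from the end\<close>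

text \<open>
  Lists are read from the bottom of a ranking upwards: the head of the list is the element placed
  last, and it pays for every element of \<open>R\<close> that will be placed before it.
\<close>

fun rcost :: "('a \<Rightarrow> 'a \<Rightarrow> nat) \<Rightarrow> 'a set \<Rightarrow> 'a list \<Rightarrow> nat" where
  "rcost W R [] = 0"
| "rcost W R (z # zs) = (\<Sum>y\<in>R - {z}. W y z) + rcost W (R - {z}) zs"

lemma rcost_append: "rcost W R (xs @ ys) = rcost W R xs + rcost W (R - set xs) ys"
proof (induction xs arbitrary: R)
  case (Cons z xs)
  have "R - {z} - set xs = R - insert z (set xs)" by auto
  then show ?case using Cons by simp
qed simp

lemma rcost_rev_eq_sum_pairs:
  assumes "distinct xs"
  shows "rcost W (set xs) (rev xs) = (\<Sum>(x, y)\<in>pairs_before xs. W x y)"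
  using assms
proof (induction xs rule: rev_induct)
  case (snoc z xs)
  then have "insert z (set xs) - {z} = set xs" by auto
  then show ?case
    using snoc by (simp add: sum_pairs_before_snoc)
qed simp

text \<open>A crude bound; it supplies a cap above all scores for the optimisation problem.\<close>

lemma rcost_le:
  assumes "\<And>x y. W x y \<le> b" "finite R"
  shows "rcost W R zs \<le> length zs * (card R * b)"
  using assms(2)
proof (induction zs arbitrary: R)
  case (Cons z zs)
  have c: "card (R - {z}) * b \<le> card R * b"
    using Cons.prems by (intro mult_le_mono1 card_mono) auto
  have "(\<Sum>y\<in>R - {z}. W y z) \<le> card (R - {z}) * b"
    using sum_bounded_above[of "R - {z}" "\<lambda>y. W y z" b] assms(1) by simp
  moreover have "rcost W (R - {z}) zs \<le> length zs * (card (R - {z}) * b)"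
    using Cons by simp
  moreover have "length zs * (card (R - {z}) * b) \<le> length zs * (card R * b)"
    using c by (rule mult_le_mono2)
  ultimately have "rcost W R (z # zs) \<le> card R * b + length zs * (card R * b)"
    using c unfolding rcost.simps by linarith
  then show ?case by simp
qed simp

text \<open>The cap \<open>G\<close> plays the role of infinity in the dynamic program.\<close>

definition opt_cost :: "('a \<Rightarrow> 'a \<Rightarrow> nat) \<Rightarrow> nat \<Rightarrow> 'a set \<Rightarrow> nat" where
  "opt_cost W G R = Min (insert G (rcost W R ` permutations_of_set R))"

lemma opt_cost_le: "opt_cost W G R \<le> G"
  by (simp add: opt_cost_def)

lemma opt_cost_le_rcost: "zs \<in> permutations_of_set R \<Longrightarrow> opt_cost W G R \<le> rcost W R zs"
  by (simp add: opt_cost_def)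

lemma opt_cost_cases:
  obtains "opt_cost W G R = G"
    | zs where "zs \<in> permutations_of_set R" "opt_cost W G R = rcost W R zs"
proof -
  have "opt_cost W G R \<in> insert G (rcost W R ` permutations_of_set R)"
    unfolding opt_cost_def by (rule Min_in) auto
  then show thesis using that by blast
qed

lemma opt_cost_empty [simp]: "opt_cost W G {} = 0"
  by (simp add: opt_cost_def)

text \<open>The recursion chooses the bottom element \<open>x\<close> of \<open>R\<close>. What
  \<open>x\<close> pays depends on the set above it and not on the order of that set. Capping the
  smaller entries does no harm, since adding a cost to a value of at least \<open>G\<close> leaves
  it at least \<open>G\<close>.\<close>

lemma opt_cost_rec:
  assumes "finite R" "R \<noteq> {}"
  shows "opt_cost W G R
       = Min (insert G ((\<lambda>x. opt_cost W G (R - {x}) + (\<Sum>y\<in>R - {x}. W y x)) ` R))"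
    (is "_ = Min ?M")
proof (rule antisym)
  have fin: "finite ?M" using assms by simp
  have "Min ?M \<in> ?M" using fin by (intro Min_in) auto
  then consider "Min ?M = G"
    | x where "x \<in> R" "Min ?M = opt_cost W G (R - {x}) + (\<Sum>y\<in>R - {x}. W y x)"
    by blast
  then show "opt_cost W G R \<le> Min ?M"
  proof cases
    case 1
    then show ?thesis by (simp add: opt_cost_le)
  next
    case 2
    show ?thesis
    proof (cases rule: opt_cost_cases[of W G "R - {x}"])
      case 1
      then show ?thesis using 2 opt_cost_le[of W G R] by simp
    next
      case (2 zs)
      then have "x # zs \<in> permutations_of_set R"
        using \<open>x \<in> R\<close> by (auto simp: permutations_of_set_def)
      from opt_cost_le_rcost[OF this, of W G] show ?thesis
        using 2 \<open>Min ?M = _\<close> by simp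
    qed
  qed
  show "Min ?M \<le> opt_cost W G R"
  proof (cases rule: opt_cost_cases[of W G R])
    case 1
    then show ?thesis using fin by simp
  next
    case (2 zs)
    then obtain x ys where x: "zs = x # ys" "x \<in> R" "ys \<in> permutations_of_set (R - {x})"
      using permutations_of_set_nonempty[OF assms(2)] by auto
    have "Min ?M \<le> opt_cost W G (R - {x}) + (\<Sum>y\<in>R - {x}. W y x)"
      using fin x(2) by simp
    also have "\<dots> \<le> opt_cost W G R"
      using opt_cost_le_rcost[OF x(3), of W G] 2 x(1) by simp
    finally show ?thesis .
  qed
qed

section \<open>Enumerating the cheap rankings\<close>

definition feasible :: "('a \<Rightarrow> 'a \<Rightarrow> nat) \<Rightarrow> nat \<Rightarrow> 'a set \<Rightarrow> 'a list \<Rightarrow> bool" where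
  "feasible W K V zs \<longleftrightarrow> distinct zs \<and> set zs \<subseteq> V \<and>
     (\<exists>ys\<in>permutations_of_set (V - set zs). rcost W V (zs @ ys) \<le> K)"

text \<open>Because of \<open>K < G\<close>, an entry that has hit the cap fails the test just as
  its true value would, so the capped table decides extendability exactly.\<close>

lemma feasible_iff_opt_cost:
  assumes "K < G" "distinct zs" "set zs \<subseteq> V"
  shows "feasible W K V zs \<longleftrightarrow> rcost W V zs + opt_cost W G (V - set zs) \<le> K"
proof
  assume "feasible W K V zs"
  then obtain ys where "ys \<in> permutations_of_set (V - set zs)" "rcost W V (zs @ ys) \<le> K"
    by (auto simp: feasible_def)
  then show "rcost W V zs + opt_cost W G (V - set zs) \<le> K"
    using opt_cost_le_rcost[of ys "V - set zs" W G] by (simp add: rcost_append)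
next
  assume le: "rcost W V zs + opt_cost W G (V - set zs) \<le> K"
  show "feasible W K V zs"
  proof (cases rule: opt_cost_cases[of W G "V - set zs"])
    case 1
    then show ?thesis using le assms by simp
  next
    case (2 ys)
    then show ?thesis using le assms by (auto simp: feasible_def rcost_append)
  qed
qed

lemma feasible_butlast: "feasible W K V (zs @ [x]) \<Longrightarrow> feasible W K V zs"
  unfolding feasible_def
proof (elim conjE bexE, intro conjI)
  fix ys assume *: "distinct (zs @ [x])" "set (zs @ [x]) \<subseteq> V"
    "ys \<in> permutations_of_set (V - set (zs @ [x]))" "rcost W V ((zs @ [x]) @ ys) \<le> K"
  then have "x # ys \<in> permutations_of_set (V - set zs)"
    by (auto simp: permutations_of_set_def)
  then show "\<exists>ys\<in>permutations_of_set (V - set zs). rcost W V (zs @ ys) \<le> K"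
    using *(4) by (intro bexI[of _ "x # ys"]) auto
qed auto

text \<open>The search tree has no dead ends. Truncation relies on this, and on
  \<open>feasible_butlast\<close>, by which every feasible prefix is reached from a feasible
  one.\<close>

lemma feasible_extend:
  assumes "feasible W K V zs" "set zs \<noteq> V"
  obtains x where "feasible W K V (zs @ [x])"
proof -
  from assms(1) obtain ys where ys: "distinct zs" "set zs \<subseteq> V"
      "ys \<in> permutations_of_set (V - set zs)" "rcost W V (zs @ ys) \<le> K"
    by (auto simp: feasible_def)
  then obtain x xs where "ys = x # xs"
    using assms(2) by (cases ys) (auto simp: permutations_of_set_def)
  then have "feasible W K V (zs @ [x])"
    using ys unfolding feasible_def
    by (auto simp: permutations_of_set_def intro!: bexI[of _ xs])
  then show thesis by (rule that)
qed

text \<open>The test in the form in which the program performs it, by a look-up in the table;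
  \<open>set_extensions\<close> identifies it with feasibility.\<close>

definition extension_ok :: "(nat \<Rightarrow> nat \<Rightarrow> nat) \<Rightarrow> nat \<Rightarrow> nat \<Rightarrow> nat \<Rightarrow> nat list \<Rightarrow> nat \<Rightarrow> bool" where
  "extension_ok W G K m zs x \<longleftrightarrow> x \<notin> set zs \<and>
     rcost W {..<m} (zs @ [x]) + opt_cost W G ({..<m} - set (zs @ [x])) \<le> K"

text \<open>The bound \<open>j\<close> is separate from \<open>m\<close> so that the same function
  describes the state of the innermost loop after \<open>j\<close> rounds.\<close>

definition extensions :: "(nat \<Rightarrow> nat \<Rightarrow> nat) \<Rightarrow> nat \<Rightarrow> nat \<Rightarrow> nat \<Rightarrow> nat \<Rightarrow> nat list \<Rightarrow> nat list list" where
  "extensions W G K m j zs = map (\<lambda>x. zs @ [x]) (filter (extension_ok W G K m zs) [0..<j])"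

text \<open>If \<open>r = 0\<close>, or if no ranking is within \<open>K\<close>, even the empty
  prefix must be left out: the formula for the length of a level has to hold from level 0
  on.\<close>

fun level :: "(nat \<Rightarrow> nat \<Rightarrow> nat) \<Rightarrow> nat \<Rightarrow> nat \<Rightarrow> nat \<Rightarrow> nat \<Rightarrow> nat \<Rightarrow> nat list list" where
  "level W G K m r 0 = (if 0 < r \<and> opt_cost W G {..<m} \<le> K then [[]] else [])"
| "level W G K m r (Suc l) = take r (concat (map (extensions W G K m m) (level W G K m r l)))"

lemma set_extensions:
  assumes "K < G" "distinct zs" "set zs \<subseteq> {..<m}"
  shows "set (extensions W G K m m zs) = {zs @ [x] | x. feasible W K {..<m} (zs @ [x])}"
proof -
  have "x < m \<and> extension_ok W G K m zs x \<longleftrightarrow> feasible W K {..<m} (zs @ [x])" for x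
  proof (cases "x < m \<and> x \<notin> set zs")
    case True
    then show ?thesis
      using feasible_iff_opt_cost[of K G "zs @ [x]" "{..<m}" W] assms
      by (simp add: extension_ok_def)
  next
    case False
    then show ?thesis by (auto simp: extension_ok_def feasible_def)
  qed
  then show ?thesis by (auto simp: extensions_def)
qed

lemma distinct_extensions: "distinct (extensions W G K m j zs)"
  by (auto simp: extensions_def distinct_map inj_on_def)

lemma level_correct:
  fixes W m l K
  defines "F \<equiv> \<lambda>l. {zs. feasible W K {..<m} zs \<and> length zs = l}"
  assumes "K < G" "l \<le> m"
  shows "distinct (level W G K m r l) \<and> set (level W G K m r l) \<subseteq> F l \<and>
    length (level W G K m r l) = min r (card (F l)) \<and>
    (\<forall>k<l. length (level W G K m r k) \<le> length (level W G K m r (Suc k)))"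
  using \<open>l \<le> m\<close>
proof (induction l)
  case 0
  have "F 0 = (if opt_cost W G {..<m} \<le> K then {[]} else {})"
    using feasible_iff_opt_cost[OF assms(2), of "[]" "{..<m}" W] by (auto simp: F_def)
  then show ?case by auto
next
  case (Suc l)
  define Z where "Z = level W G K m r l"
  define C where "C = concat (map (extensions W G K m m) Z)"
  have Z: "distinct Z" "set Z \<subseteq> F l" "length Z = min r (card (F l))"
    using Suc by (auto simp: Z_def)
  have fin: "finite (F i)" for i
    by (rule finite_subset[OF _ finite_lists_length_eq[of "{..<m}" i]]) (auto simp: F_def feasible_def)
  have ext: "set (extensions W G K m m zs) = {zs @ [x] | x. feasible W K {..<m} (zs @ [x])}"
    if "zs \<in> F l" for zs
    using that by (intro set_extensions assms) (auto simp: F_def feasible_def)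
  have C_sub: "set C \<subseteq> F (Suc l)"
    using Z(2) ext by (fastforce simp: C_def F_def)
  have more: "\<exists>x. feasible W K {..<m} (zs @ [x])" if "zs \<in> F l" for zs
  proof -
    have zs: "feasible W K {..<m} zs" "length zs = l" using that by (simp_all add: F_def)
    then have "distinct zs" by (simp add: feasible_def)
    then have "card (set zs) \<noteq> card {..<m}"
      using zs(2) Suc.prems by (simp add: distinct_card)
    then have "set zs \<noteq> {..<m}" by metis
    then show ?thesis using feasible_extend[OF zs(1)] by blast
  qed
  have "distinct C"
    unfolding C_def
  proof (rule distinct_concat)
    \<comment> \<open>Two prefixes without extensions would share the empty list; the existence of
      an extension excludes this, and any common extension determines its prefix.\<close>
    have "inj_on (extensions W G K m m) (set Z)"
    proof (rule inj_onI)
      fix zs zs' assume *: "zs \<in> set Z" "zs' \<in> set Z" "extensions W G K m m zs = extensions W G K m m zs'"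
      obtain x where "feasible W K {..<m} (zs @ [x])"
        using more * Z(2) by blast
      then have "zs @ [x] \<in> set (extensions W G K m m zs')"
        using * Z(2) ext[of zs] by auto
      then show "zs = zs'" by (auto simp: extensions_def)
    qed
    then show "distinct (map (extensions W G K m m) Z)"
      using Z(1) by (simp add: distinct_map)
  next
    show "distinct ys" if "ys \<in> set (map (extensions W G K m m) Z)" for ys
      using that distinct_extensions by auto
  next
    show "set ys \<inter> set zs = {}"
      if "ys \<in> set (map (extensions W G K m m) Z)" "zs \<in> set (map (extensions W G K m m) Z)" "ys \<noteq> zs"
      for ys zs
      using that by (auto simp: extensions_def)
  qed
  have len: "length Z \<le> length C"
  proof -
    have "1 \<le> length (extensions W G K m m zs)" if "zs \<in> set Z" for zs
    proof -
      obtain x where "feasible W K {..<m} (zs @ [x])"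
        using more[of zs] \<open>zs \<in> set Z\<close> Z(2) by blast
      then have "zs @ [x] \<in> set (extensions W G K m m zs)"
        using \<open>zs \<in> set Z\<close> Z(2) ext[of zs] by auto
      then show ?thesis by (cases "extensions W G K m m zs") auto
    qed
    then have "(\<Sum>zs\<leftarrow>Z. 1) \<le> (\<Sum>zs\<leftarrow>Z. length (extensions W G K m m zs))"
      by (rule sum_list_mono)
    then show ?thesis by (simp add: C_def length_concat comp_def sum_list_triv)
  qed
  have "min r (length C) = min r (card (F (Suc l)))"
  \<comment> \<open>Either the previous level holds \<open>r\<close> prefixes, each of which
    survives, or nothing has been cut off so far and it holds all feasible prefixes of its
    length.\<close>
  proof (cases "r \<le> card (F l)")
    case True
    then have "r \<le> length C" using Z(3) len by simp
    moreover have "length C \<le> card (F (Suc l))"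
      using card_mono[OF fin C_sub] distinct_card[OF \<open>distinct C\<close>] by simp
    ultimately show ?thesis by simp
  next
    case False
    then have "set Z = F l"
      using Z fin card_subset_eq[of "F l" "set Z"] distinct_card[of Z] by simp
    have "F (Suc l) \<subseteq> set C"
    proof
      fix ws assume ws: "ws \<in> F (Suc l)"
      then obtain zs x where "ws = zs @ [x]" by (cases ws rule: rev_cases) (auto simp: F_def)
      then have "zs \<in> F l" using ws by (auto simp: F_def dest: feasible_butlast)
      then show "ws \<in> set C"
        using ext \<open>ws = _\<close> ws \<open>set Z = F l\<close> by (auto simp: C_def F_def)
    qed
    then have "set C = F (Suc l)" using C_sub by auto
    then show ?thesis using distinct_card[OF \<open>distinct C\<close>] by simp
  qed
  then have card: "length (take r C) = min r (card (F (Suc l)))"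
    by (simp add: min.commute)
  have lev: "level W G K m r (Suc l) = take r C"
    by (simp add: C_def Z_def)
  have mono: "length (level W G K m r k) \<le> length (level W G K m r (Suc k))" if "k < Suc l" for k
  proof (cases "k = l")
    case True
    then show ?thesis unfolding \<open>k = l\<close> lev using len Z(3) by (simp add: Z_def)
  next
    case False
    then show ?thesis using Suc.IH Suc.prems that by (simp del: level.simps)
  qed
  have sub: "set (take r C) \<subseteq> F (Suc l)"
    using C_sub set_take_subset[of r C] by (rule order_trans[rotated])
  show ?case
  proof (intro conjI allI impI)
    show "distinct (level W G K m r (Suc l))"
      unfolding lev using \<open>distinct C\<close> by (rule distinct_take)
    show "set (level W G K m r (Suc l)) \<subseteq> F (Suc l)"
      unfolding lev by (rule sub)
    show "length (level W G K m r (Suc l)) = min r (card (F (Suc l)))"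
      unfolding lev by (rule card)
  qed (rule mono)
qed

lemma level_final:
  fixes W m K
  defines "A \<equiv> {zs \<in> permutations_of_set {..<m}. rcost W {..<m} zs \<le> K}"
  assumes "K < G"
  shows "distinct (level W G K m r m)" "set (level W G K m r m) \<subseteq> A"
    "length (level W G K m r m) = min r (card A)"
proof -
  have "{zs. feasible W K {..<m} zs \<and> length zs = m} = A"
  proof -
    have "set zs = {..<m}" if "distinct zs" "set zs \<subseteq> {..<m}" "length zs = m" for zs
      using that by (intro card_subset_eq) (auto simp: distinct_card)
    moreover have "length zs = m" if "distinct zs" "set zs = {..<m}" for zs
      using distinct_card[OF that(1)] that(2) by simp
    ultimately have "distinct zs \<and> set zs \<subseteq> {..<m} \<and> length zs = m
        \<longleftrightarrow> zs \<in> permutations_of_set {..<m}" for zs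
      unfolding permutations_of_set_def by blast
    moreover have "feasible W K {..<m} zs \<longleftrightarrow> rcost W {..<m} zs \<le> K"
      if "zs \<in> permutations_of_set {..<m}" for zs
      using that by (auto simp: feasible_def dest: permutations_of_setD)
    ultimately show ?thesis
      unfolding A_def by (auto simp: feasible_def)
  qed
  then show "distinct (level W G K m r m)" "set (level W G K m r m) \<subseteq> A"
    "length (level W G K m r m) = min r (card A)"
    using level_correct[OF assms(2) order_refl, of W m r] by (simp_all only:)
qed

section \<open>Sizes of the levels\<close>

lemma length_level_mono:
  assumes "K < G" "l \<le> m"
  shows "length (level W G K m r l) \<le> length (level W G K m r m)"
  using assms(2)
proof (induction rule: inc_induct)
  case (step n)
  have "length (level W G K m r n) \<le> length (level W G K m r (Suc n))"
    using level_correct[OF assms(1) order_refl, of W m r] \<open>n < m\<close> by blast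
  then show ?case using step.IH by (rule le_trans)
qed simp

lemma length_level_le:
  assumes "K < G" "l \<le> m"
  shows "length (level W G K m r l) \<le> min r (fact m)"
proof -
  let ?A = "{zs \<in> permutations_of_set {..<m}. rcost W {..<m} zs \<le> K}"
  have "card ?A \<le> card (permutations_of_set {..<m})"
    by (rule card_mono) auto
  then have "card ?A \<le> fact m" by simp
  then show ?thesis
    using length_level_mono[OF assms, of W r] level_final(3)[OF assms(1), of W m r] by simp
qed

lemma set_level:
  assumes "K < G" "l \<le> m" "zs \<in> set (level W G K m r l)"
  shows "distinct zs" "set zs \<subseteq> {..<m}" "length zs = l" "rcost W {..<m} zs \<le> K"
proof -
  have "set (level W G K m r l) \<subseteq> {zs. feasible W K {..<m} zs \<and> length zs = l}"
    using level_correct[OF assms(1,2), of W r] by (simp only:)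
  then have *: "feasible W K {..<m} zs" "length zs = l"
    using assms(3) by blast+
  then show "distinct zs" "set zs \<subseteq> {..<m}" "length zs = l" "rcost W {..<m} zs \<le> K"
    by (auto simp: feasible_def rcost_append)
qed

section \<open>The answers\<close>

text \<open>\<open>H\<close> is the penalty for contradicting a unanimous preference: the truncated difference
  \<open>1 - (length ps - c)\<close> is 1 if \<open>c = length ps\<close> and 0 for smaller \<open>c\<close>.\<close>

definition weight :: "nat \<Rightarrow> 'a list \<Rightarrow> 'a list list \<Rightarrow> nat \<Rightarrow> nat \<Rightarrow> nat" where
  "weight H cs ps i j = preferring ps (cs ! j) (cs ! i)
     + H * (1 - (length ps - preferring ps (cs ! j) (cs ! i)))"

definition ranking_of :: "'a list \<Rightarrow> nat list \<Rightarrow> 'a list" where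
  "ranking_of cs zs = map ((!) cs) (rev zs)"

lemma inj_on_nth_lessThan: "distinct cs \<Longrightarrow> inj_on ((!) cs) {..<length cs}"
  by (auto simp: inj_on_def nth_eq_iff_index_eq)

lemma image_nth_lessThan: "(!) cs ` {..<length cs} = set cs"
  by (auto simp: set_conv_nth)

lemma inj_on_ranking_of:
  assumes "distinct cs"
  shows "inj_on (ranking_of cs) (permutations_of_set {..<length cs})"
proof (rule inj_onI)
  fix xs ys assume *: "xs \<in> permutations_of_set {..<length cs}" "ys \<in> permutations_of_set {..<length cs}"
    "ranking_of cs xs = ranking_of cs ys"
  then have "inj_on ((!) cs) (set (rev xs) \<union> set (rev ys))"
    using inj_on_nth_lessThan[OF assms] by (auto simp: permutations_of_set_def)
  then show "xs = ys"
    using *(3) inj_on_map_eq_map[of "(!) cs" "rev xs" "rev ys"] by (simp add: ranking_of_def)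
qed

lemma image_ranking_of:
  assumes "distinct cs"
  shows "ranking_of cs ` permutations_of_set {..<length cs} = permutations_of_set (set cs)"
proof -
  have "ranking_of cs ` permutations_of_set {..<length cs}
      = map ((!) cs) ` rev ` permutations_of_set {..<length cs}"
    by (simp only: ranking_of_def[abs_def] image_image)
  also have "\<dots> = permutations_of_set (set cs)"
    using permutations_of_set_image_inj[OF inj_on_nth_lessThan[OF assms]]
    by (simp add: image_nth_lessThan)
  finally show ?thesis .
qed

lemma rcost_weight:
  assumes "distinct cs" "zs \<in> permutations_of_set {..<length cs}"
  shows "rcost (weight H cs ps) {..<length cs} zs
    = (\<Sum>(x, y)\<in>pairs_before (ranking_of cs zs).
        preferring ps y x + H * (1 - (length ps - preferring ps y x)))"
proof -
  have "distinct (rev zs)" "set (rev zs) = {..<length cs}"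
    using assms(2) by (auto simp: permutations_of_set_def)
  then show ?thesis
    using rcost_rev_eq_sum_pairs[of "rev zs" "weight H cs ps"]
      sum_pairs_before_map[of "rev zs" "(!) cs" "\<lambda>x y. preferring ps y x
        + H * (1 - (length ps - preferring ps y x))"] inj_on_nth_lessThan[OF assms(1)]
    by (simp add: ranking_of_def weight_def)
qed

lemma rcost_weight_0:
  assumes "distinct cs" "zs \<in> permutations_of_set {..<length cs}"
  shows "rcost (weight 0 cs ps) {..<length cs} zs = kemeny (mset ps) (ranking_of cs zs)"
proof -
  have "distinct (ranking_of cs zs)"
    using assms image_ranking_of by (auto dest: permutations_of_setD)
  then show ?thesis
    using assms by (simp add: rcost_weight kemeny_eq_sum_pairs)
qed

text \<open>One contradicted pair costs \<open>Suc k\<close> by itself and so exceeds the budget;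
  without such a pair all penalties vanish. The empty profile conforms: every pair is then unanimous
  in both directions, so with two or more candidates each ranking is penalised, and indeed none
  respects unanimity.\<close>

lemma rcost_weight_penalty:
  assumes "distinct cs" "zs \<in> permutations_of_set {..<length cs}"
  shows "rcost (weight (Suc k) cs ps) {..<length cs} zs \<le> k
    \<longleftrightarrow> kemeny (mset ps) (ranking_of cs zs) \<le> k
       \<and> respects_unanimity (set cs) (mset ps) (ranking_of cs zs)"
proof -
  let ?Q = "ranking_of cs zs"
  let ?h = "\<lambda>x y. Suc k * (1 - (length ps - preferring ps y x))"
  have "?Q \<in> permutations_of_set (set cs)"
    using assms(2) image_ranking_of[OF assms(1)] by blast
  then have Q: "distinct ?Q" "set ?Q = set cs"
    by (simp_all add: permutations_of_set_def)
  have eq: "rcost (weight (Suc k) cs ps) {..<length cs} zs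
      = kemeny (mset ps) ?Q + (\<Sum>(x, y)\<in>pairs_before ?Q. ?h x y)"
    using assms Q(1)
    by (simp add: rcost_weight kemeny_eq_sum_pairs sum.distrib[symmetric] case_prod_beta' del: mult_Suc)
  have una: "respects_unanimity (set cs) (mset ps) ?Q
      \<longleftrightarrow> (\<forall>(x, y)\<in>pairs_before ?Q. preferring ps y x \<noteq> length ps)"
  proof
    assume r: "respects_unanimity (set cs) (mset ps) ?Q"
    show "\<forall>(x, y)\<in>pairs_before ?Q. preferring ps y x \<noteq> length ps"
    proof clarify
      fix x y assume "(x, y) \<in> pairs_before ?Q" "preferring ps y x = length ps"
      then have b: "before ?Q x y" "\<forall>\<pi>\<in>#mset ps. before \<pi> y x"
        by (auto simp: pairs_before_def preferring_eq_length_iff)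
      then have "x \<in> set cs" "y \<in> set cs" "\<not> before ?Q y x"
        using before_in_set[OF b(1)] before_asym[OF Q(1) b(1)] Q(2) by auto
      moreover have "x \<noteq> y" using \<open>\<not> before ?Q y x\<close> b(1) by metis
      ultimately show False using r b(2) by (simp add: respects_unanimity_def)
    qed
  next
    assume r: "\<forall>(x, y)\<in>pairs_before ?Q. preferring ps y x \<noteq> length ps"
    show "respects_unanimity (set cs) (mset ps) ?Q"
      unfolding respects_unanimity_def
    proof (intro ballI impI)
      fix x y assume xy: "x \<in> set cs" "y \<in> set cs" "x \<noteq> y" "\<forall>\<pi>\<in>#mset ps. before \<pi> x y"
      then have "preferring ps x y = length ps" by (simp add: preferring_eq_length_iff)
      then have "\<not> before ?Q y x" using r by (auto simp: pairs_before_def)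
      then show "before ?Q x y" using before_total[of x ?Q y] xy Q by auto
    qed
  qed
  show ?thesis
  proof (cases "respects_unanimity (set cs) (mset ps) ?Q")
    case True
    then have "preferring ps y x < length ps" if "(x, y) \<in> pairs_before ?Q" for x y
      using una that preferring_le[of ps y x] by fastforce
    then have "(\<Sum>(x, y)\<in>pairs_before ?Q. ?h x y) = 0"
      by (intro sum.neutral) (auto simp: Suc_le_eq simp del: mult_Suc)
    then show ?thesis using True eq by simp
  next
    case False
    then obtain x y where xy: "(x, y) \<in> pairs_before ?Q" "preferring ps y x = length ps"
      using una by auto
    have "?h x y \<le> (\<Sum>(x, y)\<in>pairs_before ?Q. ?h x y)"
      using member_le_sum[OF xy(1), of "\<lambda>(x, y). ?h x y"] by simp
    then show ?thesis using False eq xy(2) by simp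
  qed
qed

lemma filter_image_eq:
  assumes "\<And>x. x \<in> A \<Longrightarrow> P (f x) \<longleftrightarrow> R x"
  shows "{y \<in> f ` A. P y} = f ` {x \<in> A. R x}"
  using assms by auto

text \<open>The cap \<open>Suc k\<close> suffices because it only matters whether a cost exceeds
  \<open>k\<close>. It happens to equal the penalty.\<close>

lemma dkra_answer_level:
  assumes "profile cs ps"
  defines "m \<equiv> length cs"
  shows "dkra_answer (set cs) (mset ps) k r
    (map (ranking_of cs) (level (weight (Suc k) cs ps) (Suc k) k m r m))"
proof -
  let ?lev = "level (weight (Suc k) cs ps) (Suc k) k m r m"
  let ?A = "{zs \<in> permutations_of_set {..<m}. rcost (weight (Suc k) cs ps) {..<m} zs \<le> k}"
  let ?B = "{Q \<in> kemeny_rankings_upto (set cs) (mset ps) k. respects_unanimity (set cs) (mset ps) Q}"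
  have cs: "distinct cs" using assms(1) by (simp add: profile_def)
  note lev = level_final[of k "Suc k" "weight (Suc k) cs ps" m r, OF lessI]
  have B: "?B = ranking_of cs ` ?A"
  proof -
    have "?B = {Q \<in> ranking_of cs ` permutations_of_set {..<m}.
        kemeny (mset ps) Q \<le> k \<and> respects_unanimity (set cs) (mset ps) Q}"
      unfolding kemeny_rankings_upto_def m_def image_ranking_of[OF cs] by blast
    also have "\<dots> = ranking_of cs ` ?A"
      by (rule filter_image_eq) (simp add: rcost_weight_penalty[OF cs] m_def)
    finally show ?thesis .
  qed
  have inj: "inj_on (ranking_of cs) ?A"
    using inj_on_ranking_of[OF cs] unfolding m_def by (rule inj_on_subset) auto
  have "card ?B = card ?A" unfolding B by (rule card_image[OF inj])
  moreover have "distinct (map (ranking_of cs) ?lev)"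
    using lev(1) inj_on_subset[OF inj lev(2)] by (simp add: distinct_map)
  moreover have "set (map (ranking_of cs) ?lev) \<subseteq> ?B"
    unfolding B using lev(2) by auto
  ultimately show ?thesis
    unfolding dkra_answer_def using lev(3) by auto
qed

text \<open>The cap exceeds the score of every ranking, so the table entry of the full set is the
  true optimum. With that entry as threshold, the rankings within the threshold are the optimal
  ones. The penalty is 0, since optimality is the only requirement here.\<close>

lemma dokra_answer_level:
  assumes "profile cs ps"
  defines "m \<equiv> length cs"
  defines "W \<equiv> weight 0 cs ps" and "G \<equiv> length ps * m * m + 1"
  shows "opt_cost W G {..<m} < G"
    and "dokra_answer (set cs) (mset ps) r
      (map (ranking_of cs) (level W G (opt_cost W G {..<m}) m r m))"
proof -
  let ?K = "opt_cost W G {..<m}"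
  let ?lev = "level W G ?K m r m"
  let ?A = "{zs \<in> permutations_of_set {..<m}. rcost W {..<m} zs \<le> ?K}"
  let ?B = "kemeny_rankings (set cs) (mset ps)"
  have cs: "distinct cs" using assms(1) by (simp add: profile_def)
  have less: "rcost W {..<m} zs < G" if "zs \<in> permutations_of_set {..<m}" for zs
  proof -
    have "rcost W {..<m} zs \<le> length zs * (card {..<m} * length ps)"
      by (rule rcost_le) (auto simp: W_def weight_def preferring_le)
    moreover have "length zs = m"
      using length_finite_permutations_of_set[OF that] by simp
    ultimately show ?thesis by (simp add: G_def algebra_simps)
  qed
  have "permutations_of_set {..<m} \<noteq> {}" by simp
  then obtain zs0 where zs0: "zs0 \<in> permutations_of_set {..<m}" by blast
  show K: "?K < G"
    using opt_cost_le_rcost[OF zs0, of W G] less[OF zs0] by simp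
  obtain zs1 where zs1: "zs1 \<in> permutations_of_set {..<m}" "?K = rcost W {..<m} zs1"
    by (rule opt_cost_cases[of W G "{..<m}"]) (use K in auto)
  have A: "?A = {zs \<in> permutations_of_set {..<m}.
      \<forall>zs'\<in>permutations_of_set {..<m}. rcost W {..<m} zs \<le> rcost W {..<m} zs'}"
  proof (intro Collect_cong conj_cong refl iffI ballI)
    fix zs zs' assume "rcost W {..<m} zs \<le> ?K" "zs' \<in> permutations_of_set {..<m}"
    then show "rcost W {..<m} zs \<le> rcost W {..<m} zs'"
      using opt_cost_le_rcost[of zs' "{..<m}" W G] by linarith
  next
    fix zs assume "\<forall>zs'\<in>permutations_of_set {..<m}. rcost W {..<m} zs \<le> rcost W {..<m} zs'"
    then show "rcost W {..<m} zs \<le> ?K" using zs1 by simp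
  qed
  have B: "?B = ranking_of cs ` ?A"
    unfolding A unfolding kemeny_rankings_def image_ranking_of[OF cs, symmetric] m_def
    by (rule filter_image_eq) (simp add: rcost_weight_0[OF cs] W_def)
  note lev = level_final[OF K, of W m r]
  have inj: "inj_on (ranking_of cs) ?A"
    using inj_on_ranking_of[OF cs] unfolding m_def by (rule inj_on_subset) auto
  have "card ?B = card ?A" unfolding B by (rule card_image[OF inj])
  moreover have "distinct (map (ranking_of cs) ?lev)"
    using lev(1) inj_on_subset[OF inj lev(2)] by (simp add: distinct_map)
  moreover have "set (map (ranking_of cs) ?lev) \<subseteq> ?B"
    unfolding B using lev(2) by auto
  ultimately show "dokra_answer (set cs) (mset ps) r (map (ranking_of cs) ?lev)"
    unfolding dokra_answer_def using lev(3) by auto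
qed

section \<open>The program\<close>

abbreviation add_exp (infixl "\<oplus>" 65) where "e1 \<oplus> e2 \<equiv> Bop Add e1 e2"
abbreviation sub_exp (infixl "\<ominus>" 65) where "e1 \<ominus> e2 \<equiv> Bop Sub e1 e2"
abbreviation mul_exp (infixl "\<otimes>" 70) where "e1 \<otimes> e2 \<equiv> Bop Mul e1 e2"
abbreviation div_exp (infixl "\<oslash>" 70) where "e1 \<oslash> e2 \<equiv> Bop Div e1 e2"

text \<open>Arrays: names starting with \<open>v\<close> are scalar variables kept at index 0, those starting with \<open>a\<close>
  are genuine arrays.\<close>

abbreviation (input) "aIn \<equiv> 0 :: nat"
abbreviation (input) "aOut \<equiv> 1 :: nat"
abbreviation (input) "vM \<equiv> 2 :: nat"
abbreviation (input) "vN \<equiv> 3 :: nat"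
abbreviation (input) "vB \<equiv> 4 :: nat"
abbreviation (input) "vG \<equiv> 5 :: nat"
abbreviation (input) "vH \<equiv> 6 :: nat"
abbreviation (input) "vR \<equiv> 7 :: nat"
abbreviation (input) "vK \<equiv> 8 :: nat"
abbreviation (input) "aPow \<equiv> 9 :: nat"
abbreviation (input) "aW \<equiv> 10 :: nat"
abbreviation (input) "aOpt \<equiv> 11 :: nat"
abbreviation (input) "aCode \<equiv> 12 :: nat"
abbreviation (input) "aMask \<equiv> 13 :: nat"
abbreviation (input) "aCost \<equiv> 14 :: nat"
abbreviation (input) "vCnt \<equiv> 15 :: nat"
abbreviation (input) "vNew \<equiv> 16 :: nat"
abbreviation (input) "vAcc \<equiv> 17 :: nat"
abbreviation (input) "vI \<equiv> 18 :: nat"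
abbreviation (input) "vJ \<equiv> 19 :: nat"
abbreviation (input) "vV \<equiv> 20 :: nat"
abbreviation (input) "vP \<equiv> 21 :: nat"
abbreviation (input) "vQ \<equiv> 22 :: nat"
abbreviation (input) "vX \<equiv> 23 :: nat"
abbreviation (input) "vY \<equiv> 24 :: nat"
abbreviation (input) "vS \<equiv> 25 :: nat"
abbreviation (input) "vRest \<equiv> 26 :: nat"
abbreviation (input) "vT \<equiv> 27 :: nat"

subsection \<open>Powers of two and bit masks\<close>

text \<open>There are no shifts or remainders on the machine: the bit is obtained as the parity of a
  quotient by a tabulated power of two.\<close>

definition bit_exp :: "exp \<Rightarrow> exp \<Rightarrow> exp" where
  "bit_exp e y = (e \<oslash> Load aPow y) \<ominus> Const 2 \<otimes> (e \<oslash> Load aPow y \<oslash> Const 2)"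

lemma exp_val_bit_exp [simp]:
  assumes "s aPow (exp_val s y) = 2 ^ exp_val s y"
  shows "exp_val s (bit_exp e y) = of_bool (bit (exp_val s e) (exp_val s y))"
  using assms by (simp add: bit_exp_def bit_iff_odd minus_mult_div_eq_mod mod2_eq_if)

lemma exp_weight_bit_exp [simp]:
  "exp_weight (bit_exp e y) = 2 * exp_weight e + 2 * exp_weight y + 6 * exp_width e + 22"
  "exp_width (bit_exp e y) = 2 * exp_width e + 6"
  by (simp_all add: bit_exp_def)

section \<open>Subsets coded as numbers\<close>

definition bits_of :: "nat \<Rightarrow> nat set" where
  "bits_of S = {i. bit S i}"

lemma bit_imp_less_exponent:
  fixes S :: nat
  assumes "S < 2 ^ m" "bit S i"
  shows "i < m"
proof (rule ccontr)
  assume "\<not> i < m"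
  then have "(2::nat) ^ m \<le> 2 ^ i" by (intro power_increasing) auto
  then have "S div 2 ^ i = 0" using assms(1) by (intro div_less) linarith
  then show False using assms(2) by (simp add: bit_iff_odd)
qed

lemma bits_of_subset: "S < 2 ^ m \<Longrightarrow> bits_of S \<subseteq> {..<m}"
  using bit_imp_less_exponent by (auto simp: bits_of_def)

lemma finite_bits_of [simp]: "finite (bits_of S)"
  using finite_subset[OF bits_of_subset[OF less_exp]] by simp

lemma bits_of_0 [simp]: "bits_of 0 = {}"
  by (simp add: bits_of_def)

lemma bits_of_eq_empty_iff: "bits_of S = {} \<longleftrightarrow> S = 0"
  by (auto simp: bits_of_def bit_eq_iff)

lemma bits_of_full: "bits_of (2 ^ m - 1) = {..<m}"
  by (auto simp: bits_of_def bit_mask_iff simp del: One_nat_def simp flip: mask_eq_exp_minus_1)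

lemma power_le_of_bit:
  assumes "bit (S::nat) x"
  shows "2 ^ x \<le> S"
proof -
  have "S div 2 ^ x \<noteq> 0" using assms unfolding bit_iff_odd by (metis even_zero)
  then show ?thesis by (simp add: div_eq_0_iff)
qed

text \<open>Subtracting a power of two that is present causes no borrow, so a single subtraction
  removes an element. The code becomes smaller, and therefore filling the table in ascending order
  of codes meets every subset after those it depends on.\<close>

lemma bits_of_remove:
  assumes "bit S x"
  shows "bits_of (S - 2 ^ x) = bits_of S - {x}"
proof -
  have le: "2 ^ x \<le> S" by (rule power_le_of_bit[OF assms])
  \<comment> \<open>Over the integers clearing a set bit is an ordinary subtraction;
    \<open>le\<close> ensures that the truncated one agrees with it.\<close>
  have "int (S - 2 ^ x) = unset_bit x (int S)"
    using assms le by (simp add: unset_bit_eq bit_of_nat_iff_bit of_nat_diff)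
  then have "int (S - 2 ^ x) = int (unset_bit x S)"
    by (simp add: of_nat_unset_bit_eq)
  then have "S - 2 ^ x = unset_bit x S" by simp
  then show ?thesis by (auto simp: bits_of_def bit_unset_bit_iff)
qed

definition pow_com :: com where
  "pow_com = Seq (Store aPow (Const 0) (Const 1))
     (For vI (Var vM) (Store aPow (Var vI \<oplus> Const 1) (Const 2 \<otimes> Load aPow (Var vI))))"

lemma exec_pow_com:
  assumes "s vM 0 = m" "m < L"
  shows "exec L pow_com (100 * (m + 1)) s
    (\<lambda>s'. same_outside {aPow, vI} s s' \<and> (\<forall>i\<le>m. s' aPow i = 2 ^ i))"
  unfolding pow_com_def
proof (rule exec_Store_Seq)
  let ?X = "{aPow, vI}"
  let ?I = "\<lambda>i s'. same_outside ?X s s' \<and> (\<forall>j\<le>i. s' aPow j = 2 ^ j)"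
  show "exec L (For vI (Var vM) (Store aPow (Var vI \<oplus> Const 1) (Const 2 \<otimes> Load aPow (Var vI))))
      ((m + 1) * 80) (s(aPow := (s aPow)(0 := 1))) (\<lambda>s'. same_outside {aPow, vI} s s' \<and> (\<forall>i\<le>m. s' aPow i = 2 ^ i))"
  proof (rule exec_For[where I = ?I and n = m and T = 40])
    fix i s' assume *: "i < m" "?I i s'" "s' vI 0 = i"
    have "2 ^ Suc i < (2::nat) ^ L" using * assms by (intro power_strict_increasing) auto
    then show "exec L (Store aPow (Var vI \<oplus> Const 1) (Const 2 \<otimes> Load aPow (Var vI))) 40 s'
         (\<lambda>s'. s' vI 0 = i \<and> ?I (Suc i) (set_var s' vI (Suc i)))"
      using * by (intro exec_Store') (auto simp: le_Suc_eq)
  next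
    have "2 ^ m < (2::nat) ^ L" using assms by (intro power_strict_increasing) auto
    then show "m < 2 ^ L" using less_exp[of m] by linarith
  qed (use assms in \<open>auto simp: same_outside_def\<close>)
  have "2 ^ 0 < (2::nat) ^ L" using assms by (intro power_strict_increasing) auto
  then show "1 < (2::nat) ^ L" by simp
qed (use assms in auto)

subsection \<open>The weight matrix\<close>

text \<open>The absolute difference, which serves as the test for inequality.\<close>

definition neq_exp :: "exp \<Rightarrow> exp \<Rightarrow> exp" where
  "neq_exp e1 e2 = (e1 \<ominus> e2) \<oplus> (e2 \<ominus> e1)"

text \<open>\<open>vB\<close> is the position of the first candidate. Behind the \<open>m\<close>
  candidates comes the number of votes, hence the extra 1, and then the votes row by row.\<close>

definition vote_exp :: "nat \<Rightarrow> exp" where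
  "vote_exp p = Load aIn (Var vB \<oplus> Var vM \<oplus> Const 1 \<oplus> Var vV \<otimes> Var vM \<oplus> Var p)"

definition cand_exp :: "nat \<Rightarrow> exp" where
  "cand_exp i = Load aIn (Var vB \<oplus> Var i)"

definition agree_exp :: exp where
  "agree_exp = Const 1 \<ominus> (neq_exp (vote_exp vP) (cand_exp vI) \<oplus> neq_exp (vote_exp vQ) (cand_exp vJ))"

text \<open>The offset \<open>b\<close> absorbs the difference between the two input formats, so
  that everything after loading is shared.\<close>

definition layout :: "nat \<Rightarrow> nat list \<Rightarrow> nat list list \<Rightarrow> state \<Rightarrow> bool" where
  "layout b cs ps s \<longleftrightarrow> s vB 0 = b \<and> s vM 0 = length cs \<and> s vN 0 = length ps \<and>
     (\<forall>i<length cs. s aIn (b + i) = cs ! i) \<and>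
     (\<forall>v<length ps. \<forall>p<length cs. s aIn (b + length cs + 1 + v * length cs + p) = ps ! v ! p)"

lemma layout_cong:
  assumes "layout b cs ps s" "same_outside X s s'" "X \<inter> {aIn, vM, vN, vB} = {}"
  shows "layout b cs ps s'"
  using assms by (simp add: layout_def same_outside_def)

definition votes_q :: com where
  "votes_q = For vQ (Var vP) (Store vAcc (Const 0) (Var vAcc \<oplus> agree_exp))"
definition votes_p :: com where
  "votes_p = For vP (Var vM) votes_q"
definition votes_v :: com where
  "votes_v = For vV (Var vN) votes_p"
definition weight_j :: com where
  "weight_j = For vJ (Var vM) (Seq (Store vAcc (Const 0) (Const 0)) (Seq votes_v
     (Store aW (Var vI \<otimes> Var vM \<oplus> Var vJ)
       (Var vAcc \<oplus> Var vH \<otimes> (Const 1 \<ominus> (Var vN \<ominus> Var vAcc))))))"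
definition weight_com :: com where
  "weight_com = For vI (Var vM) weight_j"

definition agree :: "nat list \<Rightarrow> nat list list \<Rightarrow> nat \<Rightarrow> nat \<Rightarrow> nat \<Rightarrow> nat \<Rightarrow> nat \<Rightarrow> nat" where
  "agree cs ps i j v p q = of_bool (ps ! v ! p = cs ! i \<and> ps ! v ! q = cs ! j)"

text \<open>In a duplicate-free vote each of the two candidates has at most one position, so at most
  one summand is 1.\<close>

lemma sum_agree:
  assumes "distinct (ps ! v)" "length (ps ! v) = m"
  shows "(\<Sum>p<m. \<Sum>q<p. agree cs ps i j v p q) = of_bool (before (ps ! v) (cs ! j) (cs ! i))"
proof -
  let ?\<pi> = "ps ! v"
  let ?S = "SIGMA p:{..<m}. {..<p}"
  let ?A = "{(p, q) \<in> ?S. ?\<pi> ! p = cs ! i \<and> ?\<pi> ! q = cs ! j}"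
  have "(\<Sum>p<m. \<Sum>q<p. agree cs ps i j v p q) = (\<Sum>(p, q)\<in>?S. agree cs ps i j v p q)"
    by (rule sum.Sigma) auto
  also have "\<dots> = card ?A"
    by (simp add: agree_def case_prod_beta' Int_def Sigma_def) (rule arg_cong[where f = card], auto)
  also have "card ?A = of_bool (before ?\<pi> (cs ! j) (cs ! i))"
  proof (cases "before ?\<pi> (cs ! j) (cs ! i)")
    case True
    then obtain q p where qp: "q < p" "p < m" "?\<pi> ! q = cs ! j" "?\<pi> ! p = cs ! i"
      using assms(2) by (auto simp: before_def)
    have "?A = {(p, q)}"
    proof -
      have "p' = p \<and> q' = q"
        if "q' < p'" "p' < m" "?\<pi> ! q' = cs ! j" "?\<pi> ! p' = cs ! i" for p' q'
        using that qp assms nth_eq_iff_index_eq[OF assms(1), of p' p]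
          nth_eq_iff_index_eq[OF assms(1), of q' q] by auto
      then have "?A \<subseteq> {(p, q)}" by fast
      moreover have "(p, q) \<in> ?A" using qp by simp
      ultimately show ?thesis by blast
    qed
    then show ?thesis using True by simp
  next
    case False
    then have "?A = {}" using assms(2) by (auto simp: before_def)
    then have "card ?A = 0" by (simp only: card.empty)
    then show ?thesis using False by simp
  qed
  finally show ?thesis .
qed

lemma length_vote:
  assumes "profile cs ps" "\<pi> \<in> set ps"
  shows "length \<pi> = length cs"
proof -
  have "\<pi> \<in> permutations_of_set (set cs)" "distinct cs" using assms by (auto simp: profile_def)
  then show ?thesis
    using length_finite_permutations_of_set[of \<pi> "set cs"] by (simp add: distinct_card)
qed

lemma sum_agree_votes:
  assumes "profile cs ps"
  shows "(\<Sum>v<length ps. \<Sum>p<length cs. \<Sum>q<p. agree cs ps i j v p q)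
    = preferring ps (cs ! j) (cs ! i)"
proof -
  have "distinct (ps ! v) \<and> length (ps ! v) = length cs" if "v < length ps" for v
  proof -
    have "ps ! v \<in> permutations_of_set (set cs)"
      using assms that by (auto simp: profile_def)
    then show ?thesis
      using length_vote[OF assms, of "ps ! v"] that by (simp add: permutations_of_setD)
  qed
  then have "(\<Sum>v<length ps. \<Sum>p<length cs. \<Sum>q<p. agree cs ps i j v p q)
      = (\<Sum>v<length ps. of_bool (before (ps ! v) (cs ! j) (cs ! i)))"
    by (intro sum.cong refl) (simp add: sum_agree)
  also have "\<dots> = card {v. v < length ps \<and> before (ps ! v) (cs ! j) (cs ! i)}"
    by (simp add: Int_def lessThan_def)
  also have "\<dots> = preferring ps (cs ! j) (cs ! i)"
    by (simp add: preferring_def length_filter_conv_card)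
  finally show ?thesis .
qed

lemma exp_val_agree_exp:
  assumes "layout b cs ps s" "s vI 0 = i" "s vJ 0 = j" "s vV 0 = v" "s vP 0 = p" "s vQ 0 = q"
    and "i < length cs" "j < length cs" "v < length ps" "p < length cs" "q < length cs"
  shows "exp_val s agree_exp = agree cs ps i j v p q"
proof -
  have "exp_val s (vote_exp vP) = ps ! v ! p" "exp_val s (vote_exp vQ) = ps ! v ! q"
    "exp_val s (cand_exp vI) = cs ! i" "exp_val s (cand_exp vJ) = cs ! j"
    using assms by (simp_all add: layout_def vote_exp_def cand_exp_def)
  then show ?thesis
    by (auto simp: agree_exp_def neq_exp_def agree_def of_bool_def)
qed

lemma exp_weight_agree_exp: "exp_weight agree_exp \<le> 500"
  by (simp add: agree_exp_def neq_exp_def vote_exp_def cand_exp_def)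

lemma sum_agree_le: "(\<Sum>q<p. agree cs ps i j v p' q) \<le> p"
  using sum_bounded_above[of "{..<p}" "\<lambda>q. agree cs ps i j v p' q" 1] by (simp add: agree_def)

lemma exec_votes_q:
  assumes lay: "layout b cs ps s" and ix: "s vI 0 = i" "s vJ 0 = j" "s vV 0 = v" "s vP 0 = p"
    "i < length cs" "j < length cs" "v < length ps" "p < length cs"
    and L: "s vAcc 0 + length cs < 2 ^ L"
  shows "exec L votes_q (600 * (length cs + 1)) s (\<lambda>s'. same_outside {vAcc, vQ} s s' \<and>
    s' vAcc 0 = s vAcc 0 + (\<Sum>q<p. agree cs ps i j v p q))"
  unfolding votes_q_def
proof (rule exec_For[where T = 560 and n = p and
      I = "\<lambda>q s'. same_outside {vAcc, vQ} s s' \<and> s' vAcc 0 = s vAcc 0 + (\<Sum>q<q. agree cs ps i j v p q)"])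
  fix q s' assume q: "q < p"
    and I: "same_outside {vAcc, vQ} s s' \<and> s' vAcc 0 = s vAcc 0 + (\<Sum>q<q. agree cs ps i j v p q)"
    and v: "s' vQ 0 = q"
  have lay': "layout b cs ps s'" by (rule layout_cong[OF lay conjunct1[OF I]]) simp
  have val: "exp_val s' agree_exp = agree cs ps i j v p q"
    by (rule exp_val_agree_exp[OF lay']) (use I v q ix in \<open>simp_all add: same_outside_def\<close>)
  have le: "s vAcc 0 + (\<Sum>q<Suc q. agree cs ps i j v p q) < 2 ^ L"
    using L q ix sum_agree_le[where p = "Suc q" and cs=cs and ps=ps and i=i and j=j and v=v and p'=p] by linarith
  show "exec L (Store vAcc (Const 0) (Var vAcc \<oplus> agree_exp)) 560 s'
    (\<lambda>s''. s'' vQ 0 = q \<and> same_outside {vAcc, vQ} s (set_var s'' vQ (Suc q)) \<and>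
      set_var s'' vQ (Suc q) vAcc 0 = s vAcc 0 + (\<Sum>q<Suc q. agree cs ps i j v p q))"
  proof (rule exec_Store')
    show "exp_val s' (Var vAcc \<oplus> agree_exp) = s vAcc 0 + (\<Sum>q<Suc q. agree cs ps i j v p q)"
      using I val by simp
    have "exp_width agree_exp \<le> 20"
      by (simp add: agree_exp_def neq_exp_def vote_exp_def cand_exp_def)
    then show "1 + exp_weight (Const 0) + exp_weight (Var vAcc \<oplus> agree_exp) \<le> 560"
      using exp_weight_agree_exp by simp
  qed (use I v le in auto)
qed (use ix L in \<open>auto simp: same_outside_def\<close>)

lemma exec_votes_p:
  assumes lay: "layout b cs ps s" and ix: "s vI 0 = i" "s vJ 0 = j" "s vV 0 = v"
    "i < length cs" "j < length cs" "v < length ps"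
    and L: "s vAcc 0 + length cs * length cs < 2 ^ L" "length cs < 2 ^ L"
  shows "exec L votes_p (700 * ((length cs + 1) * (length cs + 1))) s (\<lambda>s'. same_outside {vAcc, vQ, vP} s s' \<and>
    s' vAcc 0 = s vAcc 0 + (\<Sum>p<length cs. \<Sum>q<p. agree cs ps i j v p q))"
  unfolding votes_p_def
proof (rule exec_For[where T = "600 * (length cs + 1)" and n = "length cs" and
      I = "\<lambda>p s'. same_outside {vAcc, vQ, vP} s s' \<and>
        s' vAcc 0 = s vAcc 0 + (\<Sum>p<p. \<Sum>q<p. agree cs ps i j v p q)"])
  fix p s' assume p: "p < length cs"
    and I: "same_outside {vAcc, vQ, vP} s s' \<and>
      s' vAcc 0 = s vAcc 0 + (\<Sum>p<p. \<Sum>q<p. agree cs ps i j v p q)"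
    and v: "s' vP 0 = p"
  have lay': "layout b cs ps s'" by (rule layout_cong[OF lay conjunct1[OF I]]) simp
  \<comment> \<open>A crude estimate is enough, as it only keeps the accumulator below
    \<open>2 ^ L\<close>.\<close>
  have "(\<Sum>p<p. \<Sum>q<p. agree cs ps i j v p q) \<le> p * length cs"
  proof -
    have "(\<Sum>p<p. \<Sum>q<p. agree cs ps i j v p q) \<le> (\<Sum>p<p. length cs)"
      using p by (intro sum_mono le_trans[OF sum_agree_le]) simp
    then show ?thesis by simp
  qed
  moreover have "p * length cs + length cs \<le> length cs * length cs"
    using mult_le_mono1[of "Suc p" "length cs" "length cs"] p by simp
  ultimately have le: "s' vAcc 0 + length cs < 2 ^ L" using I L by linarith
  show "exec L votes_q (600 * (length cs + 1)) s'
    (\<lambda>s''. s'' vP 0 = p \<and> same_outside {vAcc, vQ, vP} s (set_var s'' vP (Suc p)) \<and>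
      set_var s'' vP (Suc p) vAcc 0 = s vAcc 0 + (\<Sum>p<Suc p. \<Sum>q<p. agree cs ps i j v p q))"
  proof (rule exec_mono[OF exec_votes_q[OF lay'] order_refl])
    fix s'' assume "same_outside {vAcc, vQ} s' s'' \<and>
      s'' vAcc 0 = s' vAcc 0 + (\<Sum>q<p. agree cs ps i j v p q)"
    then show "s'' vP 0 = p \<and> same_outside {vAcc, vQ, vP} s (set_var s'' vP (Suc p)) \<and>
      set_var s'' vP (Suc p) vAcc 0 = s vAcc 0 + (\<Sum>p<Suc p. \<Sum>q<p. agree cs ps i j v p q)"
      using I v by (simp add: same_outside_def)
  qed (use I v p ix le in \<open>simp_all add: same_outside_def\<close>)
qed (rule loop_bound | use lay L in \<open>simp add: same_outside_def layout_def\<close>)+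

lemma exec_votes_v:
  assumes lay: "layout b cs ps s" and ix: "s vI 0 = i" "s vJ 0 = j" "i < length cs" "j < length cs"
    and L: "s vAcc 0 + length ps * (length cs * length cs) < 2 ^ L" "length cs < 2 ^ L" "length ps < 2 ^ L"
  shows "exec L votes_v (800 * ((length ps + 1) * ((length cs + 1) * (length cs + 1)))) s (\<lambda>s'.
    same_outside {vAcc, vQ, vP, vV} s s' \<and>
    s' vAcc 0 = s vAcc 0 + (\<Sum>v<length ps. \<Sum>p<length cs. \<Sum>q<p. agree cs ps i j v p q))"
  unfolding votes_v_def
proof (rule exec_For[where T = "700 * ((length cs + 1) * (length cs + 1))" and n = "length ps" and
      I = "\<lambda>v s'. same_outside {vAcc, vQ, vP, vV} s s' \<and>
        s' vAcc 0 = s vAcc 0 + (\<Sum>v<v. \<Sum>p<length cs. \<Sum>q<p. agree cs ps i j v p q)"])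
  fix v s' assume v: "v < length ps"
    and I: "same_outside {vAcc, vQ, vP, vV} s s' \<and>
      s' vAcc 0 = s vAcc 0 + (\<Sum>v<v. \<Sum>p<length cs. \<Sum>q<p. agree cs ps i j v p q)"
    and w: "s' vV 0 = v"
  have lay': "layout b cs ps s'" by (rule layout_cong[OF lay conjunct1[OF I]]) simp
  have "(\<Sum>v<v. \<Sum>p<length cs. \<Sum>q<p. agree cs ps i j v p q) \<le> v * (length cs * length cs)"
  proof -
    have "(\<Sum>v<v. \<Sum>p<length cs. \<Sum>q<p. agree cs ps i j v p q)
        \<le> (\<Sum>v<v. \<Sum>p<length cs. length cs)"
      by (intro sum_mono le_trans[OF sum_agree_le]) simp
    then show ?thesis by simp
  qed
  moreover have "v * (length cs * length cs) + length cs * length cs \<le> length ps * (length cs * length cs)"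
    using mult_le_mono1[of "Suc v" "length ps" "length cs * length cs"] v by simp
  ultimately have le: "s' vAcc 0 + length cs * length cs < 2 ^ L" using I L by linarith
  show "exec L votes_p (700 * ((length cs + 1) * (length cs + 1))) s'
    (\<lambda>s''. s'' vV 0 = v \<and> same_outside {vAcc, vQ, vP, vV} s (set_var s'' vV (Suc v)) \<and>
      set_var s'' vV (Suc v) vAcc 0
        = s vAcc 0 + (\<Sum>v<Suc v. \<Sum>p<length cs. \<Sum>q<p. agree cs ps i j v p q))"
  proof (rule exec_mono[OF exec_votes_p[OF lay'] order_refl])
    fix s'' assume "same_outside {vAcc, vQ, vP} s' s'' \<and>
      s'' vAcc 0 = s' vAcc 0 + (\<Sum>p<length cs. \<Sum>q<p. agree cs ps i j v p q)"
    then show "s'' vV 0 = v \<and> same_outside {vAcc, vQ, vP, vV} s (set_var s'' vV (Suc v)) \<and>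
      set_var s'' vV (Suc v) vAcc 0
        = s vAcc 0 + (\<Sum>v<Suc v. \<Sum>p<length cs. \<Sum>q<p. agree cs ps i j v p q)"
      using I w by (simp add: same_outside_def)
  qed (use I v w ix le L in \<open>simp_all add: same_outside_def\<close>)
qed (rule loop_bound | use lay L in \<open>simp add: same_outside_def layout_def\<close>)+

lemma row_major_inj:
  fixes i j i' j' m :: nat
  assumes "j < m" "j' < m" "i * m + j = i' * m + j'"
  shows "i = i' \<and> j = j'"
proof -
  have "(i * m + j) div m = i" "(i' * m + j') div m = i'" using assms(1,2) by auto
  then show ?thesis using assms(3) by simp
qed

text \<open>The postcondition describes the whole array and not just row \<open>i\<close>, so that
  the outer loop can infer that finished rows survive.\<close>

lemma exec_weight_j:
  assumes lay: "layout b cs ps s" and prof: "profile cs ps" and ix: "s vI 0 = i" "i < length cs"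
    and h: "s vH 0 = H"
    and L: "length ps * (length cs * length cs) < 2 ^ L" "length cs < 2 ^ L" "length ps + H < 2 ^ L"
  defines "m \<equiv> length cs"
  shows "exec L weight_j (1000 * ((m + 1) * ((length ps + 1) * ((m + 1) * (m + 1))))) s (\<lambda>s'.
    same_outside {vAcc, vQ, vP, vV, vJ, aW} s s' \<and>
    s' aW = (\<lambda>a. if \<exists>j<m. a = i * m + j then weight H cs ps i (a - i * m) else s aW a))"
  unfolding weight_j_def
proof (rule exec_For[where T = "850 * ((length ps + 1) * ((m + 1) * (m + 1)))" and n = m and
      I = "\<lambda>j s'. same_outside {vAcc, vQ, vP, vV, vJ, aW} s s' \<and>
        s' aW = (\<lambda>a. if \<exists>j'<j. a = i * m + j' then weight H cs ps i (a - i * m) else s aW a)"])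
  fix j s' assume j: "j < m"
    and I: "same_outside {vAcc, vQ, vP, vV, vJ, aW} s s' \<and>
        s' aW = (\<lambda>a. if \<exists>j'<j. a = i * m + j' then weight H cs ps i (a - i * m) else s aW a)"
    and w: "s' vJ 0 = j"
  let ?s = "s'(vAcc := (s' vAcc)(0 := 0))"
  have same': "same_outside {vAcc, vQ, vP, vV, vJ, aW} s ?s" using I by simp
  have lay': "layout b cs ps ?s" by (rule layout_cong[OF lay same']) simp
  have votes: "exec L votes_v (800 * ((length ps + 1) * ((m + 1) * (m + 1)))) ?s (\<lambda>s'.
    same_outside {vAcc, vQ, vP, vV} ?s s' \<and>
    s' vAcc 0 = ?s vAcc 0 + (\<Sum>v<length ps. \<Sum>p<length cs. \<Sum>q<p. agree cs ps i j v p q))"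
    unfolding m_def
  proof (rule exec_votes_v[OF lay'])
    show "?s vI 0 = i" using same' ix by (simp add: same_outside_def)
  qed (use ix w j L in \<open>simp_all add: m_def\<close>)
  show "exec L (Seq (Store vAcc (Const 0) (Const 0)) (Seq votes_v
     (Store aW (Var vI \<otimes> Var vM \<oplus> Var vJ)
       (Var vAcc \<oplus> Var vH \<otimes> (Const 1 \<ominus> (Var vN \<ominus> Var vAcc))))))
     (850 * ((length ps + 1) * ((m + 1) * (m + 1)))) s' (\<lambda>s'. s' vJ 0 = j \<and>
       same_outside {vAcc, vQ, vP, vV, vJ, aW} s (set_var s' vJ (Suc j)) \<and>
       set_var s' vJ (Suc j) aW
         = (\<lambda>a. if \<exists>j'<Suc j. a = i * m + j' then weight H cs ps i (a - i * m) else s aW a))"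
  proof (rule exec_Store_Seq[OF _ _ _ exec_Seq'[OF votes]])
    fix s'' assume R: "same_outside {vAcc, vQ, vP, vV} ?s s'' \<and>
      s'' vAcc 0 = ?s vAcc 0 + (\<Sum>v<length ps. \<Sum>p<length cs. \<Sum>q<p. agree cs ps i j v p q)"
    then have acc: "s'' vAcc 0 = preferring ps (cs ! j) (cs ! i)"
      by (simp add: sum_agree_votes[OF prof])
    have val: "s'' vI 0 = i" "s'' vM 0 = m" "s'' vJ 0 = j" "s'' vH 0 = H" "s'' vN 0 = length ps"
      "s'' aW = s' aW"
      using R I w ix h lay by (simp_all add: same_outside_def layout_def m_def)
    have "H * (1 - (length ps - preferring ps (cs ! j) (cs ! i))) \<le> H * 1"
      by (intro mult_le_mono) auto
    then have le: "weight H cs ps i j < 2 ^ L"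
      using L preferring_le[of ps "cs ! j" "cs ! i"] unfolding weight_def by linarith
    show "exec L (Store aW (Var vI \<otimes> Var vM \<oplus> Var vJ)
       (Var vAcc \<oplus> Var vH \<otimes> (Const 1 \<ominus> (Var vN \<ominus> Var vAcc)))) 40 s'' (\<lambda>s'. s' vJ 0 = j \<and>
       same_outside {vAcc, vQ, vP, vV, vJ, aW} s (set_var s' vJ (Suc j)) \<and>
       set_var s' vJ (Suc j) aW
         = (\<lambda>a. if \<exists>j'<Suc j. a = i * m + j' then weight H cs ps i (a - i * m) else s aW a))"
    proof (rule exec_Store'[where i = "i * m + j" and v = "weight H cs ps i j"])
      have "same_outside {vAcc, vQ, vP, vV, vJ, aW} s s''"
        using I R by (simp add: same_outside_def)
      then show "(s''(aW := (s'' aW)(i * m + j := weight H cs ps i j))) vJ 0 = j \<and>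
         same_outside {vAcc, vQ, vP, vV, vJ, aW} s
           (set_var (s''(aW := (s'' aW)(i * m + j := weight H cs ps i j))) vJ (Suc j)) \<and>
         set_var (s''(aW := (s'' aW)(i * m + j := weight H cs ps i j))) vJ (Suc j) aW
         = (\<lambda>a. if \<exists>j'<Suc j. a = i * m + j' then weight H cs ps i (a - i * m) else s aW a)"
        using I val by (simp add: fun_eq_iff less_Suc_eq) (metis add_diff_cancel_left')
    qed (use val acc le in \<open>simp_all add: weight_def\<close>)
  next
    show "800 * ((length ps + 1) * ((m + 1) * (m + 1))) + 40 \<le> 840 * ((length ps + 1) * ((m + 1) * (m + 1)))"
      by simp
    show "1 + exp_weight (Const 0) + exp_weight (Const 0) + 840 * ((length ps + 1) * ((m + 1) * (m + 1)))
        \<le> 850 * ((length ps + 1) * ((m + 1) * (m + 1)))"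
      by simp
  qed simp_all
qed (rule loop_bound | use lay L in \<open>simp add: same_outside_def layout_def m_def\<close>)+

text \<open>Without candidates all votes are empty, and their number may be exponential in the input size.\<close>

lemma exec_weight_com_0:
  assumes "s vM 0 = 0"
  shows "exec L weight_com 1100 s (same_outside {vAcc, vQ, vP, vV, vJ, vI, aW} s)"
  unfolding weight_com_def
  by (rule exec_For[where n = 0 and T = 0 and I = "\<lambda>_. same_outside {vAcc, vQ, vP, vV, vJ, vI, aW} s"])
    (use assms in \<open>simp_all add: same_outside_def\<close>)

lemma exec_weight_com:
  assumes lay: "layout b cs ps s" and prof: "profile cs ps" and h: "s vH 0 = H"
    and L: "length ps * (length cs * length cs) < 2 ^ L" "length cs < 2 ^ L" "length ps + H < 2 ^ L"
  defines "m \<equiv> length cs"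
  shows "exec L weight_com (1100 * ((m + 1) * ((m + 1) * ((length ps + 1) * ((m + 1) * (m + 1)))))) s (\<lambda>s'.
    same_outside {vAcc, vQ, vP, vV, vJ, vI, aW} s s' \<and>
    (\<forall>i<m. \<forall>j<m. s' aW (i * m + j) = weight H cs ps i j))"
  unfolding weight_com_def
proof (rule exec_For[where T = "1000 * ((m + 1) * ((length ps + 1) * ((m + 1) * (m + 1))))" and n = m and
      I = "\<lambda>i s'. same_outside {vAcc, vQ, vP, vV, vJ, vI, aW} s s' \<and>
        (\<forall>i'<i. \<forall>j<m. s' aW (i' * m + j) = weight H cs ps i' j)"])
  fix i s' assume i: "i < m"
    and I: "same_outside {vAcc, vQ, vP, vV, vJ, vI, aW} s s' \<and>
        (\<forall>i'<i. \<forall>j<m. s' aW (i' * m + j) = weight H cs ps i' j)"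
    and w: "s' vI 0 = i"
  have lay': "layout b cs ps s'" by (rule layout_cong[OF lay conjunct1[OF I]]) simp
  have ex: "exec L weight_j (1000 * ((m + 1) * ((length ps + 1) * ((m + 1) * (m + 1))))) s' (\<lambda>s''.
    same_outside {vAcc, vQ, vP, vV, vJ, aW} s' s'' \<and>
    s'' aW = (\<lambda>a. if \<exists>j<m. a = i * m + j then weight H cs ps i (a - i * m) else s' aW a))"
    unfolding m_def
    by (rule exec_weight_j[OF lay' prof w]) (use I i h L in \<open>simp_all add: same_outside_def m_def\<close>)
  show "exec L weight_j (1000 * ((m + 1) * ((length ps + 1) * ((m + 1) * (m + 1))))) s' (\<lambda>s'. s' vI 0 = i \<and>
     same_outside {vAcc, vQ, vP, vV, vJ, vI, aW} s (set_var s' vI (Suc i)) \<and>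
     (\<forall>i'<Suc i. \<forall>j<m. set_var s' vI (Suc i) aW (i' * m + j) = weight H cs ps i' j))"
  proof (rule exec_mono[OF ex order_refl], intro conjI allI impI)
    fix s'' assume R: "same_outside {vAcc, vQ, vP, vV, vJ, aW} s' s'' \<and>
      s'' aW = (\<lambda>a. if \<exists>j<m. a = i * m + j then weight H cs ps i (a - i * m) else s' aW a)"
    show "s'' vI 0 = i" using R w by (simp add: same_outside_def)
    show "same_outside {vAcc, vQ, vP, vV, vJ, vI, aW} s (set_var s'' vI (Suc i))"
      using R I by (simp add: same_outside_def)
    fix i' j assume "i' < Suc i" "j < m"
    then show "set_var s'' vI (Suc i) aW (i' * m + j) = weight H cs ps i' j"
      using R I row_major_inj[of j m _ i' i] by (cases "i' = i") auto
  qed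
qed (rule loop_bound | use lay L in \<open>simp add: same_outside_def layout_def m_def\<close>)+

subsection \<open>Optimal costs of all subsets\<close>

definition tables :: "nat \<Rightarrow> (nat \<Rightarrow> nat \<Rightarrow> nat) \<Rightarrow> state \<Rightarrow> bool" where
  "tables m W s \<longleftrightarrow> s vM 0 = m \<and> (\<forall>i\<le>m. s aPow i = 2 ^ i) \<and>
     (\<forall>i<m. \<forall>j<m. s aW (i * m + j) = W i j)"

lemma tables_cong:
  assumes "tables m W s" "same_outside X s s'" "X \<inter> {vM, aPow, aW} = {}"
  shows "tables m W s'"
  using assms by (simp add: tables_def same_outside_def)

text \<open>The price paid by \<open>x\<close> for being placed below all elements of the set coded
  in \<open>vRest\<close>. Both the table and the search use it.\<close>

definition dcost_com :: com where
  "dcost_com = Seq (Store vAcc (Const 0) (Const 0)) (For vY (Var vM) (Store vAcc (Const 0)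
     (Var vAcc \<oplus> bit_exp (Var vRest) (Var vY) \<otimes> Load aW (Var vY \<otimes> Var vM \<oplus> Var vX))))"

lemma exec_dcost_com:
  assumes tab: "tables m W s" and x: "s vX 0 = x" "x < m" and R: "s vRest 0 = R" "R < 2 ^ m"
    and w: "\<And>i j. W i j \<le> w" and L: "m * w < 2 ^ L" "m < 2 ^ L"
  shows "exec L dcost_com (200 * (m + 1)) s (\<lambda>s'. same_outside {vAcc, vY} s s' \<and>
    s' vAcc 0 = (\<Sum>y\<in>bits_of R. W y x))"
proof -
  let ?f = "\<lambda>y. of_bool (bit R y) * W y x"
  have sum_le: "(\<Sum>y<i. ?f y) \<le> i * w" for i
    using sum_bounded_above[of "{..<i}" ?f w] w by simp
  have final: "(\<Sum>y<m. ?f y) = (\<Sum>y\<in>bits_of R. W y x)"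
  proof -
    have "(\<Sum>y\<in>bits_of R. W y x) = (\<Sum>y\<in>bits_of R. ?f y)"
      by (rule sum.cong) (simp_all add: bits_of_def)
    also have "\<dots> = (\<Sum>y<m. ?f y)"
      using bits_of_subset[OF R(2)] by (intro sum.mono_neutral_left) (auto simp: bits_of_def)
    finally show ?thesis by simp
  qed
  let ?s = "set_var s vAcc 0"
  let ?I = "\<lambda>i s'. same_outside {vAcc, vY} s s' \<and> s' vAcc 0 = (\<Sum>y<i. ?f y)"
  have "exec L (For vY (Var vM) (Store vAcc (Const 0)
     (Var vAcc \<oplus> bit_exp (Var vRest) (Var vY) \<otimes> Load aW (Var vY \<otimes> Var vM \<oplus> Var vX))))
     (150 * ((m + 1) * 1)) ?s (?I m)"
  \<comment> \<open>The factors 1 here and in the budget \<open>150 * ((m + 1) * 1)\<close> let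
    \<open>loop_bound\<close> apply with \<open>x = 1\<close>.\<close>
  proof (rule exec_For[where I = ?I and n = m and T = "100 * 1"])
    fix i s' assume i: "i < m" and I: "?I i s'" and v: "s' vY 0 = i"
    have tab': "tables m W s'" by (rule tables_cong[OF tab conjunct1[OF I]]) simp
    have val: "s' vRest 0 = R" "s' vX 0 = x" "s' vM 0 = m" "s' aPow i = 2 ^ i" "s' aW (i * m + x) = W i x"
      using I x R tab' i by (simp_all add: same_outside_def tables_def)
    have le: "(\<Sum>y<Suc i. ?f y) < 2 ^ L"
      using sum_le[of "Suc i"] i L mult_le_mono1[of "Suc i" m w] by linarith
    show "exec L (Store vAcc (Const 0)
       (Var vAcc \<oplus> bit_exp (Var vRest) (Var vY) \<otimes> Load aW (Var vY \<otimes> Var vM \<oplus> Var vX))) (100 * 1) s'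
       (\<lambda>s'. s' vY 0 = i \<and> ?I (Suc i) (set_var s' vY (Suc i)))"
    proof (rule exec_Store'[where v = "\<Sum>y<Suc i. ?f y" and i = 0])
      show "exp_val s' (Var vAcc \<oplus> bit_exp (Var vRest) (Var vY) \<otimes> Load aW (Var vY \<otimes> Var vM \<oplus> Var vX))
          = (\<Sum>y<Suc i. ?f y)"
        using I v val by simp
    qed (use I v le in simp_all)
  next
    show "\<And>i s. i \<le> m \<Longrightarrow> ?I i s \<Longrightarrow> exp_val s (Var vM) = m"
      using tab by (simp add: same_outside_def tables_def)
  qed (rule loop_bound | use L in simp)+
  then have "exec L (For vY (Var vM) (Store vAcc (Const 0)
     (Var vAcc \<oplus> bit_exp (Var vRest) (Var vY) \<otimes> Load aW (Var vY \<otimes> Var vM \<oplus> Var vX))))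
     (150 * (m + 1)) ?s (\<lambda>s'. same_outside {vAcc, vY} s s' \<and> s' vAcc 0 = (\<Sum>y\<in>bits_of R. W y x))"
    by (simp only: final mult_1_right)
  then show ?thesis
    unfolding dcost_com_def by (rule exec_Store_Seq[rotated 3]) simp_all
qed

definition min_exp :: "exp \<Rightarrow> exp \<Rightarrow> exp" where
  "min_exp e1 e2 = e1 \<ominus> (e1 \<ominus> e2)"

lemma exp_val_min_exp [simp]: "exp_val s (min_exp e1 e2) = min (exp_val s e1) (exp_val s e2)"
  by (simp add: min_exp_def)

definition opt_x :: com where
  "opt_x = For vX (Var vM) (Cond (bit_exp (Var vS) (Var vX))
     (Seq (Store vRest (Const 0) (Var vS \<ominus> Load aPow (Var vX)))
     (Seq dcost_com
       (Store aOpt (Var vS) (min_exp (Load aOpt (Var vS)) (Load aOpt (Var vRest) \<oplus> Var vAcc)))))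
     Skip)"

text \<open>Each entry starts at the cap except that of the empty set, which costs 0; the doubled
  truncated difference is the indicator of a nonzero code.\<close>

definition opt_com :: com where
  "opt_com = For vS (Load aPow (Var vM))
     (Seq (Store aOpt (Var vS) (Var vG \<otimes> (Const 1 \<ominus> (Const 1 \<ominus> Var vS)))) opt_x)"

abbreviation (input) "XOpt \<equiv> {aOpt, vX, vRest, vAcc, vY}"

lemma exec_opt_x:
  assumes tab: "tables m W s" and S: "s vS 0 = S" "S < 2 ^ m"
    and opt: "\<forall>S'<S. s aOpt S' = opt_cost W G (bits_of S')"
    and init: "s aOpt S = (if S = 0 then 0 else G)"
    and w: "\<And>i j. W i j \<le> w" and L: "m * w < 2 ^ L" "m < L" "G < 2 ^ L"
  shows "exec L opt_x (500 * ((m + 1) * (m + 1))) s (\<lambda>s'. same_outside XOpt s s' \<and>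
    (\<forall>S'\<le>S. s' aOpt S' = opt_cost W G (bits_of S')))"
proof -
  let ?R = "bits_of S"
  let ?f = "\<lambda>x. opt_cost W G (?R - {x}) + (\<Sum>y\<in>?R - {x}. W y x)"
  \<comment> \<open>The minimum over the bottom elements tried so far. The empty set is treated
    apart because the recursion does not cover it.\<close>
  let ?g = "\<lambda>i. if S = 0 then 0 else Min (insert G (?f ` {x. x < i \<and> x \<in> ?R}))"
  let ?I = "\<lambda>i s'. same_outside XOpt s s' \<and> (\<forall>S'<S. s' aOpt S' = opt_cost W G (bits_of S')) \<and> s' aOpt S = ?g i"
  have mL: "m < 2 ^ L" using L(2) less_exp[of L] by linarith
  have final: "?g m = opt_cost W G ?R"
  proof (cases "S = 0")
    case False
    have "{x. x < m \<and> x \<in> ?R} = ?R" using bits_of_subset[OF S(2)] by auto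
    then show ?thesis
      using False opt_cost_rec[of ?R W G] by (simp add: bits_of_eq_empty_iff)
  qed simp
  have g_le: "?g i < 2 ^ L" for i
  proof -
    have "Min (insert G (?f ` {x. x < i \<and> x \<in> ?R})) \<le> G" by (rule Min_le) auto
    then have "Min (insert G (?f ` {x. x < i \<and> x \<in> ?R})) < 2 ^ L"
      using L(3) by (rule le_less_trans)
    then show ?thesis by simp
  qed
  have g_Suc: "?g (Suc i) = (if bit S i then min (?g i) (?f i) else ?g i)" for i
  proof (cases "bit S i")
    case True
    have "S \<noteq> 0" using power_le_of_bit[OF True] by (cases S) auto
    have "{x. x < Suc i \<and> x \<in> ?R} = insert i {x. x < i \<and> x \<in> ?R}"
      using True by (auto simp: bits_of_def less_Suc_eq)
    then have "Min (insert G (?f ` {x. x < Suc i \<and> x \<in> ?R}))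
        = Min (insert (?f i) (insert G (?f ` {x. x < i \<and> x \<in> ?R})))"
      by (simp add: insert_commute)
    also have "\<dots> = min (?f i) (Min (insert G (?f ` {x. x < i \<and> x \<in> ?R})))"
      by (rule Min_insert) auto
    finally show ?thesis using True \<open>S \<noteq> 0\<close> by (simp add: min.commute)
  next
    case False
    then have "{x. x < Suc i \<and> x \<in> ?R} = {x. x < i \<and> x \<in> ?R}"
      by (auto simp: bits_of_def less_Suc_eq)
    then show ?thesis using False by simp
  qed
  have "exec L opt_x (500 * ((m + 1) * (m + 1))) s (\<lambda>s'. same_outside XOpt s s' \<and>
     (\<forall>S'<S. s' aOpt S' = opt_cost W G (bits_of S')) \<and> s' aOpt S = opt_cost W G ?R)"
    unfolding opt_x_def
  proof (rule exec_For[where I = ?I and n = m and T = "400 * (m + 1)"])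
    fix i s' assume i: "i < m" and I: "?I i s'" and v: "s' vX 0 = i"
    have tab': "tables m W s'" by (rule tables_cong[OF tab conjunct1[OF I]]) simp
    have val: "s' vS 0 = S" "s' vM 0 = m" "s' aPow i = 2 ^ i"
      using I S tab' i by (simp_all add: same_outside_def tables_def)
    have bit: "exp_val s' (bit_exp (Var vS) (Var vX)) = of_bool (bit S i)"
      using val v by simp
    show "exec L (Cond (bit_exp (Var vS) (Var vX))
       (Seq (Store vRest (Const 0) (Var vS \<ominus> Load aPow (Var vX)))
       (Seq dcost_com
         (Store aOpt (Var vS) (min_exp (Load aOpt (Var vS)) (Load aOpt (Var vRest) \<oplus> Var vAcc)))))
       Skip) (400 * (m + 1)) s' (\<lambda>s'. s' vX 0 = i \<and> ?I (Suc i) (set_var s' vX (Suc i)))"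
    proof (rule exec_Cond[where T' = "300 * (m + 1)"])
      assume "exp_val s' (bit_exp (Var vS) (Var vX)) = 0"
      then have "\<not> bit S i" using bit by simp
      then show "exec L Skip (300 * (m + 1)) s' (\<lambda>s'. s' vX 0 = i \<and> ?I (Suc i) (set_var s' vX (Suc i)))"
        using I v by (intro exec_Skip) (simp_all add: g_Suc)
    next
      assume "exp_val s' (bit_exp (Var vS) (Var vX)) \<noteq> 0"
      then have b: "bit S i" using bit by simp
      let ?S = "S - 2 ^ i"
      let ?s = "set_var s' vRest ?S"
      \<comment> \<open>The entry read in this round belongs to a smaller code and is therefore
        already final.\<close>
      have S_less: "?S < S" using power_le_of_bit[OF b] S by (intro diff_less) (auto intro: gr0I)
      have S_lessL: "?S < 2 ^ L"
        using S_less S(2) power_strict_increasing[OF L(2), of "2::nat"] by linarith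
      have tab'': "tables m W ?s" using tab' by (simp add: tables_def)
      have ds: "exec L dcost_com (200 * (m + 1)) ?s (\<lambda>s''. same_outside {vAcc, vY} ?s s'' \<and>
        s'' vAcc 0 = (\<Sum>y\<in>bits_of ?S. W y i))"
        by (rule exec_dcost_com[OF tab'' _ i _ _ w L(1) mL]) (use v S S_less in simp_all)
      show "exec L (Seq (Store vRest (Const 0) (Var vS \<ominus> Load aPow (Var vX)))
       (Seq dcost_com
         (Store aOpt (Var vS) (min_exp (Load aOpt (Var vS)) (Load aOpt (Var vRest) \<oplus> Var vAcc)))))
       (300 * (m + 1)) s' (\<lambda>s'. s' vX 0 = i \<and> ?I (Suc i) (set_var s' vX (Suc i)))"
      proof (rule exec_Store_Seq[OF _ _ _ exec_Seq'[OF ds]])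
        fix s'' assume D: "same_outside {vAcc, vY} ?s s'' \<and> s'' vAcc 0 = (\<Sum>y\<in>bits_of ?S. W y i)"
        have val'': "s'' vS 0 = S" "s'' vRest 0 = ?S" "s'' aOpt = s' aOpt" "s'' vX 0 = i"
          using D val v by (simp_all add: same_outside_def)
        have same'': "same_outside XOpt s s''"
          using D I by (simp add: same_outside_def)
        have fi: "s' aOpt ?S + s'' vAcc 0 = ?f i"
          using I D S_less by (simp add: bits_of_remove[OF b])
        have min: "?g (Suc i) = min (s' aOpt S) (s' aOpt ?S + s'' vAcc 0)"
          unfolding fi using I b g_Suc[of i] by (simp only: if_True)
        show "exec L (Store aOpt (Var vS) (min_exp (Load aOpt (Var vS)) (Load aOpt (Var vRest) \<oplus> Var vAcc)))
          30 s'' (\<lambda>s'. s' vX 0 = i \<and> ?I (Suc i) (set_var s' vX (Suc i)))"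
        proof (rule exec_Store'[where i = S and v = "?g (Suc i)"])
          show "exp_val s'' (min_exp (Load aOpt (Var vS)) (Load aOpt (Var vRest) \<oplus> Var vAcc)) = ?g (Suc i)"
            unfolding min using val'' by simp
          show "?g (Suc i) < 2 ^ L" by (rule g_le)
          show "(s''(aOpt := (s'' aOpt)(S := ?g (Suc i)))) vX 0 = i \<and>
            ?I (Suc i) (set_var (s''(aOpt := (s'' aOpt)(S := ?g (Suc i)))) vX (Suc i))"
            using val'' same'' I by simp
        qed (use val'' in \<open>simp_all add: min_exp_def\<close>)
      next
        show "200 * (m + 1) + 30 \<le> 230 * (m + 1)" by simp
        show "1 + exp_weight (Const 0) + exp_weight (Var vS \<ominus> Load aPow (Var vX)) + 230 * (m + 1) \<le> 300 * (m + 1)"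
          by simp
      qed (use val v S_lessL in simp_all)
    qed simp
  next
    show "\<And>i s. i \<le> m \<Longrightarrow> ?I i s \<Longrightarrow> exp_val s (Var vM) = m"
      using tab by (simp add: same_outside_def tables_def)
    show "?I 0 (set_var s vX 0)" using opt init by simp
    fix s' assume I: "?I m s'"
    then have "s' aOpt S = opt_cost W G ?R" unfolding final by simp
    then show "same_outside XOpt s s' \<and>
      (\<forall>S'<S. s' aOpt S' = opt_cost W G (bits_of S')) \<and> s' aOpt S = opt_cost W G ?R"
      using I by simp
  qed (rule loop_bound | use mL in simp)+
  then show ?thesis
    by (rule exec_mono) (auto simp: le_less)
qed

lemma exec_opt_com:
  assumes tab: "tables m W s" and G: "s vG 0 = G"
    and w: "\<And>i j. W i j \<le> w" and L: "m * w < 2 ^ L" "m < L" "G < 2 ^ L"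
  shows "exec L opt_com (700 * ((2 ^ m + 1) * ((m + 1) * (m + 1)))) s (\<lambda>s'.
    same_outside (insert vS XOpt) s s' \<and> (\<forall>S<2 ^ m. s' aOpt S = opt_cost W G (bits_of S)))"
  unfolding opt_com_def
proof (rule exec_For[where n = "2 ^ m" and T = "600 * ((m + 1) * (m + 1))" and
      I = "\<lambda>i s'. same_outside (insert vS XOpt) s s' \<and> (\<forall>S<i. s' aOpt S = opt_cost W G (bits_of S))"])
  fix S s' assume S: "S < 2 ^ m" and v: "s' vS 0 = S"
    and I: "same_outside (insert vS XOpt) s s' \<and> (\<forall>S'<S. s' aOpt S' = opt_cost W G (bits_of S'))"
  let ?g = "if S = 0 then 0 else G"
  let ?s = "s'(aOpt := (s' aOpt)(S := ?g))"
  have tab': "tables m W ?s"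
    by (rule tables_cong[OF tab, of "insert vS XOpt"]) (use I in simp_all)
  have val: "s' vG 0 = G" using I G by (simp add: same_outside_def)
  show "exec L (Seq (Store aOpt (Var vS) (Var vG \<otimes> (Const 1 \<ominus> (Const 1 \<ominus> Var vS)))) opt_x)
    (600 * ((m + 1) * (m + 1))) s' (\<lambda>s'. s' vS 0 = S \<and>
      same_outside (insert vS XOpt) s (set_var s' vS (Suc S)) \<and>
      (\<forall>S'<Suc S. set_var s' vS (Suc S) aOpt S' = opt_cost W G (bits_of S')))"
  proof (rule exec_Store_Seq[where i = S and v = ?g])
    have "exec L opt_x (500 * ((m + 1) * (m + 1))) ?s (\<lambda>s''. same_outside XOpt ?s s'' \<and>
      (\<forall>S'\<le>S. s'' aOpt S' = opt_cost W G (bits_of S')))"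
      by (rule exec_opt_x[OF tab' _ S _ _ w L]) (use I v in simp_all)
    then show "exec L opt_x (500 * ((m + 1) * (m + 1))) ?s (\<lambda>s'. s' vS 0 = S \<and>
      same_outside (insert vS XOpt) s (set_var s' vS (Suc S)) \<and>
      (\<forall>S'<Suc S. set_var s' vS (Suc S) aOpt S' = opt_cost W G (bits_of S')))"
    proof (rule exec_mono[OF _ order_refl])
      fix s'' assume D: "same_outside XOpt ?s s'' \<and>
        (\<forall>S'\<le>S. s'' aOpt S' = opt_cost W G (bits_of S'))"
      then have "s'' vS 0 = S" using v by (simp add: same_outside_def)
      moreover have "same_outside (insert vS XOpt) s s''"
        using D I by (simp add: same_outside_def)
      ultimately show "s'' vS 0 = S \<and>
        same_outside (insert vS XOpt) s (set_var s'' vS (Suc S)) \<and>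
        (\<forall>S'<Suc S. set_var s'' vS (Suc S) aOpt S' = opt_cost W G (bits_of S'))"
        using D by (simp add: less_Suc_eq_le)
    qed
    show "1 + exp_weight (Var vS) + exp_weight (Var vG \<otimes> (Const 1 \<ominus> (Const 1 \<ominus> Var vS)))
        + 500 * ((m + 1) * (m + 1)) \<le> 600 * ((m + 1) * (m + 1))" by simp
    show "?g < 2 ^ L" using L by simp
  qed (use v val in simp_all)
next
  show "2 ^ m < (2::nat) ^ L" using L by simp
  show "\<And>i s'. i \<le> 2 ^ m \<Longrightarrow> same_outside (insert vS XOpt) s s' \<and>
      (\<forall>S<i. s' aOpt S = opt_cost W G (bits_of S)) \<Longrightarrow> exp_val s' (Load aPow (Var vM)) = 2 ^ m"
    using tab by (simp add: same_outside_def tables_def)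
qed (rule loop_bound | simp)+

subsection \<open>Breadth-first enumeration\<close>

text \<open>A partial ranking is stored as one number whose base-\<open>m\<close> digits, least significant first,
  are its elements from top to bottom.\<close>

definition code :: "nat \<Rightarrow> nat list \<Rightarrow> nat" where
  "code m zs = foldl (\<lambda>c x. x + m * c) 0 zs"

lemma code_Nil [simp]: "code m [] = 0"
  by (simp add: code_def)

lemma code_snoc [simp]: "code m (zs @ [x]) = x + m * code m zs"
  by (simp add: code_def)

text \<open>This bound is the source of the quadratic term in the word width. The length is not
  recorded in a code, so an element 0 at the bottom leaves no trace; it is recovered from the level
  number.\<close>

lemma code_less: "set zs \<subseteq> {..<m} \<Longrightarrow> code m zs < m ^ length zs"
proof (induction zs rule: rev_induct)
  case (snoc x zs)
  then have "x < m" "code m zs + 1 \<le> m ^ length zs" by auto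
  from this(2) have "m * (code m zs + 1) \<le> m * m ^ length zs" by (rule mult_le_mono2)
  then show ?case using \<open>x < m\<close> by simp
qed simp

text \<open>Level \<open>l\<close> owns the \<open>r\<close> slots from \<open>l * r\<close> on, and
  its masks code the candidates still to be placed. The stride \<open>r\<close> may be exponential
  in the input size: untouched cells cost nothing, and addresses stay short.\<close>

definition stored :: "nat \<Rightarrow> nat \<Rightarrow> (nat \<Rightarrow> nat \<Rightarrow> nat) \<Rightarrow> nat \<Rightarrow> nat list list \<Rightarrow> state \<Rightarrow> bool" where
  "stored m r W l Z s \<longleftrightarrow> (\<forall>j<length Z.
     s aCode (l * r + j) = code m (Z ! j) \<and>
     s aCost (l * r + j) = rcost W {..<m} (Z ! j) \<and>
     s aMask (l * r + j) < 2 ^ m \<and>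
     bits_of (s aMask (l * r + j)) = {..<m} - set (Z ! j))"

definition search_env ::
    "nat \<Rightarrow> (nat \<Rightarrow> nat \<Rightarrow> nat) \<Rightarrow> nat \<Rightarrow> nat \<Rightarrow> nat \<Rightarrow> state \<Rightarrow> bool" where
  "search_env m W G K r s \<longleftrightarrow> tables m W s \<and>
     (\<forall>S<2 ^ m. s aOpt S = opt_cost W G (bits_of S)) \<and> s vR 0 = r \<and> s vK 0 = K"

lemma search_env_cong:
  assumes "search_env m W G K r s" "same_outside X s s'" "X \<inter> {vM, aPow, aW, aOpt, vR, vK} = {}"
  shows "search_env m W G K r s'"
  using assms by (simp add: search_env_def tables_def same_outside_def)

definition slot_exp :: exp where
  "slot_exp = Var vI \<otimes> Var vR \<oplus> Var vJ"

definition new_exp :: exp where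
  "new_exp = (Var vI \<oplus> Const 1) \<otimes> Var vR \<oplus> Var vNew"

definition push_com :: com where
  "push_com =
     Seq (Store aCode new_exp (Var vX \<oplus> Var vM \<otimes> Load aCode slot_exp))
    (Seq (Store aMask new_exp (Var vRest))
    (Seq (Store aCost new_exp (Load aCost slot_exp \<oplus> Var vAcc))
         (Store vNew (Const 0) (Var vNew \<oplus> Const 1))))"

text \<open>The product acts as a conjunction: some completion stays within the threshold, and the
  next level has room left. The second factor realises the truncation to \<open>r\<close>
  entries.\<close>

definition accept_exp :: exp where
  "accept_exp = (Const 1 \<ominus> ((Load aCost slot_exp \<oplus> Var vAcc \<oplus> Load aOpt (Var vRest)) \<ominus> Var vK))
     \<otimes> (Var vR \<ominus> Var vNew)"

definition extend_com :: com where
  "extend_com = Cond (bit_exp (Load aMask slot_exp) (Var vX))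
     (Seq (Store vRest (Const 0) (Load aMask slot_exp \<ominus> Load aPow (Var vX)))
     (Seq dcost_com (Cond accept_exp push_com Skip)))
     Skip"

lemma exec_push_com:
  assumes "s vI 0 = l" "s vR 0 = r" "s vJ 0 = j" "s vNew 0 = n" "s vX 0 = x" "s vM 0 = m"
    and "x + m * s aCode (l * r + j) = c" "s vRest 0 = R" "s aCost (l * r + j) + s vAcc 0 = d"
    and "c < 2 ^ L" "R < 2 ^ L" "d < 2 ^ L" "n + 1 < 2 ^ L"
  shows "exec L push_com 200 s (\<lambda>s'. same_outside {aCode, aMask, aCost, vNew} s s' \<and>
    s' aCode = (s aCode)(Suc l * r + n := c) \<and> s' aMask = (s aMask)(Suc l * r + n := R) \<and>
    s' aCost = (s aCost)(Suc l * r + n := d) \<and> s' vNew 0 = Suc n)"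
  unfolding push_com_def
proof (rule exec_Store_Seq)
  let ?a = "Suc l * r + n"
  let ?s1 = "s(aCode := (s aCode)(?a := c))"
  let ?s2 = "?s1(aMask := (?s1 aMask)(?a := R))"
  let ?s3 = "?s2(aCost := (?s2 aCost)(?a := d))"
  let ?Q = "\<lambda>s'. same_outside {aCode, aMask, aCost, vNew} s s' \<and>
    s' aCode = (s aCode)(?a := c) \<and> s' aMask = (s aMask)(?a := R) \<and>
    s' aCost = (s aCost)(?a := d) \<and> s' vNew 0 = Suc n"
  have 3: "exec L (Store vNew (Const 0) (Var vNew \<oplus> Const 1)) 10 ?s3 ?Q"
    by (rule exec_Store'[where i = 0 and v = "Suc n"]) (use assms in simp_all)
  have 2: "exec L (Seq (Store aCost new_exp (Load aCost slot_exp \<oplus> Var vAcc))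
         (Store vNew (Const 0) (Var vNew \<oplus> Const 1))) 60 ?s2 ?Q"
    by (rule exec_Store_Seq[OF _ _ _ 3]) (use assms in \<open>simp_all add: new_exp_def slot_exp_def\<close>)
  show "exec L (Seq (Store aMask new_exp (Var vRest))
    (Seq (Store aCost new_exp (Load aCost slot_exp \<oplus> Var vAcc))
         (Store vNew (Const 0) (Var vNew \<oplus> Const 1)))) 100 ?s1 ?Q"
    by (rule exec_Store_Seq[OF _ _ _ 2]) (use assms in \<open>simp_all add: new_exp_def slot_exp_def\<close>)
qed (use assms in \<open>simp_all add: new_exp_def slot_exp_def\<close>)

lemma exec_extend_com:
  assumes env: "search_env m W G K r s"
    and ix: "s vI 0 = l" "s vJ 0 = j" "s vX 0 = x" "x < m" "l < m"
    and Z: "stored m r W l Z s" "j < length Z" "length Z \<le> r"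
    and zs: "Z ! j = zs" "set zs \<subseteq> {..<m}" "length zs = l"
    and N: "stored m r W (Suc l) N s" "s vNew 0 = length N"
    and w: "\<And>i j. W i j \<le> w"
    and L: "m * w < 2 ^ L" "m < L" "m ^ m \<le> 2 ^ L" "K < 2 ^ L" "r < 2 ^ L"
  defines "N' \<equiv> (if extension_ok W G K m zs x \<and> length N < r then N @ [zs @ [x]] else N)"
  shows "exec L extend_com (600 * (m + 1)) s (\<lambda>s'.
    same_outside {aCode, aMask, aCost, vNew, vRest, vAcc, vY} s s' \<and>
    stored m r W l Z s' \<and> stored m r W (Suc l) N' s' \<and> s' vNew 0 = length N')"
    (is "exec _ _ _ _ ?Q")
proof -
  let ?a = "l * r + j"
  let ?M = "s aMask ?a"
  let ?V = "{..<m}"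
  have tab: "tables m W s" using env by (simp add: search_env_def)
  have val: "s vR 0 = r" "s vK 0 = K" "s vM 0 = m" "s aPow x = 2 ^ x"
    using env ix(4) by (simp_all add: search_env_def tables_def)
  have st: "s aCode ?a = code m zs" "s aCost ?a = rcost W ?V zs" "?M < 2 ^ m" "bits_of ?M = ?V - set zs"
    using Z zs(1) by (auto simp: stored_def)
  have mL: "m < 2 ^ L" "(2::nat) ^ m < 2 ^ L"
    using L(2) less_trans[OF L(2) less_exp] by simp_all
  have slot: "exp_val s slot_exp = ?a" using ix val by (simp add: slot_exp_def)
  have bit: "exp_val s (bit_exp (Load aMask slot_exp) (Var vX)) = of_bool (bit ?M x)"
    using slot ix val by simp
  have bit_iff: "bit ?M x \<longleftrightarrow> x \<notin> set zs"
  proof -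
    have "bit ?M x \<longleftrightarrow> x \<in> bits_of ?M" by (simp add: bits_of_def)
    then show ?thesis using st(4) ix(4) by simp
  qed
  show ?thesis
    unfolding extend_com_def
  proof (rule exec_Cond[where T' = "540 * (m + 1)"])
    assume "exp_val s (bit_exp (Load aMask slot_exp) (Var vX)) = 0"
    then have "N' = N" using bit bit_iff by (simp add: N'_def extension_ok_def)
    then show "exec L Skip (540 * (m + 1)) s ?Q"
      using Z N by (intro exec_Skip) simp_all
  next
    assume "exp_val s (bit_exp (Load aMask slot_exp) (Var vX)) \<noteq> 0"
    then have b: "bit ?M x" using bit by simp
    let ?R = "?M - 2 ^ x"
    let ?s = "set_var s vRest ?R"
    have R: "?R < 2 ^ m" using st(3) by simp
    have bitsR: "bits_of ?R = ?V - set (zs @ [x])"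
      using bits_of_remove[OF b] st(4) by auto
    have tab': "tables m W ?s" using tab by (simp add: tables_def)
    let ?d = "\<Sum>y\<in>bits_of ?R. W y x"
    have ds: "exec L dcost_com (200 * (m + 1)) ?s (\<lambda>s'. same_outside {vAcc, vY} ?s s' \<and> s' vAcc 0 = ?d)"
      by (rule exec_dcost_com[OF tab' _ ix(4) _ R w L(1) mL(1)]) (use ix in simp_all)
    have rc: "rcost W ?V (zs @ [x]) = rcost W ?V zs + ?d"
    proof -
      have "?V - set zs - {x} = bits_of ?R" using bitsR by auto
      then show ?thesis by (simp add: rcost_append)
    qed
    show "exec L (Seq (Store vRest (Const 0) (Load aMask slot_exp \<ominus> Load aPow (Var vX)))
     (Seq dcost_com (Cond accept_exp push_com Skip))) (540 * (m + 1)) s ?Q"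
    proof (rule exec_Store_Seq[OF _ _ _ exec_Seq'[OF ds]])
      fix s1 assume D: "same_outside {vAcc, vY} ?s s1 \<and> s1 vAcc 0 = ?d"
      have same1: "same_outside {vRest, vAcc, vY} s s1"
        using D by (simp add: same_outside_def)
      have val1: "s1 vI 0 = l" "s1 vJ 0 = j" "s1 vX 0 = x" "s1 vR 0 = r" "s1 vK 0 = K" "s1 vM 0 = m"
        "s1 vNew 0 = length N" "s1 vRest 0 = ?R" "s1 aCode = s aCode" "s1 aMask = s aMask"
        "s1 aCost = s aCost" "s1 aOpt ?R = opt_cost W G (bits_of ?R)" "s1 vAcc 0 = ?d"
        using D ix val N R env by (simp_all add: same_outside_def search_env_def)
      have slot1: "exp_val s1 slot_exp = ?a" using val1 by (simp add: slot_exp_def)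
      have acc: "exp_val s1 accept_exp \<noteq> 0 \<longleftrightarrow> extension_ok W G K m zs x \<and> length N < r"
      proof -
        have "extension_ok W G K m zs x \<longleftrightarrow> rcost W ?V zs + ?d + opt_cost W G (bits_of ?R) \<le> K"
          using b bit_iff unfolding extension_ok_def rc bitsR by simp
        moreover have "exp_val s1 accept_exp
            = (1 - (rcost W ?V zs + ?d + opt_cost W G (bits_of ?R) - K)) * (r - length N)"
          using val1 slot1 st by (simp add: accept_exp_def)
        moreover have "(1 - (u - K)) * (r - n) \<noteq> 0 \<longleftrightarrow> u \<le> K \<and> n < r" for u n :: nat
          by auto
        ultimately show ?thesis by simp
      qed
      have Z1: "stored m r W l Z s1" "stored m r W (Suc l) N s1"
        using Z(1) N(1) val1 by (simp_all add: stored_def)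
      show "exec L (Cond accept_exp push_com Skip) 300 s1 ?Q"
      proof (rule exec_Cond[where T' = 200])
        assume "exp_val s1 accept_exp = 0"
        then have "N' = N" using acc by (simp add: N'_def)
        then show "exec L Skip 200 s1 ?Q"
          using Z1 val1 same1 by (intro exec_Skip) (simp_all add: same_outside_def)
      next
        assume "exp_val s1 accept_exp \<noteq> 0"
        then have ok: "extension_ok W G K m zs x" "length N < r" and N': "N' = N @ [zs @ [x]]"
          using acc by (simp_all add: N'_def)
        let ?b = "Suc l * r + length N"
        have code: "x + m * s1 aCode ?a = code m (zs @ [x])" using val1 st by simp
        have code_L: "code m (zs @ [x]) < 2 ^ L"
        proof -
          have "code m (zs @ [x]) < m ^ length (zs @ [x])"
            using zs ix(4) by (intro code_less) auto
          also have "\<dots> \<le> m ^ m" using zs ix(4,5) by (intro power_increasing) auto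
          finally show ?thesis using L(3) by simp
        qed
        have cost: "s1 aCost ?a + s1 vAcc 0 = rcost W ?V (zs @ [x])"
          using val1 st rc by simp
        \<comment> \<open>Acceptance itself bounds the cost by \<open>K\<close>, which fits into a
          word.\<close>
        have cost_L: "rcost W ?V (zs @ [x]) < 2 ^ L"
          using ok(1) L(4) by (simp add: extension_ok_def)
        have "exec L push_com 200 s1 (\<lambda>s'. same_outside {aCode, aMask, aCost, vNew} s1 s' \<and>
            s' aCode = (s1 aCode)(?b := code m (zs @ [x])) \<and> s' aMask = (s1 aMask)(?b := ?R) \<and>
            s' aCost = (s1 aCost)(?b := rcost W ?V (zs @ [x])) \<and> s' vNew 0 = Suc (length N))"
          by (rule exec_push_com[OF val1(1,4,2,7,3,6) code val1(8) cost code_L _ cost_L])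
            (use less_trans[OF R mL(2)] ok(2) L(5) in simp_all)
        then show "exec L push_com 200 s1 ?Q"
        proof (rule exec_mono[OF _ order_refl])
          fix s2 assume P: "same_outside {aCode, aMask, aCost, vNew} s1 s2 \<and>
            s2 aCode = (s1 aCode)(?b := code m (zs @ [x])) \<and> s2 aMask = (s1 aMask)(?b := ?R) \<and>
            s2 aCost = (s1 aCost)(?b := rcost W ?V (zs @ [x])) \<and> s2 vNew 0 = Suc (length N)"
          have "same_outside {aCode, aMask, aCost, vNew, vRest, vAcc, vY} s s2"
            using P same1 by (simp add: same_outside_def)
          moreover have "stored m r W l Z s2"
          proof -
            \<comment> \<open>Row \<open>l\<close> ends before row \<open>l + 1\<close> begins,
              because a level has at most \<open>r\<close> entries.\<close>
            have "l * r + j' \<noteq> ?b" if "j' < length Z" for j'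
              using that Z(3) by simp
            then show ?thesis using P Z1(1) unfolding stored_def by (simp only: fun_upd_apply) simp
          qed
          moreover have "stored m r W (Suc l) N' s2"
            unfolding stored_def
          proof (intro allI impI)
            fix j' assume "j' < length N'"
            then consider "j' < length N" | "j' = length N" using N' by fastforce
            then show "s2 aCode (Suc l * r + j') = code m (N' ! j') \<and>
              s2 aCost (Suc l * r + j') = rcost W {..<m} (N' ! j') \<and>
              s2 aMask (Suc l * r + j') < 2 ^ m \<and>
              bits_of (s2 aMask (Suc l * r + j')) = {..<m} - set (N' ! j')"
            proof cases
              case 1
              then show ?thesis using P Z1(2) N' by (simp add: stored_def nth_append)
            next
              case 2
              then show ?thesis using P N' R bitsR by simp
            qed
          qed
          ultimately show "?Q s2" using P N' by simp
        qed
      qed (simp add: accept_exp_def slot_exp_def)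
    next
      show "200 * (m + 1) + 300 \<le> 200 * (m + 1) + 300" by simp
      show "1 + exp_weight (Const 0) + exp_weight (Load aMask slot_exp \<ominus> Load aPow (Var vX))
          + (200 * (m + 1) + 300) \<le> 540 * (m + 1)"
        by (simp add: slot_exp_def)
    qed (use slot ix val less_trans[OF R mL(2)] in simp_all)
  qed (simp add: slot_exp_def)
qed

section \<open>The nested loops of the search\<close>

abbreviation (input) "XBfs \<equiv> {aCode, aMask, aCost, vNew, vRest, vAcc, vY}"

definition bfs_x :: com where
  "bfs_x = For vX (Var vM) extend_com"

definition bfs_j :: com where
  "bfs_j = For vJ (Var vCnt) bfs_x"

definition bfs_com :: com where
  "bfs_com =
     Seq (Store aCode (Const 0) (Const 0))
    (Seq (Store aMask (Const 0) (Load aPow (Var vM) \<ominus> Const 1))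
    (Seq (Store aCost (Const 0) (Const 0))
    (Seq (Store vCnt (Const 0) ((Const 1 \<ominus> (Const 1 \<ominus> Var vR))
           \<otimes> (Const 1 \<ominus> (Load aOpt (Load aPow (Var vM) \<ominus> Const 1) \<ominus> Var vK))))
    (For vI (Var vM)
      (Seq (Store vNew (Const 0) (Const 0)) (Seq bfs_j (Store vCnt (Const 0) (Var vNew))))))))"

text \<open>Refusing entries once \<open>r\<close> of them are stored has the same effect as
  truncating the complete list afterwards.\<close>

lemma take_snoc: "take r (xs @ [e]) = (if length (take r xs) < r then take r xs @ [e] else take r xs)"
  by (cases "length xs < r") auto

lemma extensions_Suc:
  "extensions W G K m (Suc x) zs
     = extensions W G K m x zs @ (if extension_ok W G K m zs x then [zs @ [x]] else [])"
  by (simp add: extensions_def)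

text \<open>\<open>B\<close> stands for the untruncated list of extensions of the earlier prefixes,
  of which memory holds only the first \<open>r\<close>.\<close>

lemma exec_bfs_x:
  assumes env: "search_env m W G K r s"
    and ix: "s vI 0 = l" "s vJ 0 = j" "l < m"
    and Z: "stored m r W l Z s" "j < length Z" "length Z \<le> r"
    and zs: "Z ! j = zs" "set zs \<subseteq> {..<m}" "length zs = l"
    and N: "stored m r W (Suc l) (take r B) s" "s vNew 0 = length (take r B)"
    and w: "\<And>i j. W i j \<le> w"
    and L: "m * w < 2 ^ L" "m < L" "m ^ m \<le> 2 ^ L" "K < 2 ^ L" "r < 2 ^ L"
  defines "N' \<equiv> \<lambda>x. take r (B @ extensions W G K m x zs)"
  shows "exec L bfs_x (700 * ((m + 1) * (m + 1))) s (\<lambda>s'.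
    same_outside (insert vX XBfs) s s' \<and>
    stored m r W l Z s' \<and> stored m r W (Suc l) (N' m) s' \<and> s' vNew 0 = length (N' m))"
  unfolding bfs_x_def
proof (rule exec_For[where n = m and T = "600 * (m + 1)" and
      I = "\<lambda>x s'. same_outside (insert vX XBfs) s s' \<and>
        stored m r W l Z s' \<and> stored m r W (Suc l) (N' x) s' \<and> s' vNew 0 = length (N' x)"])
  fix x s' assume x: "x < m" and v: "s' vX 0 = x"
    and I: "same_outside (insert vX XBfs) s s' \<and>
        stored m r W l Z s' \<and> stored m r W (Suc l) (N' x) s' \<and> s' vNew 0 = length (N' x)"
  have env': "search_env m W G K r s'"
    by (rule search_env_cong[OF env conjunct1[OF I]]) simp
  have ix': "s' vI 0 = l" "s' vJ 0 = j" using I ix by (simp_all add: same_outside_def)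
  have N'_Suc: "(if extension_ok W G K m zs x \<and> length (N' x) < r then N' x @ [zs @ [x]] else N' x) = N' (Suc x)"
  proof (cases "extension_ok W G K m zs x")
    case True
    then have "N' (Suc x) = take r ((B @ extensions W G K m x zs) @ [zs @ [x]])"
      by (simp only: N'_def extensions_Suc if_True append_assoc)
    also have "\<dots> = (if length (N' x) < r then N' x @ [zs @ [x]] else N' x)"
      unfolding N'_def by (rule take_snoc)
    finally show ?thesis using True by simp
  next
    case False
    then show ?thesis by (simp add: N'_def extensions_Suc)
  qed
  have ex: "exec L extend_com (600 * (m + 1)) s' (\<lambda>s''. same_outside XBfs s' s'' \<and>
    stored m r W l Z s'' \<and> stored m r W (Suc l) (N' (Suc x)) s'' \<and> s'' vNew 0 = length (N' (Suc x)))"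
    using exec_extend_com[OF env' ix' v x ix(3) _ Z(2,3) zs _ _ w L, of "N' x"] I
    unfolding N'_Suc by simp
  show "exec L extend_com (600 * (m + 1)) s' (\<lambda>s'. s' vX 0 = x \<and>
    same_outside (insert vX XBfs) s (set_var s' vX (Suc x)) \<and>
    stored m r W l Z (set_var s' vX (Suc x)) \<and> stored m r W (Suc l) (N' (Suc x)) (set_var s' vX (Suc x)) \<and>
    set_var s' vX (Suc x) vNew 0 = length (N' (Suc x)))"
  proof (rule exec_mono[OF ex order_refl])
    fix s'' assume D: "same_outside XBfs s' s'' \<and>
      stored m r W l Z s'' \<and> stored m r W (Suc l) (N' (Suc x)) s'' \<and> s'' vNew 0 = length (N' (Suc x))"
    have "s'' vX 0 = x" using D v by (simp add: same_outside_def)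
    moreover have "same_outside (insert vX XBfs) s s''" using D I by (simp add: same_outside_def)
    ultimately show "s'' vX 0 = x \<and>
      same_outside (insert vX XBfs) s (set_var s'' vX (Suc x)) \<and>
      stored m r W l Z (set_var s'' vX (Suc x)) \<and> stored m r W (Suc l) (N' (Suc x)) (set_var s'' vX (Suc x)) \<and>
      set_var s'' vX (Suc x) vNew 0 = length (N' (Suc x))"
      using D by (simp add: stored_def)
  qed
next
  show "\<And>i s'. i \<le> m \<Longrightarrow> same_outside (insert vX XBfs) s s' \<and>
        stored m r W l Z s' \<and> stored m r W (Suc l) (N' i) s' \<and> s' vNew 0 = length (N' i)
        \<Longrightarrow> exp_val s' (Var vM) = m"
    using env by (simp add: same_outside_def search_env_def tables_def)
  show "same_outside (insert vX XBfs) s (set_var s vX 0) \<and>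
        stored m r W l Z (set_var s vX 0) \<and> stored m r W (Suc l) (N' 0) (set_var s vX 0) \<and>
        set_var s vX 0 vNew 0 = length (N' 0)"
    using Z(1) N by (simp add: N'_def extensions_def stored_def)
  show "m < 2 ^ L" using L(2) less_exp[of L] by linarith
qed (rule loop_bound | simp)+

lemma exec_bfs_j:
  assumes env: "search_env m W G K r s"
    and ix: "s vI 0 = l" "l < m" "s vCnt 0 = length Z" "s vNew 0 = 0"
    and Z: "stored m r W l Z s" "length Z \<le> r" "\<And>zs. zs \<in> set Z \<Longrightarrow> set zs \<subseteq> {..<m} \<and> length zs = l"
    and w: "\<And>i j. W i j \<le> w"
    and L: "m * w < 2 ^ L" "m < L" "m ^ m \<le> 2 ^ L" "K < 2 ^ L" "r < 2 ^ L"
  defines "N' \<equiv> \<lambda>j. take r (concat (map (extensions W G K m m) (take j Z)))"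
  shows "exec L bfs_j (800 * ((length Z + 1) * ((m + 1) * (m + 1)))) s (\<lambda>s'.
    same_outside (insert vJ (insert vX XBfs)) s s' \<and>
    stored m r W (Suc l) (N' (length Z)) s' \<and> s' vNew 0 = length (N' (length Z)))"
  unfolding bfs_j_def
proof (rule exec_For[where n = "length Z" and T = "700 * ((m + 1) * (m + 1))" and
      I = "\<lambda>j s'. same_outside (insert vJ (insert vX XBfs)) s s' \<and>
        stored m r W l Z s' \<and> stored m r W (Suc l) (N' j) s' \<and> s' vNew 0 = length (N' j)"])
  fix j s' assume j: "j < length Z" and v: "s' vJ 0 = j"
    and I: "same_outside (insert vJ (insert vX XBfs)) s s' \<and>
        stored m r W l Z s' \<and> stored m r W (Suc l) (N' j) s' \<and> s' vNew 0 = length (N' j)"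
  have env': "search_env m W G K r s'"
    by (rule search_env_cong[OF env conjunct1[OF I]]) simp
  have ix': "s' vI 0 = l" using I ix by (simp add: same_outside_def)
  have N'_Suc: "take r (concat (map (extensions W G K m m) (take j Z)) @ extensions W G K m m (Z ! j)) = N' (Suc j)"
    using j by (simp add: N'_def take_Suc_conv_app_nth)
  have zs: "set (Z ! j) \<subseteq> {..<m}" "length (Z ! j) = l" using Z(3) j by simp_all
  have ex: "exec L bfs_x (700 * ((m + 1) * (m + 1))) s' (\<lambda>s''. same_outside (insert vX XBfs) s' s'' \<and>
    stored m r W l Z s'' \<and> stored m r W (Suc l) (N' (Suc j)) s'' \<and> s'' vNew 0 = length (N' (Suc j)))"
    using exec_bfs_x[OF env' ix' v ix(2) _ j Z(2) refl zs _ _ w L,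
        of "concat (map (extensions W G K m m) (take j Z))"] I
    unfolding N'_Suc by (simp add: N'_def)
  show "exec L bfs_x (700 * ((m + 1) * (m + 1))) s' (\<lambda>s'. s' vJ 0 = j \<and>
    same_outside (insert vJ (insert vX XBfs)) s (set_var s' vJ (Suc j)) \<and>
    stored m r W l Z (set_var s' vJ (Suc j)) \<and> stored m r W (Suc l) (N' (Suc j)) (set_var s' vJ (Suc j)) \<and>
    set_var s' vJ (Suc j) vNew 0 = length (N' (Suc j)))"
  proof (rule exec_mono[OF ex order_refl])
    fix s'' assume D: "same_outside (insert vX XBfs) s' s'' \<and>
      stored m r W l Z s'' \<and> stored m r W (Suc l) (N' (Suc j)) s'' \<and> s'' vNew 0 = length (N' (Suc j))"
    have "s'' vJ 0 = j" using D v by (simp add: same_outside_def)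
    moreover have "same_outside (insert vJ (insert vX XBfs)) s s''" using D I by (simp add: same_outside_def)
    ultimately show "s'' vJ 0 = j \<and>
      same_outside (insert vJ (insert vX XBfs)) s (set_var s'' vJ (Suc j)) \<and>
      stored m r W l Z (set_var s'' vJ (Suc j)) \<and> stored m r W (Suc l) (N' (Suc j)) (set_var s'' vJ (Suc j)) \<and>
      set_var s'' vJ (Suc j) vNew 0 = length (N' (Suc j))"
      using D by (simp add: stored_def)
  qed
next
  show "\<And>i s'. i \<le> length Z \<Longrightarrow> same_outside (insert vJ (insert vX XBfs)) s s' \<and>
        stored m r W l Z s' \<and> stored m r W (Suc l) (N' i) s' \<and> s' vNew 0 = length (N' i)
        \<Longrightarrow> exp_val s' (Var vCnt) = length Z"
    using ix by (simp add: same_outside_def)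
  show "same_outside (insert vJ (insert vX XBfs)) s (set_var s vJ 0) \<and>
        stored m r W l Z (set_var s vJ 0) \<and> stored m r W (Suc l) (N' 0) (set_var s vJ 0) \<and>
        set_var s vJ 0 vNew 0 = length (N' 0)"
    using Z(1) ix by (simp add: N'_def stored_def)
  show "length Z < 2 ^ L" using Z(2) L(5) by simp
qed (rule loop_bound | simp)+

text \<open>The bound \<open>c\<close> on the level lengths is kept abstract and enters only the
  time budget; it becomes the minimum of \<open>r\<close> and the factorial of \<open>m\<close>
  later.\<close>

lemma exec_bfs_com:
  assumes env: "search_env m W G K r s" and KG: "K < G"
    and w: "\<And>i j. W i j \<le> w"
    and L: "m * w < 2 ^ L" "m < L" "m ^ m \<le> 2 ^ L" "K < 2 ^ L" "r < 2 ^ L"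
    and c: "\<And>l. l \<le> m \<Longrightarrow> length (level W G K m r l) \<le> c"
  shows "exec L bfs_com (1200 * ((m + 1) * ((c + 1) * ((m + 1) * (m + 1))))) s (\<lambda>s'.
    same_outside (XBfs \<union> {vI, vJ, vX, vCnt}) s s' \<and>
    stored m r W m (level W G K m r m) s' \<and> s' vCnt 0 = length (level W G K m r m))"
proof -
  let ?X = "XBfs \<union> {vI, vJ, vX, vCnt}"
  let ?lev = "level W G K m r"
  let ?I = "\<lambda>l s'. same_outside ?X s s' \<and> stored m r W l (?lev l) s' \<and> s' vCnt 0 = length (?lev l)"
  let ?x = "(c + 1) * ((m + 1) * (m + 1))"
  let ?body = "Seq (Store vNew (Const 0) (Const 0)) (Seq bfs_j (Store vCnt (Const 0) (Var vNew)))"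
  have mL: "m < 2 ^ L" "(2::nat) ^ m < 2 ^ L" "0 < L"
    using L(2) less_trans[OF L(2) less_exp] by simp_all
  have "2 ^ 0 < (2::nat) ^ L" using mL(3) by (intro power_strict_increasing) auto
  then have one: "1 < (2::nat) ^ L" by simp
  have loop: "exec L (For vI (Var vM) ?body) (1000 * ((m + 1) * ?x)) s0 (?I m)" if "?I 0 s0" for s0
  proof (rule exec_For[where I = ?I and n = m and T = "900 * ?x"])
    fix l s' assume l: "l < m" and v: "s' vI 0 = l" and I: "?I l s'"
    let ?s = "set_var s' vNew 0"
    have env': "search_env m W G K r ?s"
      by (rule search_env_cong[OF env, of ?X]) (use I in simp_all)
    have Zr: "length (?lev l) \<le> r" using length_level_le[OF KG, of l m W r] l by simp
    have Zset: "set zs \<subseteq> {..<m} \<and> length zs = l" if "zs \<in> set (?lev l)" for zs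
      using set_level[OF KG _ that] l by simp
    have len: "length (?lev (Suc l)) < 2 ^ L"
      using length_level_le[OF KG, of "Suc l" m W r] l L(5) by (simp del: level.simps)
    have "exec L bfs_j (800 * ((length (?lev l) + 1) * ((m + 1) * (m + 1)))) ?s (\<lambda>s''.
      same_outside (insert vJ (insert vX XBfs)) ?s s'' \<and>
      stored m r W (Suc l) (?lev (Suc l)) s'' \<and> s'' vNew 0 = length (?lev (Suc l)))"
      using exec_bfs_j[OF env' _ l _ _ _ Zr Zset w L] I v by (simp add: stored_def)
    then have bj: "exec L bfs_j (800 * ?x) ?s (\<lambda>s''.
      same_outside (insert vJ (insert vX XBfs)) ?s s'' \<and>
      stored m r W (Suc l) (?lev (Suc l)) s'' \<and> s'' vNew 0 = length (?lev (Suc l)))"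
    proof (rule exec_mono)
      show "800 * ((length (?lev l) + 1) * ((m + 1) * (m + 1))) \<le> 800 * ?x"
        using c[of l] l by (intro mult_le_mono) auto
    qed
    show "exec L ?body (900 * ?x) s' (\<lambda>s'. s' vI 0 = l \<and> ?I (Suc l) (set_var s' vI (Suc l)))"
    proof (rule exec_Store_Seq[OF _ _ _ exec_Seq'[OF bj]])
      fix s'' assume D: "same_outside (insert vJ (insert vX XBfs)) ?s s'' \<and>
        stored m r W (Suc l) (?lev (Suc l)) s'' \<and> s'' vNew 0 = length (?lev (Suc l))"
      have "s'' vI 0 = l" using D v by (simp add: same_outside_def)
      moreover have "same_outside ?X s s''" using D I by (simp add: same_outside_def)
      ultimately show "exec L (Store vCnt (Const 0) (Var vNew)) 10 s''
          (\<lambda>s'. s' vI 0 = l \<and> ?I (Suc l) (set_var s' vI (Suc l)))"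
        using D len by (intro exec_Store'[where i = 0 and v = "length (?lev (Suc l))"]) (simp_all add: stored_def del: level.simps)
    next
      show "800 * ?x + 10 \<le> 810 * ?x" by simp
      show "1 + exp_weight (Const 0) + exp_weight (Const 0) + 810 * ?x \<le> 900 * ?x" by simp
    qed simp_all
  next
    show "?I 0 (set_var s0 vI 0)" using that by (simp add: stored_def)
    show "\<And>i s'. i \<le> m \<Longrightarrow> ?I i s' \<Longrightarrow> exp_val s' (Var vM) = m"
      using env by (simp add: same_outside_def search_env_def tables_def)
  qed (rule loop_bound | use mL in simp)+
  let ?full = "2 ^ m - 1 :: nat"
  let ?cnt = "length (?lev 0)"
  let ?s1 = "s(aCode := (s aCode)(0 := 0))"
  let ?s2 = "?s1(aMask := (?s1 aMask)(0 := ?full))"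
  let ?s3 = "?s2(aCost := (?s2 aCost)(0 := 0))"
  let ?s4 = "?s3(vCnt := (?s3 vCnt)(0 := ?cnt))"
  have full: "?full < 2 ^ m" by simp
  have val: "s vM 0 = m" "s aPow m = 2 ^ m" "s vR 0 = r" "s vK 0 = K" "s aOpt ?full = opt_cost W G {..<m}"
    using env full by (simp_all add: search_env_def tables_def bits_of_full[unfolded One_nat_def])
  \<comment> \<open>Slot 0 receives the empty prefix in any case; the counter, 0 or 1, decides
    whether level 0 contains it.\<close>
  have I0: "?I 0 ?s4"
    using full bits_of_full[of m] by (simp add: stored_def)
  have 4: "exec L (Seq (Store vCnt (Const 0) ((Const 1 \<ominus> (Const 1 \<ominus> Var vR))
           \<otimes> (Const 1 \<ominus> (Load aOpt (Load aPow (Var vM) \<ominus> Const 1) \<ominus> Var vK)))) (For vI (Var vM) ?body))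
         (1000 * ((m + 1) * ?x) + 70) ?s3 (?I m)"
    by (rule exec_Store_Seq[OF _ _ _ loop[OF I0]]) (use val one in \<open>auto simp: One_nat_def[symmetric] simp del: One_nat_def\<close>)
  have 3: "exec L (Seq (Store aCost (Const 0) (Const 0)) (Seq (Store vCnt (Const 0) ((Const 1 \<ominus> (Const 1 \<ominus> Var vR))
           \<otimes> (Const 1 \<ominus> (Load aOpt (Load aPow (Var vM) \<ominus> Const 1) \<ominus> Var vK)))) (For vI (Var vM) ?body)))
         (1000 * ((m + 1) * ?x) + 80) ?s2 (?I m)"
    by (rule exec_Store_Seq[OF _ _ _ 4]) simp_all
  have 2: "exec L (Seq (Store aMask (Const 0) (Load aPow (Var vM) \<ominus> Const 1))
        (Seq (Store aCost (Const 0) (Const 0)) (Seq (Store vCnt (Const 0) ((Const 1 \<ominus> (Const 1 \<ominus> Var vR))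
           \<otimes> (Const 1 \<ominus> (Load aOpt (Load aPow (Var vM) \<ominus> Const 1) \<ominus> Var vK)))) (For vI (Var vM) ?body))))
         (1000 * ((m + 1) * ?x) + 100) ?s1 (?I m)"
    by (rule exec_Store_Seq[OF _ _ _ 3]) (use val less_trans[OF full mL(2)] in simp_all)
  have "1000 * ((m + 1) * ?x) + 110 \<le> 1200 * ((m + 1) * ?x)" by simp
  then show ?thesis
    unfolding bfs_com_def
    by (intro exec_Store_Seq[OF _ _ _ 2]) simp_all
qed

subsection \<open>Output\<close>

definition digit_exp :: exp where
  "digit_exp = Var vT \<ominus> (Var vT \<oslash> Var vM) \<otimes> Var vM"

text \<open>Index 0 of the output holds its length and index 1 the number of rankings, so the
  rankings start at 2. The low digits of a code belong to the elements placed last, so reading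
  digits by repeated division emits a ranking from the top and performs the reversal in
  \<open>ranking_of\<close>.\<close>

definition out_p :: com where
  "out_p = For vP (Var vM)
     (Seq (Store aOut (Const 2 \<oplus> Var vJ \<otimes> Var vM \<oplus> Var vP) (Load aIn (Var vB \<oplus> digit_exp)))
          (Store vT (Const 0) (Var vT \<oslash> Var vM)))"

definition out_com :: com where
  "out_com =
     Seq (For vJ (Var vCnt) (Seq (Store vT (Const 0) (Load aCode (Var vM \<otimes> Var vR \<oplus> Var vJ))) out_p))
    (Seq (Store aOut (Const 1) (Var vCnt)) (Store aOut (Const 0) (Const 1 \<oplus> Var vCnt \<otimes> Var vM)))"

lemma exec_out_p:
  assumes s: "s vM 0 = m" "s vB 0 = b" "s vJ 0 = j" "s vT 0 = code m zs"
    and cs: "\<forall>i<m. s aIn (b + i) = cs ! i"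
    and zs: "length zs = m" "set zs \<subseteq> {..<m}"
    and L: "m < 2 ^ L" "m ^ m \<le> 2 ^ L" "\<forall>i<m. cs ! i < 2 ^ L"
  shows "exec L out_p (200 * ((m + 1) * 1)) s (\<lambda>s'. same_outside {aOut, vP, vT} s s' \<and>
    (\<forall>a. s' aOut a = (if 2 + j * m \<le> a \<and> a < 2 + j * m + m
       then ranking_of cs zs ! (a - (2 + j * m)) else s aOut a)))"
  unfolding out_p_def
proof (rule exec_For[where n = m and T = "100 * 1" and
      I = "\<lambda>p s'. same_outside {aOut, vP, vT} s s' \<and> s' vT 0 = code m (take (m - p) zs) \<and>
        (\<forall>a. s' aOut a = (if 2 + j * m \<le> a \<and> a < 2 + j * m + p
           then ranking_of cs zs ! (a - (2 + j * m)) else s aOut a))"])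
  fix p s' assume p: "p < m" and v: "s' vP 0 = p"
    and I: "same_outside {aOut, vP, vT} s s' \<and> s' vT 0 = code m (take (m - p) zs) \<and>
        (\<forall>a. s' aOut a = (if 2 + j * m \<le> a \<and> a < 2 + j * m + p
           then ranking_of cs zs ! (a - (2 + j * m)) else s aOut a))"
  \<comment> \<open>Digit \<open>p\<close>, counted from the low end, is the entry of
    \<open>zs\<close> with \<open>p\<close> entries behind it.\<close>
  let ?x = "zs ! (m - Suc p)"
  let ?a = "2 + j * m + p"
  let ?zs = "take (m - Suc p) zs"
  have "m - p = Suc (m - Suc p)" using p by simp
  then have "take (m - p) zs = ?zs @ [?x]"
    using zs p by (simp add: take_Suc_conv_app_nth)
  then have code: "s' vT 0 = ?x + m * code m ?zs" using I by simp
  have x: "?x < m"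
  proof -
    have "?x \<in> set zs" using zs p by simp
    then show ?thesis using zs(2) by auto
  qed
  have val: "s' vM 0 = m" "s' vB 0 = b" "s' vJ 0 = j" "s' aIn (b + ?x) = cs ! ?x"
    using I s cs x by (simp_all add: same_outside_def)
  have div: "s' vT 0 div m = code m ?zs" using code x by simp
  have digit: "exp_val s' digit_exp = ?x"
    using val div code by (simp add: digit_exp_def)
  have rk: "ranking_of cs zs ! p = cs ! ?x"
    using zs p by (simp add: ranking_of_def rev_nth)
  have code_L: "code m ?zs < 2 ^ L"
  proof -
    have "code m ?zs < m ^ length ?zs"
      using zs(2) set_take_subset[of "m - Suc p" zs] by (intro code_less) (rule subset_trans)
    also have "\<dots> \<le> m ^ m" using zs p by (intro power_increasing) auto
    finally show ?thesis using L(2) by simp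
  qed
  let ?s = "s'(aOut := (s' aOut)(?a := cs ! ?x))"
  let ?P = "\<lambda>s'. s' vP 0 = p \<and> same_outside {aOut, vP, vT} s (set_var s' vP (Suc p)) \<and>
       set_var s' vP (Suc p) vT 0 = code m (take (m - Suc p) zs) \<and>
        (\<forall>a. set_var s' vP (Suc p) aOut a = (if 2 + j * m \<le> a \<and> a < 2 + j * m + Suc p
           then ranking_of cs zs ! (a - (2 + j * m)) else s aOut a))"
  have arr: "(\<forall>a. ((s' aOut)(?a := cs ! ?x)) a = (if 2 + j * m \<le> a \<and> a < 2 + j * m + Suc p
           then ranking_of cs zs ! (a - (2 + j * m)) else s aOut a))"
  proof
    fix a
    show "((s' aOut)(?a := cs ! ?x)) a = (if 2 + j * m \<le> a \<and> a < 2 + j * m + Suc p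
           then ranking_of cs zs ! (a - (2 + j * m)) else s aOut a)"
    proof (cases "a = ?a")
      case True
      then show ?thesis using rk by simp
    next
      case False
      then have "a < 2 + j * m + Suc p \<longleftrightarrow> a < 2 + j * m + p" by linarith
      then show ?thesis using I False by (simp only: fun_upd_apply if_False)
    qed
  qed
  have "exec L (Store vT (Const 0) (Var vT \<oslash> Var vM)) 10 ?s ?P"
  proof (rule exec_Store'[where i = 0 and v = "code m ?zs"])
    show "?P (?s(vT := (?s vT)(0 := code m ?zs)))"
      using arr I v by simp
  qed (use val div code_L in simp_all)
  then show "exec L (Seq (Store aOut (Const 2 \<oplus> Var vJ \<otimes> Var vM \<oplus> Var vP) (Load aIn (Var vB \<oplus> digit_exp)))
      (Store vT (Const 0) (Var vT \<oslash> Var vM))) (100 * 1) s' ?P"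
    by (rule exec_Store_Seq[rotated 3])
      (use val v digit L(3) x in \<open>simp_all add: digit_exp_def del: exp_val.simps(3)\<close>, simp_all)
next
  show "\<And>i s'. i \<le> m \<Longrightarrow> same_outside {aOut, vP, vT} s s' \<and> s' vT 0 = code m (take (m - i) zs) \<and>
      (\<forall>a. s' aOut a = (if 2 + j * m \<le> a \<and> a < 2 + j * m + i
       then ranking_of cs zs ! (a - (2 + j * m)) else s aOut a)) \<Longrightarrow> exp_val s' (Var vM) = m"
    using s by (simp add: same_outside_def)
  show "same_outside {aOut, vP, vT} s (set_var s vP 0) \<and> set_var s vP 0 vT 0 = code m (take (m - 0) zs) \<and>
        (\<forall>a. set_var s vP 0 aOut a = (if 2 + j * m \<le> a \<and> a < 2 + j * m + 0
           then ranking_of cs zs ! (a - (2 + j * m)) else s aOut a))"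
    using s zs by simp
qed (rule loop_bound | use L in simp)+

section \<open>Flattened lists of rankings\<close>

lemma nth_concat_uniform:
  assumes "\<And>xs. xs \<in> set xss \<Longrightarrow> length xs = m" "j < length xss" "p < m"
  shows "concat xss ! (j * m + p) = xss ! j ! p"
  using assms
proof (induction xss arbitrary: j)
  case (Cons xs xss)
  then show ?case by (cases j) (auto simp: nth_append)
qed simp

lemma length_concat_uniform:
  assumes "\<And>xs. xs \<in> set xss \<Longrightarrow> length xs = m"
  shows "length (concat xss) = length xss * m"
  using assms by (induction xss) auto

lemma output_of_eq_encode_rankings:
  assumes "s aOut 0 = 1 + length Qs * m" "s aOut 1 = length Qs"
    and "\<And>Q. Q \<in> set Qs \<Longrightarrow> length Q = m"
    and "\<And>j p. j < length Qs \<Longrightarrow> p < m \<Longrightarrow> s aOut (2 + j * m + p) = Qs ! j ! p"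
  shows "output_of s = encode_rankings Qs"
proof (rule nth_equalityI)
  show len: "length (output_of s) = length (encode_rankings Qs)"
    using assms(1,3) by (simp add: output_of_def encode_rankings_def length_concat_uniform del: upt_Suc)
  fix i assume "i < length (output_of s)"
  then have i: "i < 1 + length Qs * m" using assms(1) by (simp add: output_of_def del: upt_Suc)
  have out: "output_of s ! i = s aOut (1 + i)"
    using i assms(1) by (simp add: output_of_def del: upt_Suc)
  show "output_of s ! i = encode_rankings Qs ! i"
  proof (cases i)
    case 0
    then show ?thesis using out assms(2) by (simp add: encode_rankings_def)
  next
    case (Suc k)
    then have k: "k < length Qs * m" using i by simp
    then have "0 < m" by (cases m) auto
    define j p where "j = k div m" and "p = k mod m"
    have "k = j * m + p" by (simp add: j_def p_def)
    moreover have "p < m" using \<open>0 < m\<close> by (simp add: p_def)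
    moreover have "j < length Qs" using k by (simp add: j_def less_mult_imp_div_less)
    ultimately have "concat Qs ! k = Qs ! j ! p" "s aOut (2 + k) = Qs ! j ! p"
      using nth_concat_uniform[of Qs m j p] assms(3) assms(4)[of j p] by (simp_all add: add.assoc)
    then show ?thesis using out Suc by (simp add: encode_rankings_def)
  qed
qed

lemma exec_out_com:
  assumes s: "s vM 0 = length cs" "s vB 0 = b" "s vR 0 = r" "s vCnt 0 = length Z"
    and cs: "\<forall>i<length cs. s aIn (b + i) = cs ! i"
    and Z: "stored (length cs) r W (length cs) Z s"
      "\<And>zs. zs \<in> set Z \<Longrightarrow> set zs \<subseteq> {..<length cs} \<and> length zs = length cs"
    and L: "length cs < 2 ^ L" "length cs ^ length cs \<le> 2 ^ L" "\<forall>x\<in>set cs. x < 2 ^ L"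
      "1 + length Z * length cs < 2 ^ L" "length Z < 2 ^ L"
  shows "exec L out_com (500 * ((length Z + 1) * (length cs + 1))) s
    (\<lambda>s'. output_of s' = encode_rankings (map (ranking_of cs) Z))"
proof -
  let ?m = "length cs"
  let ?I = "\<lambda>j s'. same_outside {aOut, vP, vT, vJ} s s' \<and>
    (\<forall>j'<j. \<forall>p<?m. s' aOut (2 + j' * ?m + p) = ranking_of cs (Z ! j') ! p)"
  let ?body = "Seq (Store vT (Const 0) (Load aCode (Var vM \<otimes> Var vR \<oplus> Var vJ))) out_p"
  have loop: "exec L (For vJ (Var vCnt) ?body) (400 * ((length Z + 1) * (?m + 1))) s (?I (length Z))"
  proof (rule exec_For[where I = ?I and n = "length Z" and T = "300 * (?m + 1)"])
    fix j s' assume j: "j < length Z" and v: "s' vJ 0 = j" and I: "?I j s'"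
    let ?zs = "Z ! j"
    have zs: "length ?zs = ?m" "set ?zs \<subseteq> {..<?m}" using Z(2) j by simp_all
    have val: "s' vM 0 = ?m" "s' vB 0 = b" "s' vR 0 = r" "s' aCode (?m * r + j) = code ?m ?zs"
      "\<forall>i<?m. s' aIn (b + i) = cs ! i"
      using I s cs Z(1) j by (simp_all add: same_outside_def stored_def)
    have code_L: "code ?m ?zs < 2 ^ L"
      using code_less[OF zs(2)] zs(1) L(2) by simp
    let ?s = "s'(vT := (s' vT)(0 := code ?m ?zs))"
    have ex: "exec L out_p (200 * ((?m + 1) * 1)) ?s (\<lambda>s''. same_outside {aOut, vP, vT} ?s s'' \<and>
      (\<forall>a. s'' aOut a = (if 2 + j * ?m \<le> a \<and> a < 2 + j * ?m + ?m
       then ranking_of cs ?zs ! (a - (2 + j * ?m)) else ?s aOut a)))"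
      by (rule exec_out_p[where b = b]) (use val v zs L in simp_all)
    show "exec L ?body (300 * (?m + 1)) s' (\<lambda>s'. s' vJ 0 = j \<and> ?I (Suc j) (set_var s' vJ (Suc j)))"
    proof (rule exec_Store_Seq[OF _ _ _ exec_mono[OF ex order_refl]])
      fix s'' assume D: "same_outside {aOut, vP, vT} ?s s'' \<and>
        (\<forall>a. s'' aOut a = (if 2 + j * ?m \<le> a \<and> a < 2 + j * ?m + ?m
          then ranking_of cs ?zs ! (a - (2 + j * ?m)) else ?s aOut a))"
      have "s'' vJ 0 = j" using D v by (simp add: same_outside_def)
      moreover have "same_outside {aOut, vP, vT, vJ} s s''" using D I by (simp add: same_outside_def)
      moreover have "s'' aOut (2 + j' * ?m + p) = ranking_of cs (Z ! j') ! p"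
        if "j' < Suc j" "p < ?m" for j' p
      proof (cases "j' = j")
        case True
        then show ?thesis using D that by simp
      next
        case False
        then have "j' < j" using that by simp
        have "Suc j' * ?m \<le> j * ?m" using \<open>j' < j\<close> by (intro mult_le_mono1) simp
        then have "2 + j' * ?m + p < 2 + j * ?m" using that(2) by simp
        then have "s'' aOut (2 + j' * ?m + p) = s' aOut (2 + j' * ?m + p)" using D by simp
        then show ?thesis using I \<open>j' < j\<close> that(2) by simp
      qed
      ultimately show "s'' vJ 0 = j \<and> ?I (Suc j) (set_var s'' vJ (Suc j))" by simp
    qed (use val v code_L in simp_all)
  next
    show "\<And>i s'. i \<le> length Z \<Longrightarrow> ?I i s' \<Longrightarrow> exp_val s' (Var vCnt) = length Z"
      using s by (simp add: same_outside_def)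
  qed (rule loop_bound | use L in simp)+
  show ?thesis
    unfolding out_com_def
  proof (rule exec_Seq'[OF loop])
    fix s' assume I: "?I (length Z) s'"
    have val: "s' vM 0 = ?m" "s' vCnt 0 = length Z" using I s by (simp_all add: same_outside_def)
    let ?s1 = "s'(aOut := (s' aOut)(1 := length Z))"
    let ?s2 = "?s1(aOut := (?s1 aOut)(0 := 1 + length Z * ?m))"
    have "output_of ?s2 = encode_rankings (map (ranking_of cs) Z)"
    proof (rule output_of_eq_encode_rankings[where m = ?m])
      show "length Q = ?m" if "Q \<in> set (map (ranking_of cs) Z)" for Q
        using that Z(2) by (auto simp: ranking_of_def)
    qed (use I in simp_all)
    then have "exec L (Store aOut (Const 0) (Const 1 \<oplus> Var vCnt \<otimes> Var vM)) 20 ?s1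
        (\<lambda>s'. output_of s' = encode_rankings (map (ranking_of cs) Z))"
      by (intro exec_Store'[where i = 0 and v = "1 + length Z * ?m"]) (use val L in simp_all)
    then show "exec L (Seq (Store aOut (Const 1) (Var vCnt)) (Store aOut (Const 0) (Const 1 \<oplus> Var vCnt \<otimes> Var vM)))
        30 s' (\<lambda>s'. output_of s' = encode_rankings (map (ranking_of cs) Z))"
      by (rule exec_Store_Seq[rotated 3]) (use val L in simp_all)
  qed simp
qed

subsection \<open>The complete algorithm\<close>

text \<open>The expression \<open>e\<close> yields the threshold. It is evaluated only after the
  table is complete, since the optimisation problem reads its threshold from there.\<close>

definition core_com :: "exp \<Rightarrow> com" where
  "core_com e = Seq pow_com (Seq weight_com (Seq opt_com (Seq (Store vK (Const 0) e) (Seq bfs_com out_com))))"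

lemma weight_le: "weight H cs ps i j \<le> length ps + H"
proof -
  have "H * (1 - (length ps - preferring ps (cs ! j) (cs ! i))) \<le> H * 1"
    by (intro mult_le_mono) auto
  then show ?thesis
    using preferring_le[of ps "cs ! j" "cs ! i"] unfolding weight_def by linarith
qed

text \<open>The exponent 5 is due to the weight matrix, whose loops contribute four factors
  \<open>m + 1\<close> and one factor \<open>n + 1\<close>. The later phases need at most
  \<open>N ^ 3\<close> times either \<open>2 ^ m\<close> or the number of kept prefixes, up to
  constants.\<close>

lemma exec_core_com:
  fixes cs ps H G
  defines "m \<equiv> length cs" and "n \<equiv> length ps" and "W \<equiv> weight H cs ps"
  assumes lay: "layout b cs ps s" and prof: "profile cs ps"
    and s: "s vH 0 = H" "s vG 0 = G" "s vR 0 = r" and KG: "K < G"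
    and e: "exp_weight e \<le> 50"
      "\<And>s'. s' aIn = s aIn \<Longrightarrow> s' vM 0 = m \<Longrightarrow> (\<forall>i\<le>m. s' aPow i = 2 ^ i) \<Longrightarrow>
        (\<forall>S<2 ^ m. s' aOpt S = opt_cost W G (bits_of S)) \<Longrightarrow> exp_val s' e = K"
    and L: "n * (m * m) < 2 ^ L" "n + H < 2 ^ L" "m < L" "G < 2 ^ L" "m * (n + H) < 2 ^ L"
      "m ^ m \<le> 2 ^ L" "r < 2 ^ L" "\<forall>x\<in>set cs. x < 2 ^ L" "1 + r * m < 2 ^ L"
    and N: "m + 1 \<le> N" "m \<noteq> 0 \<Longrightarrow> n + 1 \<le> N"
  shows "exec L (core_com e) (7000 * (2 ^ m * max 1 (min r (fact m)) * N ^ 5)) s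
    (\<lambda>s'. output_of s' = encode_rankings (map (ranking_of cs) (level W G K m r m)))"
proof -
  let ?c = "min r (fact m)"
  let ?lev = "level W G K m r m"
  let ?out = "\<lambda>s'. output_of s' = encode_rankings (map (ranking_of cs) ?lev)"
  \<comment> \<open>The maximum with 1 is for \<open>r = 0\<close>, where the table is still
    computed. Up to a factor 2, \<open>P\<close> dominates both the table size and the list
    length.\<close>
  define P where "P = 2 ^ m * max 1 ?c"
  have mL: "m < 2 ^ L" using less_trans[OF L(3) less_exp] .
  have w: "W i j \<le> n + H" for i j unfolding W_def n_def by (rule weight_le)
  have KL: "K < 2 ^ L" using KG L(4) by simp
  have levc: "length (level W G K m r l) \<le> ?c" if "l \<le> m" for l
    by (rule length_level_le[OF KG that])
  have levr: "length ?lev \<le> r" using levc[of m] by simp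
  have levL: "length ?lev < 2 ^ L" "1 + length ?lev * m < 2 ^ L"
  proof -
    show "length ?lev < 2 ^ L" using levr L(7) by simp
    have "length ?lev * m \<le> r * m" using levr by (rule mult_le_mono1)
    then show "1 + length ?lev * m < 2 ^ L" using L(9) by linarith
  qed
  define Y where "Y = P * N ^ 5"
  have P1: "1 \<le> P" "2 ^ m + 1 \<le> 2 * P" "?c + 1 \<le> 2 * P"
  proof -
    have "(1::nat) * 1 \<le> P" unfolding P_def by (intro mult_le_mono) auto
    then show "1 \<le> P" by simp
    have "(2::nat) ^ m * 1 \<le> P" unfolding P_def by (intro mult_le_mono) auto
    then show "2 ^ m + 1 \<le> 2 * P" using \<open>1 \<le> P\<close> by simp
    have "1 * max 1 ?c \<le> P" unfolding P_def by (intro mult_le_mono) auto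
    then show "?c + 1 \<le> 2 * P" using \<open>1 \<le> P\<close> by simp
  qed
  have N1: "1 \<le> N" "N \<le> N ^ 5" "N * N \<le> N ^ 5" "N * (N * N) \<le> N ^ 5" "N * (N * (N * (N * N))) = N ^ 5"
  proof -
    show "1 \<le> N" using N(1) by simp
    then show "N \<le> N ^ 5" "N * N \<le> N ^ 5" "N * (N * N) \<le> N ^ 5"
      using power_increasing[of 1 5 N] power_increasing[of 2 5 N] power_increasing[of 3 5 N]
      by (simp_all add: power2_eq_square power3_eq_cube mult.assoc)
    show "N * (N * (N * (N * N))) = N ^ 5" by (simp add: eval_nat_numeral)
  qed
  have Y: "N \<le> Y" "1 \<le> Y" "N ^ 5 \<le> Y" "\<And>x. x \<le> N ^ 5 \<Longrightarrow> (2 * P) * x \<le> 2 * Y"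
  proof -
    have "1 * N \<le> P * N ^ 5" using P1 N1 by (intro mult_le_mono) auto
    then show "N \<le> Y" unfolding Y_def by simp
    then show "1 \<le> Y" using N1 by simp
    have "1 * N ^ 5 \<le> P * N ^ 5" using P1 by (intro mult_le_mono) auto
    then show "N ^ 5 \<le> Y" unfolding Y_def by simp
    show "(2 * P) * x \<le> 2 * Y" if "x \<le> N ^ 5" for x
      using mult_le_mono2[OF that, of "2 * P"] unfolding Y_def by simp
  qed
  have T1: "100 * (m + 1) \<le> 100 * Y"
    using N(1) Y(1) by simp
  have T2: "1100 * ((m + 1) * ((m + 1) * ((n + 1) * ((m + 1) * (m + 1))))) \<le> 1100 * Y" if "m \<noteq> 0"
  proof (rule mult_le_mono2)
    have "(m + 1) * ((m + 1) * ((n + 1) * ((m + 1) * (m + 1)))) \<le> N * (N * (N * (N * N)))"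
      using N(1) N(2)[OF that] by (intro mult_le_mono)
    also have "\<dots> \<le> Y" using N1(5) Y(3) by simp
    finally show "(m + 1) * ((m + 1) * ((n + 1) * ((m + 1) * (m + 1)))) \<le> Y" .
  qed
  have T3: "700 * ((2 ^ m + 1) * ((m + 1) * (m + 1))) \<le> 700 * (2 * Y)"
  proof (rule mult_le_mono2)
    have "(2 ^ m + 1) * ((m + 1) * (m + 1)) \<le> (2 * P) * (N * N)"
      using P1 N(1) by (intro mult_le_mono)
    also have "\<dots> \<le> 2 * Y" using N1(3) by (rule Y(4))
    finally show "(2 ^ m + 1) * ((m + 1) * (m + 1)) \<le> 2 * Y" .
  qed
  have T4: "60 \<le> 60 * Y" using Y(2) by simp
  have T5: "1200 * ((m + 1) * ((?c + 1) * ((m + 1) * (m + 1)))) \<le> 1200 * (2 * Y)"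
  proof (rule mult_le_mono2)
    have "(m + 1) * ((?c + 1) * ((m + 1) * (m + 1))) \<le> N * ((2 * P) * (N * N))"
      using P1 N(1) by (intro mult_le_mono)
    also have "\<dots> = (2 * P) * (N * (N * N))" by (simp only: ac_simps)
    also have "\<dots> \<le> 2 * Y" using N1(4) by (rule Y(4))
    finally show "(m + 1) * ((?c + 1) * ((m + 1) * (m + 1))) \<le> 2 * Y" .
  qed
  have T6: "500 * ((length ?lev + 1) * (m + 1)) \<le> 500 * (2 * Y)"
  proof (rule mult_le_mono2)
    have "length ?lev + 1 \<le> 2 * P" by (rule le_trans[OF add_right_mono[OF levc[OF order_refl]] P1(3)])
    then have "(length ?lev + 1) * (m + 1) \<le> (2 * P) * N"
      using N(1) by (intro mult_le_mono)
    also have "\<dots> \<le> 2 * Y" using N1(2) by (rule Y(4))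
    finally show "(length ?lev + 1) * (m + 1) \<le> 2 * Y" .
  qed
  have vM: "s vM 0 = m" "s vB 0 = b" "s vN 0 = n" "\<forall>i<m. s aIn (b + i) = cs ! i"
    using lay by (simp_all add: layout_def m_def n_def)
  \<comment> \<open>The six phases add up to \<open>6060 * Y\<close>, which is rounded up to
    \<open>7000 * Y\<close> at the end.\<close>
  have "exec L (core_com e) (100 * Y + (1100 * Y + (700 * (2 * Y) + (60 * Y + (1200 * (2 * Y) + 500 * (2 * Y)))))) s ?out"
    unfolding core_com_def
  proof (rule exec_Seq'[OF exec_mono[OF exec_pow_com[where s = s, OF vM(1) L(3)] T1] _ order_refl])
    fix s1 assume 1: "same_outside {aPow, vI} s s1 \<and> (\<forall>i\<le>m. s1 aPow i = 2 ^ i)"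
    have lay1: "layout b cs ps s1" by (rule layout_cong[OF lay conjunct1[OF 1]]) simp
    have h1: "s1 vH 0 = H" using 1 s by (simp add: same_outside_def)
    have weights: "exec L weight_com (1100 * Y) s1 (\<lambda>s'.
      same_outside {vAcc, vQ, vP, vV, vJ, vI, aW} s1 s' \<and>
      (\<forall>i<m. \<forall>j<m. s' aW (i * m + j) = W i j))"
    proof (cases "m = 0")
      case True
      then have "s1 vM 0 = 0" using 1 vM by (simp add: same_outside_def)
      from exec_weight_com_0[where s = s1, OF this] show ?thesis
        by (rule exec_mono) (use T4 True in auto)
    next
      case False
      have "exec L weight_com (1100 * ((m + 1) * ((m + 1) * ((n + 1) * ((m + 1) * (m + 1)))))) s1 (\<lambda>s'.
          same_outside {vAcc, vQ, vP, vV, vJ, vI, aW} s1 s' \<and>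
          (\<forall>i<m. \<forall>j<m. s' aW (i * m + j) = W i j))"
        unfolding m_def n_def W_def
        by (rule exec_weight_com[OF lay1 prof h1 L(1)[unfolded m_def n_def] mL[unfolded m_def]
              L(2)[unfolded n_def]])
      then show ?thesis by (rule exec_mono[OF _ T2[OF False]])
    qed
    show "exec L (Seq weight_com (Seq opt_com (Seq (Store vK (Const 0) e) (Seq bfs_com out_com))))
        (1100 * Y + (700 * (2 * Y) + (60 * Y + (1200 * (2 * Y) + 500 * (2 * Y))))) s1 ?out"
    proof (rule exec_Seq'[OF weights _ order_refl])
      fix s2 assume 2: "same_outside {vAcc, vQ, vP, vV, vJ, vI, aW} s1 s2 \<and>
        (\<forall>i<m. \<forall>j<m. s2 aW (i * m + j) = W i j)"
      have tab2: "tables m W s2" using 1 2 vM by (simp add: tables_def same_outside_def)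
      have g2: "s2 vG 0 = G" using 1 2 s by (simp add: same_outside_def)
      show "exec L (Seq opt_com (Seq (Store vK (Const 0) e) (Seq bfs_com out_com)))
        (700 * (2 * Y) + (60 * Y + (1200 * (2 * Y) + 500 * (2 * Y)))) s2 ?out"
      proof (rule exec_Seq'[OF exec_mono[OF exec_opt_com[OF tab2 g2 w L(5,3,4)] T3] _ order_refl])
        fix s3 assume 3: "same_outside (insert vS XOpt) s2 s3 \<and>
          (\<forall>S<2 ^ m. s3 aOpt S = opt_cost W G (bits_of S))"
        have tab3: "tables m W s3" by (rule tables_cong[OF tab2 conjunct1[OF 3]]) simp
        have val3: "s3 aIn = s aIn" "s3 vM 0 = m" "s3 vB 0 = b" "s3 vR 0 = r"
          using 1 2 3 s vM by (simp_all add: same_outside_def)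
        have e3: "exp_val s3 e = K"
          using e(2)[OF val3(1,2)] tab3 3 by (simp add: tables_def)
        let ?s4 = "set_var s3 vK K"
        have env4: "search_env m W G K r ?s4"
          using tab3 3 val3 by (simp add: search_env_def tables_def)
        have "exec L (Seq bfs_com out_com) (1200 * (2 * Y) + 500 * (2 * Y)) ?s4 ?out"
        proof (rule exec_Seq'[OF exec_mono[OF exec_bfs_com[OF env4 KG w L(5,3,6) KL L(7) levc] T5] _ order_refl])
          fix s5 assume 5: "same_outside (XBfs \<union> {vI, vJ, vX, vCnt}) ?s4 s5 \<and>
            stored m r W m ?lev s5 \<and> s5 vCnt 0 = length ?lev"
          have val5: "s5 aIn = s aIn" "s5 vM 0 = m" "s5 vB 0 = b" "s5 vR 0 = r"
            using 5 val3 by (simp_all add: same_outside_def)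
          have lev5: "set zs \<subseteq> {..<m} \<and> length zs = m" if "zs \<in> set ?lev" for zs
            using set_level[OF KG order_refl that] by simp
          have in5: "\<forall>i<m. s5 aIn (b + i) = cs ! i" using vM(4) val5(1) by simp
          have "exec L out_com (500 * ((length ?lev + 1) * (m + 1))) s5 ?out"
            unfolding m_def
            by (rule exec_out_com[where b = b and r = r and W = W])
              (fact val5[unfolded m_def] conjunct2[OF conjunct2[OF 5], unfolded m_def]
                conjunct1[OF conjunct2[OF 5], unfolded m_def] in5[unfolded m_def] lev5[unfolded m_def]
                mL[unfolded m_def] L(6,8)[unfolded m_def] levL[unfolded m_def])+
          then show "exec L out_com (500 * (2 * Y)) s5 ?out"
            by (rule exec_mono[OF _ T6])
        qed
        then show "exec L (Seq (Store vK (Const 0) e) (Seq bfs_com out_com))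
          (60 * Y + (1200 * (2 * Y) + 500 * (2 * Y))) s3 ?out"
          by (rule exec_Store_Seq[rotated 3]) (use e3 KL e(1) T4 in simp_all)
      qed
    qed
  qed
  then have "exec L (core_com e) (7000 * Y) s ?out"
  proof (rule exec_mono)
    show "100 * Y + (1100 * Y + (700 * (2 * Y) + (60 * Y + (1200 * (2 * Y) + 500 * (2 * Y))))) \<le> 7000 * Y"
      by simp
  qed
  then show ?thesis unfolding Y_def P_def .
qed

section \<open>Initial memory and choice of the word width\<close>

lemma init_state_Suc: "i < length xs \<Longrightarrow> init_state xs aIn (Suc i) = xs ! i"
  by (simp add: init_state_def)

lemma init_state_layout:
  assumes prof: "profile cs ps" and xs: "xs = pre @ cs @ encode_rankings ps"
  defines "b \<equiv> Suc (length pre)" and "m \<equiv> length cs"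
  shows "\<forall>i<length pre. init_state xs aIn (Suc i) = pre ! i"
    and "\<forall>i<m. init_state xs aIn (b + i) = cs ! i"
    and "init_state xs aIn (b + m) = length ps"
    and "\<forall>v<length ps. \<forall>p<m. init_state xs aIn (b + m + 1 + v * m + p) = ps ! v ! p"
proof -
  have len: "length \<pi> = m" if "\<pi> \<in> set ps" for \<pi>
    using length_vote[OF prof that] by (simp add: m_def)
  have "xs = (pre @ cs @ [length ps]) @ concat ps" by (simp add: xs encode_rankings_def)
  note xs' = this
  show "\<forall>i<length pre. init_state xs aIn (Suc i) = pre ! i"
    by (auto simp: init_state_Suc xs nth_append)
  show "\<forall>i<m. init_state xs aIn (b + i) = cs ! i"
    by (auto simp: init_state_Suc xs nth_append b_def m_def)
  show "init_state xs aIn (b + m) = length ps"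
    by (simp add: init_state_Suc xs nth_append b_def m_def encode_rankings_def)
  show "\<forall>v<length ps. \<forall>p<m. init_state xs aIn (b + m + 1 + v * m + p) = ps ! v ! p"
  proof (intro allI impI)
    fix v p assume vp: "v < length ps" "p < m"
    let ?k = "v * m + p"
    have "Suc v * m \<le> length ps * m" using vp(1) by (intro mult_le_mono1) simp
    then have k: "?k < length (concat ps)"
      using vp(2) length_concat_uniform[of ps m] len by simp
    have "b + m + 1 + v * m + p = Suc (length (pre @ cs @ [length ps]) + ?k)"
      by (simp add: b_def m_def)
    then have "init_state xs aIn (b + m + 1 + v * m + p) = xs ! (length (pre @ cs @ [length ps]) + ?k)"
      using k by (simp only: init_state_Suc xs' length_append add_strict_left_mono)
    also have "\<dots> = concat ps ! ?k" unfolding xs' by (rule nth_append_length_plus)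
    also have "\<dots> = ps ! v ! p" using nth_concat_uniform[of ps m v p] len vp by simp
    finally show "init_state xs aIn (b + m + 1 + v * m + p) = ps ! v ! p" .
  qed
qed

lemma bits_le_sum_list: "x \<in> set xs \<Longrightarrow> bits x \<le> sum_list (map bits xs)"
  by (induction xs) auto

lemma length_le_sum_list_bits: "length xs \<le> sum_list (map bits xs)"
proof (induction xs)
  case (Cons x xs)
  then show ?case using bits_ge_1[of x] by simp
qed simp

lemma exec_computes:
  assumes "exec L P T (init_state xs) (\<lambda>s. output_of s = ys)" "bounded_mem L (init_state xs)"
  shows "\<exists>t. computes P xs t ys \<and> t \<le> T * L"
  using assms unfolding exec_def computes_def by blast

text \<open>The exponent 7 is 5 for the steps plus 2 for the word width. The constant is 8000 times
  5: raising 7000 to 8000 absorbs the 200 steps of loading, and \<open>L\<close> is at most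
  \<open>5 * N * N\<close>.\<close>

lemma computes_core_com:
  fixes cs ps H G pre
  defines "m \<equiv> length cs" and "n \<equiv> length ps" and "W \<equiv> weight H cs ps"
    and "xs \<equiv> pre @ cs @ encode_rankings ps"
  defines "N \<equiv> sum_list (map bits xs)"
  assumes prof: "profile cs ps"
    and ini: "exec (N * N + 4 * N) pre_com 200 (init_state xs) (\<lambda>s. layout b cs ps s \<and>
      s aIn = init_state xs aIn \<and> s vH 0 = H \<and> s vG 0 = G \<and> s vR 0 = r)"
    and KG: "K < G"
    and e: "exp_weight e \<le> 50"
      "\<And>s'. s' aIn = init_state xs aIn \<Longrightarrow> s' vM 0 = m \<Longrightarrow> (\<forall>i\<le>m. s' aPow i = 2 ^ i) \<Longrightarrow>
        (\<forall>S<2 ^ m. s' aOpt S = opt_cost W G (bits_of S)) \<Longrightarrow> exp_val s' e = K"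
    and bd: "G \<le> 2 ^ (3 * N)" "H \<le> 2 ^ N" "r < 2 ^ N"
  shows "\<exists>t. computes (Seq pre_com (core_com e)) xs t
      (encode_rankings (map (ranking_of cs) (level W G K m r m))) \<and>
    t \<le> 2 ^ m * max 1 (min r (fact m)) * (40000 * N ^ 7)"
proof -
  \<comment> \<open>With \<open>B = 2 ^ N\<close> the square accommodates
    \<open>m ^ m \<le> B ^ N\<close>. The linear part accommodates products of three quantities of
    size at most \<open>B\<close>, such as the cap, with a fourth factor \<open>B\<close> to make
    the inequalities strict.\<close>
  define L where "L = N * N + 4 * N"
  define B :: nat where "B = 2 ^ N"
  have len: "length xs \<le> N" unfolding N_def by (rule length_le_sum_list_bits)
  have mn: "length pre + m + 1 \<le> length xs" by (simp add: xs_def encode_rankings_def m_def)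
  then have m: "m + 1 \<le> N" and N1: "1 \<le> N" using len by simp_all
  have entry: "x < B" if "x \<in> set xs" for x
    using bits_le_iff[OF N1, of x] bits_le_sum_list[OF that] by (simp add: N_def B_def)
  have n: "n + 1 \<le> N" if "m \<noteq> 0"
  proof -
    have lens: "length \<pi> = m" if "\<pi> \<in> set ps" for \<pi>
      using length_vote[OF prof that] by (simp add: m_def)
    \<comment> \<open>A nonempty vote occupies at least one entry of the input, so the number of
      votes is at most the input length.\<close>
    have "n * 1 \<le> n * m" using that by (intro mult_le_mono2) simp
    then have "n \<le> length (concat ps)" using length_concat_uniform[of ps m] lens by (simp add: n_def)
    then have "n + 1 \<le> length xs" by (simp add: xs_def encode_rankings_def)
    then show ?thesis using len by simp
  qed
  have B2: "2 \<le> B" using power_increasing[of 1 N "2::nat"] N1 by (simp add: B_def)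
  have nB: "n < B" by (rule entry) (simp add: xs_def encode_rankings_def n_def)
  have mB: "m < B" using less_le_trans[OF _ less_imp_le[OF less_exp], of m N] m by (simp add: B_def)
  have rB: "r < B" "H \<le> B" using bd by (simp_all add: B_def)
  have B4: "B * B * B * B \<le> 2 ^ L"
  proof -
    have "B * B * B * B = 2 ^ (4 * N)" by (simp add: B_def power_mult power4_eq_xxxx mult.commute)
    also have "\<dots> \<le> 2 ^ L" by (rule power_increasing) (simp_all add: L_def)
    finally show ?thesis .
  qed
  have BB: "B + B \<le> B * B" "B * B * 1 \<le> B * B * B" "B * B * B * 1 < B * B * B * B" "1 * B \<le> B * B"
  proof -
    have "B + B = 2 * B" by simp
    also have "\<dots> \<le> B * B" using B2 by (rule mult_le_mono1)
    finally show "B + B \<le> B * B" .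
    show "B * B * 1 \<le> B * B * B" using B2 by (intro mult_le_mono2) simp
    show "B * B * B * 1 < B * B * B * B" using B2 by (intro mult_strict_left_mono) simp_all
    show "1 * B \<le> B * B" using B2 by (intro mult_le_mono1) simp
  qed
  have bound1: "n * (m * m) < 2 ^ L"
  proof -
    have "n * (m * m) \<le> B * (B * B)" using nB mB by (intro mult_le_mono) simp_all
    also have "\<dots> = B * B * B" by (simp only: mult.assoc)
    finally show ?thesis using BB B4 by linarith
  qed
  have bound2: "n + H < 2 ^ L" using nB rB BB B4 by linarith
  have bound3: "m < L" using m by (simp add: L_def)
  have bound4: "G < 2 ^ L"
  proof -
    have "2 ^ (3 * N) = B * B * B" by (simp add: B_def power_mult power3_eq_cube mult.commute)
    then show ?thesis using bd(1) BB B4 by linarith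
  qed
  have bound5: "m * (n + H) < 2 ^ L"
  proof -
    have "n + H \<le> B * B" using nB rB BB by linarith
    then have "m * (n + H) \<le> B * (B * B)" using mB by (intro mult_le_mono) simp_all
    also have "\<dots> = B * B * B" by (simp only: mult.assoc)
    finally show ?thesis using BB B4 by linarith
  qed
  have bound6: "m ^ m \<le> 2 ^ L"
  proof -
    have "m ^ m \<le> B ^ m" using mB by (intro power_mono) simp_all
    also have "\<dots> \<le> B ^ N" using m B2 by (intro power_increasing) simp_all
    also have "\<dots> = 2 ^ (N * N)" by (simp add: B_def power_mult)
    also have "\<dots> \<le> 2 ^ L" by (rule power_increasing) (simp_all add: L_def)
    finally show ?thesis .
  qed
  have BL: "B < 2 ^ L" using BB B4 B2 by linarith
  have bound8: "\<forall>x\<in>set cs. x < 2 ^ L"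
    using entry BL by (auto simp: xs_def intro: less_trans)
  have bound9: "1 + r * m < 2 ^ L"
  proof -
    have "r * m < B * B" using rB mB by (intro mult_strict_mono) simp_all
    then show ?thesis using BB B4 by linarith
  qed
  have mem: "bounded_mem L (init_state xs)"
    unfolding bounded_mem_def
  proof (intro conjI allI)
    show "1 \<le> L" using N1 by (simp add: L_def)
    fix a i
    have "init_state xs a i \<in> insert 0 (set (length xs # xs))"
      using nth_mem[of i "length xs # xs"] by (simp only: init_state_def) simp
    moreover have "length xs < 2 ^ L" using len less_exp[of N] BL unfolding B_def by linarith
    ultimately show "init_state xs a i < 2 ^ L"
      using entry BL by (auto intro: less_trans)
  qed
  note bounds = bound1[unfolded m_def n_def] bound2[unfolded n_def] bound3[unfolded m_def] bound4
    bound5[unfolded m_def n_def] bound6[unfolded m_def] less_trans[OF rB(1) BL] bound8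
    bound9[unfolded m_def] m[unfolded m_def] n[unfolded m_def n_def]
  let ?Y = "2 ^ m * max 1 (min r (fact m))"
  have "exec L (Seq pre_com (core_com e)) (200 + 7000 * (?Y * N ^ 5)) (init_state xs)
    (\<lambda>s'. output_of s' = encode_rankings (map (ranking_of cs) (level W G K m r m)))"
  proof (rule exec_Seq'[OF ini[folded L_def] _ order_refl])
    fix s assume s: "layout b cs ps s \<and> s aIn = init_state xs aIn \<and> s vH 0 = H \<and> s vG 0 = G \<and> s vR 0 = r"
    show "exec L (core_com e) (7000 * (?Y * N ^ 5)) s
      (\<lambda>s'. output_of s' = encode_rankings (map (ranking_of cs) (level W G K m r m)))"
      unfolding m_def n_def W_def
    proof (rule exec_core_com[where b = b, OF _ prof _ _ _ KG e(1)])
      show "exp_val s' e = K" if "s' aIn = s aIn" "s' vM 0 = length cs"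
        "\<forall>i\<le>length cs. s' aPow i = 2 ^ i"
        "\<forall>S<2 ^ length cs. s' aOpt S = opt_cost (weight H cs ps) G (bits_of S)" for s'
        by (rule e(2)) (use that s in \<open>simp_all add: m_def W_def\<close>)
    qed (fact bounds | use s in simp)+
  qed
  from exec_computes[OF this mem] obtain t where
    t: "computes (Seq pre_com (core_com e)) xs t
      (encode_rankings (map (ranking_of cs) (level W G K m r m)))"
    "t \<le> (200 + 7000 * (?Y * N ^ 5)) * L" by blast
  have "(200 + 7000 * (?Y * N ^ 5)) * L \<le> (8000 * (?Y * N ^ 5)) * (5 * (N * N))"
  proof (rule mult_le_mono)
    have "1 * 1 * 1 \<le> ?Y * N ^ 5" using N1 by (intro mult_le_mono) simp_all
    then show "200 + 7000 * (?Y * N ^ 5) \<le> 8000 * (?Y * N ^ 5)" by linarith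
    have "N * 1 \<le> N * N" using N1 by (intro mult_le_mono2)
    then show "L \<le> 5 * (N * N)" by (simp add: L_def)
  qed
  also have "\<dots> = ?Y * (40000 * N ^ 7)"
  proof -
    have "N ^ 7 = N ^ (5 + 2)" by simp
    also have "\<dots> = N ^ 5 * (N * N)" by (simp only: power_add power2_eq_square)
    finally show ?thesis by simp
  qed
  finally show ?thesis using t le_trans by blast
qed

section \<open>Loading the two input formats\<close>

definition dkra_load :: com where
  "dkra_load =
     Seq (Store vM (Const 0) (Load aIn (Const 3)))
    (Seq (Store vR (Const 0) (Load aIn (Const 2)))
    (Seq (Store vB (Const 0) (Const 4))
    (Seq (Store vN (Const 0) (Load aIn (Const 4 \<oplus> Var vM)))
    (Seq (Store vG (Const 0) (Load aIn (Const 1) \<oplus> Const 1))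
         (Store vH (Const 0) (Load aIn (Const 1) \<oplus> Const 1))))))"

definition dkra_com :: com where
  "dkra_com = Seq dkra_load (core_com (Load aIn (Const 1)))"

text \<open>Without \<open>k\<close> in front, everything sits one place earlier. The penalty is
  switched off, and the cap is one more than the largest score that \<open>rcost_le\<close>
  allows.\<close>

definition dokra_load :: com where
  "dokra_load =
     Seq (Store vM (Const 0) (Load aIn (Const 2)))
    (Seq (Store vR (Const 0) (Load aIn (Const 1)))
    (Seq (Store vB (Const 0) (Const 3))
    (Seq (Store vN (Const 0) (Load aIn (Const 3 \<oplus> Var vM)))
    (Seq (Store vG (Const 0) (Var vN \<otimes> Var vM \<otimes> Var vM \<oplus> Const 1))
         (Store vH (Const 0) (Const 0))))))"

text \<open>The code of the full candidate set is \<open>2 ^ m - 1\<close>, so the threshold is the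
  optimum itself.\<close>

definition dokra_com :: com where
  "dokra_com = Seq dokra_load (core_com (Load aOpt (Load aPow (Var vM) \<ominus> Const 1)))"

text \<open>Index 0 of the input array holds the length of the input. Hence \<open>k\<close>,
  \<open>r\<close> and \<open>m\<close> are found at 1, 2 and 3, and the candidates begin at
  4.\<close>

lemma exec_dkra_load:
  assumes "\<forall>i<length cs. s aIn (4 + i) = cs ! i" "s aIn 1 = k" "s aIn 2 = r" "s aIn 3 = length cs"
    "s aIn (4 + length cs) = length ps"
    "\<forall>v<length ps. \<forall>p<length cs. s aIn (4 + length cs + 1 + v * length cs + p) = ps ! v ! p"
    and "length cs < 2 ^ L" "length ps < 2 ^ L" "r < 2 ^ L" "Suc k < 2 ^ L" "4 < (2::nat) ^ L"
  shows "exec L dkra_load 200 s (\<lambda>s'. layout 4 cs ps s' \<and> s' aIn = s aIn \<and>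
    s' vH 0 = Suc k \<and> s' vG 0 = Suc k \<and> s' vR 0 = r)" (is "exec _ _ _ _ ?Q")
proof -
  let ?s1 = "s(vM := (s vM)(0 := length cs))"
  let ?s2 = "?s1(vR := (?s1 vR)(0 := r))"
  let ?s3 = "?s2(vB := (?s2 vB)(0 := 4))"
  let ?s4 = "?s3(vN := (?s3 vN)(0 := length ps))"
  let ?s5 = "?s4(vG := (?s4 vG)(0 := Suc k))"
  have Q: "?Q (?s5(vH := (?s5 vH)(0 := Suc k)))"
    using assms by (simp add: layout_def)
  have 6: "exec L (Store vH (Const 0) (Load aIn (Const 1) \<oplus> Const 1)) 20 ?s5 ?Q"
    by (rule exec_Store'[where i = 0 and v = "Suc k"]) (rule Q | use assms in simp)+
  have 5: "exec L (Seq (Store vG (Const 0) (Load aIn (Const 1) \<oplus> Const 1))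
      (Store vH (Const 0) (Load aIn (Const 1) \<oplus> Const 1))) 40 ?s4 ?Q"
    by (rule exec_Store_Seq[OF _ _ _ 6]) (use assms in simp_all)
  have 4: "exec L (Seq (Store vN (Const 0) (Load aIn (Const 4 \<oplus> Var vM)))
    (Seq (Store vG (Const 0) (Load aIn (Const 1) \<oplus> Const 1))
      (Store vH (Const 0) (Load aIn (Const 1) \<oplus> Const 1)))) 70 ?s3 ?Q"
    by (rule exec_Store_Seq[OF _ _ _ 5]) (use assms in simp_all)
  have 3: "exec L (Seq (Store vB (Const 0) (Const 4))
    (Seq (Store vN (Const 0) (Load aIn (Const 4 \<oplus> Var vM)))
    (Seq (Store vG (Const 0) (Load aIn (Const 1) \<oplus> Const 1))
      (Store vH (Const 0) (Load aIn (Const 1) \<oplus> Const 1))))) 100 ?s2 ?Q"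
    by (rule exec_Store_Seq[OF _ _ _ 4]) (use assms in simp_all)
  have 2: "exec L (Seq (Store vR (Const 0) (Load aIn (Const 2)))
    (Seq (Store vB (Const 0) (Const 4))
    (Seq (Store vN (Const 0) (Load aIn (Const 4 \<oplus> Var vM)))
    (Seq (Store vG (Const 0) (Load aIn (Const 1) \<oplus> Const 1))
      (Store vH (Const 0) (Load aIn (Const 1) \<oplus> Const 1)))))) 130 ?s1 ?Q"
    by (rule exec_Store_Seq[OF _ _ _ 3]) (use assms in simp_all)
  show ?thesis
    unfolding dkra_load_def
    by (rule exec_Store_Seq[OF _ _ _ 2]) (use assms in simp_all)
qed

lemma exec_dokra_load:
  assumes "\<forall>i<length cs. s aIn (3 + i) = cs ! i" "s aIn 1 = r" "s aIn 2 = length cs"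
    "s aIn (3 + length cs) = length ps"
    "\<forall>v<length ps. \<forall>p<length cs. s aIn (3 + length cs + 1 + v * length cs + p) = ps ! v ! p"
    and "length cs < 2 ^ L" "length ps < 2 ^ L" "r < 2 ^ L"
    and "length ps * length cs * length cs + 1 < 2 ^ L" "4 < (2::nat) ^ L"
  shows "exec L dokra_load 200 s (\<lambda>s'. layout 3 cs ps s' \<and> s' aIn = s aIn \<and>
    s' vH 0 = 0 \<and> s' vG 0 = length ps * length cs * length cs + 1 \<and> s' vR 0 = r)" (is "exec _ _ _ _ ?Q")
proof -
  let ?G = "length ps * length cs * length cs + 1"
  let ?s1 = "s(vM := (s vM)(0 := length cs))"
  let ?s2 = "?s1(vR := (?s1 vR)(0 := r))"
  let ?s3 = "?s2(vB := (?s2 vB)(0 := 3))"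
  let ?s4 = "?s3(vN := (?s3 vN)(0 := length ps))"
  let ?s5 = "?s4(vG := (?s4 vG)(0 := ?G))"
  have Q: "?Q (?s5(vH := (?s5 vH)(0 := 0)))"
    using assms by (simp add: layout_def)
  have 6: "exec L (Store vH (Const 0) (Const 0)) 20 ?s5 ?Q"
    by (rule exec_Store'[where i = 0 and v = 0]) (rule Q | use assms in simp)+
  have 5: "exec L (Seq (Store vG (Const 0) (Var vN \<otimes> Var vM \<otimes> Var vM \<oplus> Const 1))
      (Store vH (Const 0) (Const 0))) 60 ?s4 ?Q"
    by (rule exec_Store_Seq[OF _ _ _ 6]) (use assms in simp_all)
  have 4: "exec L (Seq (Store vN (Const 0) (Load aIn (Const 3 \<oplus> Var vM)))
    (Seq (Store vG (Const 0) (Var vN \<otimes> Var vM \<otimes> Var vM \<oplus> Const 1))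
      (Store vH (Const 0) (Const 0)))) 90 ?s3 ?Q"
    by (rule exec_Store_Seq[OF _ _ _ 5]) (use assms in simp_all)
  have 3: "exec L (Seq (Store vB (Const 0) (Const 3))
    (Seq (Store vN (Const 0) (Load aIn (Const 3 \<oplus> Var vM)))
    (Seq (Store vG (Const 0) (Var vN \<otimes> Var vM \<otimes> Var vM \<oplus> Const 1))
      (Store vH (Const 0) (Const 0))))) 110 ?s2 ?Q"
    by (rule exec_Store_Seq[OF _ _ _ 4]) (use assms in simp_all)
  have 2: "exec L (Seq (Store vR (Const 0) (Load aIn (Const 1)))
    (Seq (Store vB (Const 0) (Const 3))
    (Seq (Store vN (Const 0) (Load aIn (Const 3 \<oplus> Var vM)))
    (Seq (Store vG (Const 0) (Var vN \<otimes> Var vM \<otimes> Var vM \<oplus> Const 1))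
      (Store vH (Const 0) (Const 0)))))) 140 ?s1 ?Q"
    by (rule exec_Store_Seq[OF _ _ _ 3]) (use assms in simp_all)
  show ?thesis
    unfolding dokra_load_def
    by (rule exec_Store_Seq[OF _ _ _ 2]) (use assms in simp_all)
qed

lemma encode_bounds:
  fixes pre cs ps
  defines "xs \<equiv> pre @ cs @ encode_rankings ps"
  defines "N \<equiv> sum_list (map bits xs)"
  assumes "pre \<noteq> []"
  shows "2 \<le> N" "length cs < 2 ^ N" "length ps < 2 ^ N" "\<And>x. x \<in> set pre \<Longrightarrow> x < 2 ^ N"
proof -
  have len: "length pre + length cs + 1 \<le> N"
    using length_le_sum_list_bits[of xs] unfolding N_def by (simp add: xs_def encode_rankings_def)
  have "1 \<le> length pre" using assms(3) by (cases pre) auto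
  then show N: "2 \<le> N" using len by simp
  have entry: "x < 2 ^ N" if "x \<in> set xs" for x
    using bits_le_iff[of N x] bits_le_sum_list[OF that] N by (simp add: N_def)
  show "length cs < 2 ^ N" using len less_exp[of N] by linarith
  show "length ps < 2 ^ N" by (rule entry) (simp add: xs_def encode_rankings_def)
  show "x < 2 ^ N" if "x \<in> set pre" for x by (rule entry) (use that in \<open>simp add: xs_def\<close>)
qed

lemma two_power_less_word_size:
  fixes N :: nat
  assumes "2 \<le> N"
  shows "(2::nat) ^ N < 2 ^ (N * N + 4 * N)" "(2::nat) ^ (3 * N) < 2 ^ (N * N + 4 * N)"
    "4 < (2::nat) ^ (N * N + 4 * N)"
proof -
  show a: "(2::nat) ^ N < 2 ^ (N * N + 4 * N)" "(2::nat) ^ (3 * N) < 2 ^ (N * N + 4 * N)"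
    using assms by simp_all
  have "(4::nat) \<le> 2 ^ N" using power_increasing[of 2 N "2::nat"] assms by simp
  then show "4 < (2::nat) ^ (N * N + 4 * N)" using a(1) by linarith
qed

section \<open>Correctness and running time of the two programs\<close>

lemma dkra_com_correct:
  assumes prof: "profile cs ps"
  shows "\<exists>t ys. computes dkra_com (encode DKRA (cs, ps, k, r)) t ys \<and> answer DKRA (cs, ps, k, r) ys \<and>
    t \<le> 2 ^ card (set cs) * max 1 (min r (fact (card (set cs))))
      * (40000 * input_size DKRA (cs, ps, k, r) ^ 7)"
proof -
  let ?pre = "[k, r, length cs]"
  let ?xs = "?pre @ cs @ encode_rankings ps"
  let ?N = "sum_list (map bits ?xs)"
  let ?m = "length cs"
  let ?Qs = "map (ranking_of cs) (level (weight (Suc k) cs ps) (Suc k) k ?m r ?m)"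
  have card: "card (set cs) = ?m" using prof by (simp add: profile_def distinct_card)
  have enc: "encode DKRA (cs, ps, k, r) = ?xs" by (simp add: DKRA_def)
  have size: "input_size DKRA (cs, ps, k, r) = ?N" by (simp only: input_size_def enc)
  have bd: "2 \<le> ?N" "?m < 2 ^ ?N" "length ps < 2 ^ ?N" "k < 2 ^ ?N" "r < 2 ^ ?N"
    using encode_bounds[where pre = ?pre and cs = cs and ps = ps] by auto
  note pw = two_power_less_word_size[OF bd(1)]
  note lay = init_state_layout[where pre = ?pre, OF prof refl]
  have in1: "init_state ?xs aIn 1 = k" "init_state ?xs aIn 2 = r" "init_state ?xs aIn 3 = ?m"
    using lay(1) by (simp_all add: eval_nat_numeral)
  have ini: "exec (?N * ?N + 4 * ?N) dkra_load 200 (init_state ?xs) (\<lambda>s. layout 4 cs ps s \<and>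
    s aIn = init_state ?xs aIn \<and> s vH 0 = Suc k \<and> s vG 0 = Suc k \<and> s vR 0 = r)"
  proof (rule exec_dkra_load)
    have b: "Suc (length ?pre) = 4" by simp
    show "\<forall>i<?m. init_state ?xs aIn (4 + i) = cs ! i" using lay(2)[unfolded b] .
    show "init_state ?xs aIn (4 + ?m) = length ps" using lay(3)[unfolded b] .
    show "\<forall>v<length ps. \<forall>p<?m. init_state ?xs aIn (4 + ?m + 1 + v * ?m + p) = ps ! v ! p"
      using lay(4)[unfolded b] .
  qed (use in1 bd pw in linarith)+
  have "\<exists>t. computes dkra_com ?xs t (encode_rankings ?Qs) \<and>
    t \<le> 2 ^ ?m * max 1 (min r (fact ?m)) * (40000 * ?N ^ 7)"
    unfolding dkra_com_def
  proof (rule computes_core_com[OF prof ini])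
    show "exp_val s' (Load aIn (Const 1)) = k" if "s' aIn = init_state ?xs aIn" for s'
      using that in1 by simp
    have "(2::nat) ^ ?N \<le> 2 ^ (3 * ?N)" by (rule power_increasing) simp_all
    then show "Suc k \<le> 2 ^ (3 * ?N)" using bd(4) by linarith
  qed (use bd in simp_all)
  moreover have "answer DKRA (cs, ps, k, r) (encode_rankings ?Qs)"
    using dkra_answer_level[OF prof, of k r] by (auto simp: DKRA_def)
  ultimately show ?thesis unfolding enc size card by blast
qed

lemma dokra_com_correct:
  assumes prof: "profile cs ps"
  shows "\<exists>t ys. computes dokra_com (encode DOKRA (cs, ps, r)) t ys \<and> answer DOKRA (cs, ps, r) ys \<and>
    t \<le> 2 ^ card (set cs) * max 1 (min r (fact (card (set cs))))
      * (40000 * input_size DOKRA (cs, ps, r) ^ 7)"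
proof -
  let ?pre = "[r, length cs]"
  let ?xs = "?pre @ cs @ encode_rankings ps"
  let ?N = "sum_list (map bits ?xs)"
  let ?m = "length cs"
  let ?W = "weight 0 cs ps"
  let ?G = "length ps * ?m * ?m + 1"
  let ?K = "opt_cost ?W ?G {..<?m}"
  let ?Qs = "map (ranking_of cs) (level ?W ?G ?K ?m r ?m)"
  have card: "card (set cs) = ?m" using prof by (simp add: profile_def distinct_card)
  have enc: "encode DOKRA (cs, ps, r) = ?xs" by (simp add: DOKRA_def)
  have size: "input_size DOKRA (cs, ps, r) = ?N" by (simp only: input_size_def enc)
  have bd: "2 \<le> ?N" "?m < 2 ^ ?N" "length ps < 2 ^ ?N" "r < 2 ^ ?N"
    using encode_bounds[where pre = ?pre and cs = cs and ps = ps] by auto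
  note pw = two_power_less_word_size[OF bd(1)]
  have G: "?G \<le> 2 ^ (3 * ?N)"
  proof -
    have "length ps * ?m * ?m < 2 ^ ?N * 2 ^ ?N * 2 ^ ?N"
      using bd by (intro mult_strict_mono mult_strict_mono') simp_all
    also have "\<dots> = 2 ^ (3 * ?N)" by (simp only: power_add[symmetric]) simp
    finally show ?thesis by linarith
  qed
  note lay = init_state_layout[where pre = ?pre, OF prof refl]
  have in1: "init_state ?xs aIn 1 = r" "init_state ?xs aIn 2 = ?m"
    using lay(1) by (simp_all add: eval_nat_numeral)
  have ini: "exec (?N * ?N + 4 * ?N) dokra_load 200 (init_state ?xs) (\<lambda>s. layout 3 cs ps s \<and>
    s aIn = init_state ?xs aIn \<and> s vH 0 = 0 \<and> s vG 0 = ?G \<and> s vR 0 = r)"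
  proof (rule exec_dokra_load)
    have b: "Suc (length ?pre) = 3" by simp
    show "\<forall>i<?m. init_state ?xs aIn (3 + i) = cs ! i" using lay(2)[unfolded b] .
    show "init_state ?xs aIn (3 + ?m) = length ps" using lay(3)[unfolded b] .
    show "\<forall>v<length ps. \<forall>p<?m. init_state ?xs aIn (3 + ?m + 1 + v * ?m + p) = ps ! v ! p"
      using lay(4)[unfolded b] .
  qed (use in1 bd pw G in linarith)+
  have "\<exists>t. computes dokra_com ?xs t (encode_rankings ?Qs) \<and>
    t \<le> 2 ^ ?m * max 1 (min r (fact ?m)) * (40000 * ?N ^ 7)"
    unfolding dokra_com_def
  proof (rule computes_core_com[OF prof ini])
    show "?K < ?G" by (rule dokra_answer_level(1)[OF prof])
    show "exp_val s' (Load aOpt (Load aPow (Var vM) \<ominus> Const 1)) = ?K"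
      if "s' vM 0 = ?m" "\<forall>i\<le>?m. s' aPow i = 2 ^ i"
        "\<forall>S<2 ^ ?m. s' aOpt S = opt_cost ?W ?G (bits_of S)" for s'
    proof -
      have "2 ^ ?m - 1 < (2::nat) ^ ?m" by simp
      then have "s' aOpt (2 ^ ?m - 1) = ?K" using that(3) bits_of_full[of ?m] by metis
      then show ?thesis using that(1,2) by simp
    qed
    show "?G \<le> 2 ^ (3 * ?N)" by (rule G)
  qed (use bd in simp_all)
  moreover have "answer DOKRA (cs, ps, r) (encode_rankings ?Qs)"
    using dokra_answer_level(2)[OF prof, of r] by (auto simp: DOKRA_def)
  ultimately show ?thesis unfolding enc size card by blast
qed

section \<open>Computability of the parameter function\<close>

definition fpt_bound_com :: com where
  "fpt_bound_com =
     Seq (Store vT (Const 0) (Const 1))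
    (Seq (For vI (Load aIn (Const 1)) (Store vT (Const 0) (Var vT \<otimes> Const 2 \<otimes> (Var vI \<oplus> Const 1))))
    (Seq (Store aOut (Const 1) (Var vT)) (Store aOut (Const 0) (Const 1))))"

text \<open>Round \<open>i\<close> contributes the factor \<open>2 * (i + 1)\<close>, so power and
  factorial are built up together.\<close>

lemma computable_fpt_bound: "computable (\<lambda>n. 2 ^ n * fact n)"
  unfolding computable_def
proof (intro exI[of _ fpt_bound_com] allI)
  fix n :: nat
  define f :: "nat \<Rightarrow> nat" where "f = (\<lambda>n. 2 ^ n * fact n)"
  \<comment> \<open>Computability sets no time limit, so the width may be as large as the result
    itself.\<close>
  define L where "L = f n + n + 5"
  have f_mono: "f i \<le> f n" if "i \<le> n" for i
    unfolding f_def using that by (intro mult_le_mono power_increasing fact_mono_nat) simp_all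
  have L: "f n + n + 5 < 2 ^ L" using less_exp[of L] unfolding L_def .
  have "1 \<le> L" by (simp add: L_def)
  have fL: "f i < 2 ^ L" if "i \<le> n" for i using f_mono[OF that] L by linarith
  have oneL: "1 < (2::nat) ^ L" "n < 2 ^ L" using L by linarith+
  have f_Suc: "f (Suc i) = f i * 2 * (i + 1)" for i by (simp add: f_def algebra_simps)
  let ?s = "init_state [n]"
  let ?out = "\<lambda>s. output_of s = [f n]"
  let ?I = "\<lambda>i s. s aIn 1 = n \<and> s vT 0 = f i"
  let ?end = "Seq (Store aOut (Const 1) (Var vT)) (Store aOut (Const 0) (Const 1))"
  let ?loop = "For vI (Load aIn (Const 1)) (Store vT (Const 0) (Var vT \<otimes> Const 2 \<otimes> (Var vI \<oplus> Const 1)))"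
  have n1: "?s aIn 1 = n" by (simp add: init_state_def)
  have ending: "exec L ?end 50 s ?out" if "?I n s" for s
  proof -
    let ?s1 = "s(aOut := (s aOut)(1 := f n))"
    have "?out (?s1(aOut := (?s1 aOut)(0 := 1)))" by (simp add: output_of_def)
    then have "exec L (Store aOut (Const 0) (Const 1)) 20 ?s1 ?out"
      by (intro exec_Store'[where i = 0 and v = 1]) (use oneL in simp_all)
    then show ?thesis
      by (rule exec_Store_Seq[rotated 3]) (use that fL in simp_all)
  qed
  have loop: "exec L ?loop ((n + 1) * 100) (set_var ?s vT 1) (?I n)"
  proof (rule exec_For[where I = ?I and n = n and T = 50])
    fix i :: nat and s :: state
    assume "i < n" "?I i s" "s vI 0 = i"
    then show "exec L (Store vT (Const 0) (Var vT \<otimes> Const 2 \<otimes> (Var vI \<oplus> Const 1))) 50 s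
        (\<lambda>s'. s' vI 0 = i \<and> ?I (Suc i) (set_var s' vI (Suc i)))"
      using fL[of "Suc i"]
      by (intro exec_Store'[where i = 0 and v = "f (Suc i)"]) (simp_all add: f_Suc)
  qed (use n1 oneL in \<open>simp_all add: f_def\<close>)
  have "exec L fpt_bound_com ((n + 1) * 100 + 70) ?s ?out"
    unfolding fpt_bound_com_def
  proof (rule exec_Store_Seq)
    show "exec L (Seq ?loop ?end) ((n + 1) * 100 + 50) (set_var ?s vT 1) ?out"
      by (rule exec_Seq'[OF loop ending order_refl])
  qed (use oneL in simp_all)
  moreover have "bounded_mem L ?s"
    using oneL \<open>1 \<le> L\<close> by (auto simp: bounded_mem_def init_state_def nth_Cons split: nat.split)
  ultimately have "\<exists>t. computes fpt_bound_com [n] t [f n]"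
    using exec_computes by blast
  then show "\<exists>t. computes fpt_bound_com [n] t [2 ^ n * fact n]" by (simp only: f_def)
qed

theorem theorem2:
  shows "(\<exists>P c (q :: nat poly).
            solves_in_time P DKRA
              (\<lambda>(cs, ps, k, r).
                 2 ^ card (set cs) * max 1 r ^ c * poly q (input_size DKRA (cs, ps, k, r))))
       \<and> fpt DKRA (\<lambda>(cs, ps, k, r). card (set cs))
       \<and> fpt DOKRA (\<lambda>(cs, ps, r). card (set cs))"
proof (intro conjI)
  define q :: "nat poly" where "q = monom 40000 7"
  have q: "poly q N = 40000 * N ^ 7" for N by (simp add: q_def poly_monom)
  have weaken: "\<exists>t ys. A t ys \<and> B ys \<and> t \<le> T'"
    if "\<exists>t ys. A t ys \<and> B ys \<and> t \<le> T" "T \<le> T'" for A B and T T' :: nat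
    using that le_trans by blast
  \<comment> \<open>Relaxing the minimum to its first argument gives the bound in \<open>r\<close>,
    with exponent 1; relaxing it to the second one gives the bound in \<open>m\<close>.\<close>
  have max_r: "2 ^ m * max 1 (min r (fact m)) * x \<le> 2 ^ m * max 1 r ^ 1 * x" for m r x :: nat
    by (intro mult_le_mono) auto
  \<comment> \<open>The factorial is positive and so absorbs the maximum with 1.\<close>
  have max_fact: "2 ^ m * max 1 (min r (fact m)) * x \<le> 2 ^ m * fact m * x" for m r x :: nat
    by (intro mult_le_mono) (auto simp: Suc_le_eq)
  have dkra: "profile cs ps" if "(cs, ps, k, r) \<in> instances DKRA" for cs ps k r
    using that by (simp add: DKRA_def)
  have dokra: "profile cs ps" if "(cs, ps, r) \<in> instances DOKRA" for cs ps r
    using that by (simp add: DOKRA_def)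
  have "solves_in_time dkra_com DKRA (\<lambda>(cs, ps, k, r).
      2 ^ card (set cs) * max 1 r ^ 1 * poly q (input_size DKRA (cs, ps, k, r)))"
    unfolding solves_in_time_def q
    by (clarsimp simp only: split_paired_Ball_Sigma) (rule weaken[OF dkra_com_correct[OF dkra] max_r])
  then show "\<exists>P c (q :: nat poly). solves_in_time P DKRA (\<lambda>(cs, ps, k, r).
      2 ^ card (set cs) * max 1 r ^ c * poly q (input_size DKRA (cs, ps, k, r)))"
    by blast
  have "solves_in_time dkra_com DKRA (\<lambda>x. (\<lambda>n. 2 ^ n * fact n) ((\<lambda>(cs, ps, k, r). card (set cs)) x)
      * poly q (input_size DKRA x))"
    unfolding solves_in_time_def q
  proof
    fix x assume "x \<in> instances DKRA"
    moreover obtain cs ps k r where "x = (cs, ps, k, r)" by (cases x) auto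
    ultimately show "\<exists>t ys. computes dkra_com (encode DKRA x) t ys \<and> answer DKRA x ys \<and>
        t \<le> (\<lambda>n. 2 ^ n * fact n) ((\<lambda>(cs, ps, k, r). card (set cs)) x) * (40000 * input_size DKRA x ^ 7)"
      using weaken[OF dkra_com_correct[OF dkra] max_fact] by simp
  qed
  then show "fpt DKRA (\<lambda>(cs, ps, k, r). card (set cs))"
    unfolding fpt_def using computable_fpt_bound by blast
  have "solves_in_time dokra_com DOKRA (\<lambda>x. (\<lambda>n. 2 ^ n * fact n) ((\<lambda>(cs, ps, r). card (set cs)) x)
      * poly q (input_size DOKRA x))"
    unfolding solves_in_time_def q
  proof
    fix x assume "x \<in> instances DOKRA"
    moreover obtain cs ps r where "x = (cs, ps, r)" by (cases x) auto
    ultimately show "\<exists>t ys. computes dokra_com (encode DOKRA x) t ys \<and> answer DOKRA x ys \<and>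
        t \<le> (\<lambda>n. 2 ^ n * fact n) ((\<lambda>(cs, ps, r). card (set cs)) x) * (40000 * input_size DOKRA x ^ 7)"
      using weaken[OF dokra_com_correct[OF dokra] max_fact] by simp
  qed
  then show "fpt DOKRA (\<lambda>(cs, ps, r). card (set cs))"
    unfolding fpt_def using computable_fpt_bound by blast
qed

end
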